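(* Let $(X,\mathsf d,\mathfrak m)$ be a metric-measure space satisfying the standing assumptions of the context, and suppose that its heat semigroup satisfies the $\mathrm L^\infty$-to-$\mathrm{Lip}$ contraction property with a Borel function $\mathsf c\colon(0,\infty)\to(0,\infty)$, $\mathsf c\in \mathrm L^1_{\rm loc}([0,\infty))$. Assume that there are $M\in[0,\infty)$ and $b\in(0,1)$ with $\mathsf c(t)\le M t^{-b}$ for all $t\in(0,1]$. Then for every $\tilde\lambda>0$ there exists a constant $C=C(M,b,\tilde\lambda)>0$ such that $$\mathsf{Per}(\{f_\lambda>0\})\ \ge\ C\,\lambda^{1-b}\,\frac{\|f_\lambda\|_{\mathrm L^1}}{\|f_\lambda\|_{\mathrm L^\infty}}$$ for every $\lambda$-eigenfunction $f_\lambda$ with $\lambda\ge\tilde\lambda$.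
   Context: Standing assumptions: $(X,\mathsf d)$ is a complete and separable metric space; $\mathfrak m$ is a non-negative Borel-regular measure on $X$ with $\operatorname{supp}\mathfrak m=X$, and there exist $A,B>0$ and $\bar x\in X$ such that $\mathfrak m(\{x:\mathsf d(x,\bar x)<r\})\le Ae^{Br^2}$ for all $r>0$; and $(X,\mathsf d,\mathfrak m)$ is infinitesimally Hilbertian, i.e. $2\mathsf{Ch}(f)+2\mathsf{Ch}(g)=\mathsf{Ch}(f+g)+\mathsf{Ch}(f-g)$ for all $f,g\in \mathrm W^{1,2}(X)$. Notation: $\mathrm L^p=\mathrm L^p(X,\mathfrak m)$ (real-valued); the norms $\|\cdot\|_{\mathrm L^p}$ are defined, possibly equal to $\infty$, on all $\mathfrak m$-measurable functions. $\mathrm{Lip}(X)$, $\mathrm{Lip}_b(X)$, $\mathrm{Lip}_{bs}(X)$ are the Lipschitz functions on $X$ that are real-valued, bounded, and with bounded support, respectively; $\mathrm{Lip}(f)$ is the Lipschitz constant. The slope of $f\in\mathrm{Lip}(X)$ is $|\mathsf Df|(x)=\limsup_{y\to x}|f(y)-f(x)|/\mathsf d(y,x)$ (and $0$ at isolated points). The Cheeger energy of $f\in \mathrm L^2$ is $\mathsf{Ch}(f)=\inf\{\liminf_k\frac12\int_X|\mathsf Df_k|^2\,\mathrm d\mathfrak m: f_k\in\mathrm{Lip}_{bs}(X),\ f_k\to f\text{ in }\mathrm L^2\}$ and $\mathrm W^{1,2}(X)=\{f\in \mathrm L^2:\mathsf{Ch}(f)<\infty\}$. $\mathrm{Dom}(\Delta)$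 is the set of $f\in \mathrm L^2$ at which the subdifferential $\partial^-\mathsf{Ch}(f)$ is non-empty, and $\Delta f$ is the element of minimal $\mathrm L^2$ norm in $-\partial^-\mathsf{Ch}(f)$. The heat semigroup $(\mathsf H_t)_{t\ge0}$: for $f\in \mathrm L^2$, $t\mapsto\mathsf H_tf$ is the unique locally Lipschitz curve $(0,\infty)\to \mathrm L^2$ with $\frac{\mathrm d}{\mathrm dt}\mathsf H_tf=\Delta\mathsf H_tf$ for a.e. $t>0$ and $\mathsf H_tf\to f$ in $\mathrm L^2$ as $t\to0^+$; $\mathsf H_0=\mathrm{Id}$. It is linear and extends to a contraction semigroup on $\mathrm L^p$, $p\in[1,\infty)$, and on $\mathrm L^\infty$ by $\int_X g\,\mathsf H_tf\,\mathrm d\mathfrak m=\int_X f\,\mathsf H_tg\,\mathrm d\mathfrak m$ for $f\in \mathrm L^\infty$, $g\in \mathrm L^1$. $\mathrm L^\infty$-to-$\mathrm{Lip}$ contraction property with function $\mathsf c$: for every $f\in \mathrm L^\infty$ and $t>0$, $\mathsf H_tf\in\mathrm{Lip}_b(X)$ (up to choosing its continuous representative) and $\mathrm{Lip}(\mathsf H_tf)\le\mathsf c(t)\|f\|_{\mathrm L^\infty}$. A $\lambda$-eigenfunction, $\lambda\in[0,\infty)$, is a non-zero $f_\lambda\in\mathrm{Dom}(\Delta)$ with $-\Delta f_\lambda=\lambda f_\lambda$. For $f\in \mathrm L^1$, $\mathsf{TV}(f)=\inf\{\liminf_k\int_X|\mathsf Df_k|\,\mathrm d\mathfrak m:f_k\in\mathrm{Lip}_{bs}(X),\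 f_k\to f\text{ in }\mathrm L^1\}$; $\mathrm{BV}(X)=\{f\in \mathrm L^1:\mathsf{TV}(f)<\infty\}$; $\mathsf{Per}(A)=\mathsf{TV}(\chi_A)$ if $\chi_A\in\mathrm{BV}(X)$ and $\mathsf{Per}(A)=+\infty$ otherwise.
   Formalization: The eigenfunction is also assumed to be in L^1: otherwise the quotient is infinite or undefined and the claim can fail (minus a positive non-integrable ground state). C is uniform over spaces carried by subsets of one fixed set; taking the reals covers all spaces up to isometry. *)

theory Defs
  imports "HOL-Analysis.Analysis" "HOL-Probability.Essential_Supremum"
begin

text \<open>
  A metric measure space is a pair consisting of a distance \<open>d\<close> and a measure \<open>m\<close>, with underlying
  set \<open>X = space m\<close>. The carrier-based metric spaces of \<open>Metric_space\<close> are used instead of the type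
  class so that one can quantify over all spaces inside a formula. Elements of Lebesgue spaces are
  represented by functions; every notion below that is meant for classes modulo equality almost
  everywhere is invariant under changing representatives.
\<close>

abbreviation top_of :: "('a \<Rightarrow> 'a \<Rightarrow> real) \<Rightarrow> 'a measure \<Rightarrow> 'a topology" where
  "top_of d m \<equiv> Metric_space.mtopology (space m) d"

definition borel_sets_of :: "('a \<Rightarrow> 'a \<Rightarrow> real) \<Rightarrow> 'a measure \<Rightarrow> 'a set set" where
  "borel_sets_of d m = sigma_sets (space m) {U. openin (top_of d m) U}"

text \<open>
  This allows \<open>sets m\<close> to be the Borel sigma-algebra as well as its completion.
\<close>

definition borel_regular :: "('a \<Rightarrow> 'a \<Rightarrow> real) \<Rightarrow> 'a measure \<Rightarrow> bool" where
  "borel_regular d m \<longleftrightarrow>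
     borel_sets_of d m \<subseteq> sets m \<and>
     (\<forall>A\<in>sets m. \<exists>B\<in>borel_sets_of d m. A \<subseteq> B \<and> emeasure m A = emeasure m B)"

definition support_of :: "('a \<Rightarrow> 'a \<Rightarrow> real) \<Rightarrow> 'a measure \<Rightarrow> 'a set" where
  "support_of d m =
     {x \<in> space m. \<forall>U. openin (top_of d m) U \<and> x \<in> U \<longrightarrow> emeasure m U > 0}"


section \<open>Lebesgue spaces\<close>

definition L1 :: "'a measure \<Rightarrow> ('a \<Rightarrow> real) set" where
  "L1 m = {f. integrable m f}"

definition L2 :: "'a measure \<Rightarrow> ('a \<Rightarrow> real) set" where
  "L2 m = {f \<in> borel_measurable m. integrable m (\<lambda>x. (f x)\<^sup>2)}"

definition L1_norm :: "'a measure \<Rightarrow> ('a \<Rightarrow> real) \<Rightarrow> ennreal" where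
  "L1_norm m f = (\<integral>\<^sup>+x. ennreal \<bar>f x\<bar> \<partial>m)"

text \<open>Only used for functions in \<open>L2 m\<close>.\<close>

definition L2_norm :: "'a measure \<Rightarrow> ('a \<Rightarrow> real) \<Rightarrow> real" where
  "L2_norm m f = sqrt (\<integral>x. (f x)\<^sup>2 \<partial>m)"

definition Linf_norm :: "'a measure \<Rightarrow> ('a \<Rightarrow> real) \<Rightarrow> ennreal" where
  "Linf_norm m f = esssup m (\<lambda>x. ennreal \<bar>f x\<bar>)"

definition Linf :: "'a measure \<Rightarrow> ('a \<Rightarrow> real) set" where
  "Linf m = {f \<in> borel_measurable m. Linf_norm m f < \<infinity>}"

definition L1_converges :: "'a measure \<Rightarrow> (nat \<Rightarrow> 'a \<Rightarrow> real) \<Rightarrow> ('a \<Rightarrow> real) \<Rightarrow> bool" where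
  "L1_converges m F f \<longleftrightarrow>
     (\<forall>k. F k \<in> L1 m) \<and> f \<in> L1 m \<and> (\<lambda>k. L1_norm m (\<lambda>x. F k x - f x)) \<longlonglongrightarrow> 0"

definition L2_converges :: "'a measure \<Rightarrow> (nat \<Rightarrow> 'a \<Rightarrow> real) \<Rightarrow> ('a \<Rightarrow> real) \<Rightarrow> bool" where
  "L2_converges m F f \<longleftrightarrow>
     (\<forall>k. F k \<in> L2 m) \<and> f \<in> L2 m \<and> (\<lambda>k. L2_norm m (\<lambda>x. F k x - f x)) \<longlonglongrightarrow> 0"


section \<open>Lipschitz functions, Cheeger energy, total variation\<close>

definition Lip :: "('a \<Rightarrow> 'a \<Rightarrow> real) \<Rightarrow> 'a measure \<Rightarrow> ('a \<Rightarrow> real) set" where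
  "Lip d m = {f. Lipschitz_continuous_map (metric (space m, d)) euclidean_metric f}"

definition Lip_b :: "('a \<Rightarrow> 'a \<Rightarrow> real) \<Rightarrow> 'a measure \<Rightarrow> ('a \<Rightarrow> real) set" where
  "Lip_b d m = {f \<in> Lip d m. bounded (f ` space m)}"

definition Lip_bs :: "('a \<Rightarrow> 'a \<Rightarrow> real) \<Rightarrow> 'a measure \<Rightarrow> ('a \<Rightarrow> real) set" where
  "Lip_bs d m = {f \<in> Lip d m. Metric_space.mbounded (space m) d {x \<in> space m. f x \<noteq> 0}}"

definition Lip_const :: "('a \<Rightarrow> 'a \<Rightarrow> real) \<Rightarrow> 'a measure \<Rightarrow> ('a \<Rightarrow> real) \<Rightarrow> ennreal" where
  "Lip_const d m f =
     (SUP x\<in>space m. SUP y\<in>space m - {x}. ennreal (\<bar>f x - f y\<bar> / d x y))"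

text \<open>
  The filter \<open>atin\<close> is the punctured one. At isolated points it is \<open>bot\<close>, so that the
  \<open>Limsup\<close> is \<open>0\<close> there.
\<close>

definition slope :: "('a \<Rightarrow> 'a \<Rightarrow> real) \<Rightarrow> 'a measure \<Rightarrow> ('a \<Rightarrow> real) \<Rightarrow> 'a \<Rightarrow> ennreal" where
  "slope d m f x = Limsup (atin (top_of d m) x) (\<lambda>y. ennreal (\<bar>f y - f x\<bar> / d y x))"

definition Ch :: "('a \<Rightarrow> 'a \<Rightarrow> real) \<Rightarrow> 'a measure \<Rightarrow> ('a \<Rightarrow> real) \<Rightarrow> ennreal" where
  "Ch d m f =
     (INF F \<in> {F. (\<forall>k. F k \<in> Lip_bs d m) \<and> L2_converges m F f}.
        liminf (\<lambda>k. (\<integral>\<^sup>+x. (slope d m (F k) x)\<^sup>2 \<partial>m) / 2))"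

definition W12 :: "('a \<Rightarrow> 'a \<Rightarrow> real) \<Rightarrow> 'a measure \<Rightarrow> ('a \<Rightarrow> real) set" where
  "W12 d m = {f \<in> L2 m. Ch d m f < \<infinity>}"

definition infinitesimally_Hilbertian :: "('a \<Rightarrow> 'a \<Rightarrow> real) \<Rightarrow> 'a measure \<Rightarrow> bool" where
  "infinitesimally_Hilbertian d m \<longleftrightarrow>
     (\<forall>f\<in>W12 d m. \<forall>g\<in>W12 d m.
        2 * Ch d m f + 2 * Ch d m g = Ch d m (\<lambda>x. f x + g x) + Ch d m (\<lambda>x. f x - g x))"

definition TV :: "('a \<Rightarrow> 'a \<Rightarrow> real) \<Rightarrow> 'a measure \<Rightarrow> ('a \<Rightarrow> real) \<Rightarrow> ennreal" where
  "TV d m f =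
     (INF F \<in> {F. (\<forall>k. F k \<in> Lip_bs d m) \<and> L1_converges m F f}.
        liminf (\<lambda>k. \<integral>\<^sup>+x. slope d m (F k) x \<partial>m))"

definition BV :: "('a \<Rightarrow> 'a \<Rightarrow> real) \<Rightarrow> 'a measure \<Rightarrow> ('a \<Rightarrow> real) set" where
  "BV d m = {f \<in> L1 m. TV d m f < \<infinity>}"

definition Per :: "('a \<Rightarrow> 'a \<Rightarrow> real) \<Rightarrow> 'a measure \<Rightarrow> 'a set \<Rightarrow> ennreal" where
  "Per d m A = (if indicator A \<in> BV d m then TV d m (indicator A) else \<infinity>)"


section \<open>Laplacian and eigenfunctions\<close>

definition Ch_subdiff ::
  "('a \<Rightarrow> 'a \<Rightarrow> real) \<Rightarrow> 'a measure \<Rightarrow> ('a \<Rightarrow> real) \<Rightarrow> ('a \<Rightarrow> real) set" where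
  "Ch_subdiff d m f =
     {v \<in> L2 m. f \<in> W12 d m \<and>
        (\<forall>g\<in>L2 m. enn2ereal (Ch d m f) + ereal (\<integral>x. v x * (g x - f x) \<partial>m)
                     \<le> enn2ereal (Ch d m g))}"

text \<open>
  \<open>is_Laplacian d m f w\<close>: the function \<open>f\<close> belongs to the domain of the Laplacian and \<open>w\<close>
  represents its Laplacian.
\<close>

definition is_Laplacian ::
  "('a \<Rightarrow> 'a \<Rightarrow> real) \<Rightarrow> 'a measure \<Rightarrow> ('a \<Rightarrow> real) \<Rightarrow> ('a \<Rightarrow> real) \<Rightarrow> bool" where
  "is_Laplacian d m f w \<longleftrightarrow>
     (\<lambda>x. - w x) \<in> Ch_subdiff d m f \<and>
     (\<forall>v\<in>Ch_subdiff d m f. L2_norm m w \<le> L2_norm m v)"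

definition eigenfunction ::
  "('a \<Rightarrow> 'a \<Rightarrow> real) \<Rightarrow> 'a measure \<Rightarrow> real \<Rightarrow> ('a \<Rightarrow> real) \<Rightarrow> bool" where
  "eigenfunction d m l f \<longleftrightarrow>
     0 \<le> l \<and> f \<in> L2 m \<and> \<not> (AE x in m. f x = 0) \<and> is_Laplacian d m f (\<lambda>x. - (l * f x))"


section \<open>Heat semigroup\<close>

definition heat_curve ::
  "('a \<Rightarrow> 'a \<Rightarrow> real) \<Rightarrow> 'a measure \<Rightarrow> ('a \<Rightarrow> real) \<Rightarrow> (real \<Rightarrow> 'a \<Rightarrow> real) \<Rightarrow> bool" where
  "heat_curve d m f u \<longleftrightarrow>
     f \<in> L2 m \<and> (\<forall>t\<ge>0. u t \<in> L2 m) \<and>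
     (AE x in m. u 0 x = f x) \<and>
     ((\<lambda>t. L2_norm m (\<lambda>x. u t x - f x)) \<longlongrightarrow> 0) (at_right 0) \<and>
     (\<forall>a b. 0 < a \<and> a \<le> b \<longrightarrow>
        (\<exists>K. \<forall>s\<in>{a..b}. \<forall>t\<in>{a..b}. L2_norm m (\<lambda>x. u s x - u t x) \<le> K * \<bar>s - t\<bar>)) \<and>
     (AE t in lborel. t > 0 \<longrightarrow>
        (\<exists>w. is_Laplacian d m (u t) w \<and>
             ((\<lambda>s. L2_norm m (\<lambda>x. (u s x - u t x) / (s - t) - w x)) \<longlongrightarrow> 0) (at t)))"

text \<open>
  The heat semigroup at time \<open>t\<close> is given by its graph: the three predicates below say that the
  semigroup maps \<open>f\<close> to (the class of) \<open>h\<close>, on square integrable functions, on integrable functions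
  by continuous extension from the intersection of both spaces, and on bounded functions by duality.
\<close>

definition heat_L2 ::
  "('a \<Rightarrow> 'a \<Rightarrow> real) \<Rightarrow> 'a measure \<Rightarrow> real \<Rightarrow> ('a \<Rightarrow> real) \<Rightarrow> ('a \<Rightarrow> real) \<Rightarrow> bool" where
  "heat_L2 d m t f h \<longleftrightarrow> (\<exists>u. heat_curve d m f u \<and> h \<in> L2 m \<and> (AE x in m. h x = u t x))"

definition heat_L1 ::
  "('a \<Rightarrow> 'a \<Rightarrow> real) \<Rightarrow> 'a measure \<Rightarrow> real \<Rightarrow> ('a \<Rightarrow> real) \<Rightarrow> ('a \<Rightarrow> real) \<Rightarrow> bool" where
  "heat_L1 d m t f h \<longleftrightarrow>
     (\<exists>F G. (\<forall>k. F k \<in> L2 m \<and> heat_L2 d m t (F k) (G k)) \<and>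
            L1_converges m F f \<and> L1_converges m G h)"

definition heat_Linf ::
  "('a \<Rightarrow> 'a \<Rightarrow> real) \<Rightarrow> 'a measure \<Rightarrow> real \<Rightarrow> ('a \<Rightarrow> real) \<Rightarrow> ('a \<Rightarrow> real) \<Rightarrow> bool" where
  "heat_Linf d m t f h \<longleftrightarrow>
     f \<in> Linf m \<and> h \<in> Linf m \<and>
     (\<forall>g\<in>L1 m. \<exists>k. heat_L1 d m t g k \<and> (\<integral>x. g x * h x \<partial>m) = (\<integral>x. f x * k x \<partial>m))"

definition Linf_to_Lip_contraction ::
  "('a \<Rightarrow> 'a \<Rightarrow> real) \<Rightarrow> 'a measure \<Rightarrow> (real \<Rightarrow> real) \<Rightarrow> bool" where
  "Linf_to_Lip_contraction d m c \<longleftrightarrow>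
     (\<forall>f\<in>Linf m. \<forall>t>0. \<exists>h\<in>Lip_b d m.
        heat_Linf d m t f h \<and> Lip_const d m h \<le> ennreal (c t) * Linf_norm m f)"


section \<open>Standing assumptions\<close>

definition standing_mms :: "('a \<Rightarrow> 'a \<Rightarrow> real) \<Rightarrow> 'a measure \<Rightarrow> bool" where
  "standing_mms d m \<longleftrightarrow>
     Metric_space (space m) d \<and>
     Metric_space.mcomplete (space m) d \<and>
     separable_space (top_of d m) \<and>
     borel_regular d m \<and>
     support_of d m = space m \<and>
     (\<exists>A>0. \<exists>B>0. \<exists>z\<in>space m. \<forall>r>0.
        emeasure m {x \<in> space m. d x z < r} \<le> ennreal (A * exp (B * r\<^sup>2))) \<and>
     infinitesimally_Hilbertian d m"

text \<open>Borel functions on the open half-line with positive values, integrable up to \<open>0\<close>.\<close>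

definition contraction_function :: "(real \<Rightarrow> real) \<Rightarrow> bool" where
  "contraction_function c \<longleftrightarrow>
     c \<in> borel_measurable (restrict_space borel {0<..}) \<and>
     (\<forall>t>0. c t > 0) \<and>
     (\<forall>T>0. set_integrable lborel {0<..T} c)"

end

theory Submission
  imports Defs
begin

text \<open>
Write \<open>E\<close> for the set where an eigenfunction \<open>f\<close> is positive. Testing the equation
\<open>- \<Delta> f = \<lambda> f\<close> with the indicator \<open>\<chi>\<close> of \<open>E\<close> gives, formally,
\<open>\<lambda> \<integral>\<^sub>E f = \<integral> \<nabla>f \<cdot> \<nabla>\<chi> \<le> Lip f * Per E\<close>, and the theorem follows once three points are settled.

\<^item> \<open>Lip f\<close> is at most a constant times \<open>\<lambda>\<^sup>b\<close> times the essential supremum of \<open>|f|\<close>. The heat semigroup acts on \<open>f\<close>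
  by \<open>H\<^sub>t f = exp (- \<lambda> t) f\<close> (\<open>heat_Linf_eigen\<close>), so \<open>Lip f \<le> exp (\<lambda> t) c(t) \<parallel>f\<parallel>\<close>, and one takes
  \<open>t\<close> of order \<open>1 / \<lambda>\<close>. The scaling is proved by differentiating the pairing of \<open>f\<close> with a heat
  curve; this uses that the Laplacian is symmetric, which is where the parallelogram law for the
  Cheeger energy enters (\<open>cheeger_expand\<close>, \<open>subdiff_sym\<close>).

\<^item> The integration by parts is an inequality (\<open>subdiff_lip_le\<close>): if \<open>v\<close> lies in the
  subdifferential of the Cheeger energy at an \<open>L\<close>-Lipschitz function \<open>f\<close>, then
  \<open>\<integral> v F \<le> L \<integral> |DF|\<close> for every Lipschitz function \<open>F\<close> with bounded support. The energy is defined by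
  relaxation, so \<open>f\<close> is only accessible through Lipschitz functions \<open>g\<close> near \<open>f\<close> whose energy is
  nearly optimal, and nothing prevents the slope of \<open>g\<close> from exceeding \<open>L\<close> somewhere. However, gluing
  \<open>f\<close> itself into \<open>g\<close> on a region cannot lower the energy below the optimum, which bounds the average
  of \<open>|Dg|\<^sup>2 - L\<^sup>2\<close> against Lipschitz cutoffs (\<open>near_opt_weighted\<close>). As the slopes of near optimal
  functions are close to each other in \<open>L\<^sup>2\<close> (\<open>near_opt_cauchy\<close>), the cutoffs may be replaced by the
  indicator of the set where \<open>|Dg| > L\<close>, and the excess of \<open>|Dg|\<close> over \<open>L\<close> tends to zero
  (\<open>near_opt_excess\<close>).

\<^item> \<open>\<integral> f = 0\<close>, so that \<open>\<integral>\<^sub>E f\<close> is half of the \<open>L\<^sup>1\<close> norm (\<open>eigenfunction_mean_zero\<close>). This is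
  conservation of mass, and it rests on the Gaussian bound for the volume of balls. The argument is
  a time-discrete version of the integral estimates of Davies and Grigor'yan. Let \<open>\<eta>\<close> be a cutoff
  function at scale \<open>R\<close> and run the implicit Euler scheme for the heat equation from \<open>\<eta>\<close> up to a small
  fixed time \<open>\<tau>\<close>. By symmetry, the pairing with \<open>f\<close> is multiplied by at most \<open>1 / (1 + \<lambda> \<tau>)\<close>. On the
  other hand, estimates with the weight \<open>exp (- \<theta> d(z, x))\<close>, where \<open>\<theta>\<close> is proportional to \<open>R\<close>, show
  that the scheme hardly changes \<open>\<eta>\<close> on the ball of radius \<open>R / 2\<close>: the slope of \<open>\<eta>\<close> lives at distance
  at least \<open>R\<close>, where the weight beats the volume. Letting \<open>R\<close> tend to infinity gives
  \<open>|\<integral> f| \<le> |\<integral> f| / (1 + \<lambda> \<tau>)\<close>. Each step of the scheme is a minimisation; near minimisers among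
  Lipschitz functions with bounded support are used, for which slopes can be handled pointwise.

The calculus behind the last two points reduces to one pointwise inequality, the Leibniz rule
\<open>rslope_glue\<close> for convex combinations of Lipschitz functions with variable coefficients.
\<close>

section \<open>Two estimates for the exponential function\<close>

lemma abs_exp_minus_1_le: "\<bar>exp x - 1\<bar> \<le> exp \<bar>x\<bar> * \<bar>x\<bar>" for x :: real
proof (cases "0 \<le> x")
  case True
  have "1 - x \<le> exp (- x)" using exp_ge_add_one_self[of "- x"] by simp
  then have "exp x * (1 - x) \<le> exp x * exp (- x)" by (rule mult_left_mono) simp
  also have "\<dots> = 1" by (simp flip: exp_add)
  finally show ?thesis using True by (simp add: algebra_simps)
next
  case False
  have "1 + x \<le> exp x" by (rule exp_ge_add_one_self)
  moreover have "exp x \<le> 1" using False by simp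
  ultimately have "\<bar>exp x - 1\<bar> \<le> \<bar>x\<bar>" using False by linarith
  also have "\<dots> \<le> exp \<bar>x\<bar> * \<bar>x\<bar>" by (simp add: mult_le_cancel_right1)
  finally show ?thesis .
qed

lemma inverse_power_le_exp:
  fixes g :: real
  assumes "0 \<le> g" "g \<le> 1 / 2"
  shows "(1 / (1 - g)) ^ n \<le> exp (2 * (real n * g))"
proof -
  have "- 2 * g \<le> - g - 2 * g\<^sup>2" using assms by (simp add: power2_eq_square) (use mult_left_mono[of g "1/2" g] in linarith)
  also have "\<dots> \<le> ln (1 - g)" by (rule ln_one_minus_pos_lower_bound[OF assms])
  finally have "exp (- (2 * g)) \<le> exp (ln (1 - g))" by simp
  then have "exp (- (2 * g)) \<le> 1 - g" using assms by simp
  then have "1 / (1 - g) \<le> 1 / exp (- (2 * g))" by (intro divide_left_mono) (use assms in auto)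
  also have "\<dots> = exp (2 * g)" by (simp add: exp_minus field_simps)
  finally have "(1 / (1 - g)) ^ n \<le> exp (2 * g) ^ n" using assms by (intro power_mono) auto
  also have "\<dots> = exp (2 * (real n * g))" by (simp flip: exp_of_nat_mult add: algebra_simps)
  finally show ?thesis .
qed

section \<open>Lipschitz curves with vanishing derivative\<close>

text \<open>
The difference quotients of \<open>\<psi>\<close> are bounded on \<open>[a, b]\<close> and tend to zero almost everywhere, so their
integrals tend to zero. These integrals are differences of averages of \<open>\<psi>\<close> over short intervals
at \<open>b\<close> and at \<open>a\<close>, and they tend to \<open>\<psi> b - \<psi> a\<close>.
\<close>

lemma locally_lipschitz_deriv_zero_const:
  fixes \<psi> :: "real \<Rightarrow> real"
  assumes lip: "\<And>a b. 0 < a \<Longrightarrow> a \<le> b \<Longrightarrow> \<exists>K. \<forall>s\<in>{a..b}. \<forall>t\<in>{a..b}. \<bar>\<psi> s - \<psi> t\<bar> \<le> K * \<bar>s - t\<bar>"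
    and der: "AE t in lborel. t > 0 \<longrightarrow> (\<psi> has_real_derivative 0) (at t)"
    and ab: "0 < a" "a \<le> b"
  shows "\<psi> a = \<psi> b"
proof -
  have cont: "isCont \<psi> t" if t: "t > 0" for t
  proof -
    obtain K where K: "\<forall>s\<in>{t/2..2*t}. \<forall>r\<in>{t/2..2*t}. \<bar>\<psi> s - \<psi> r\<bar> \<le> K * \<bar>s - r\<bar>"
      using lip[of "t/2" "2*t"] t by auto
    have "((\<lambda>s. \<psi> s - \<psi> t) \<longlongrightarrow> 0) (at t)"
    proof (rule Lim_null_comparison)
      have "eventually (\<lambda>s. s \<in> {t/2<..<2*t}) (at t)"
        using t by (intro eventually_at_in_open') auto
      then show "eventually (\<lambda>s. norm (\<psi> s - \<psi> t) \<le> K * \<bar>s - t\<bar>) (at t)"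
        by (rule eventually_mono) (use K t in auto)
      have "((\<lambda>s. K * \<bar>s - t\<bar>) \<longlongrightarrow> K * \<bar>t - t\<bar>) (at t)" by (intro tendsto_intros)
      then show "((\<lambda>s. K * \<bar>s - t\<bar>) \<longlongrightarrow> 0) (at t)" by simp
    qed
    then show ?thesis unfolding isCont_def using LIM_zero_iff by blast
  qed
  define F where "F x = integral {a/2..x} \<psi>" for x
  have F: "(F has_real_derivative \<psi> t) (at t)" if t: "a/2 < t" "t < b + 2" for t
  proof -
    have "continuous_on {a/2..b + 2} \<psi>"
      using cont ab by (intro continuous_at_imp_continuous_on) auto
    then have "(F has_real_derivative \<psi> t) (at t within {a/2..b + 2})"
      unfolding F_def by (rule integral_has_real_derivative) (use t in auto)
    then show ?thesis using t at_within_Icc_at[of "a/2" t "b + 2"] by simp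
  qed
  define h where "h n = inverse (real (Suc n))" for n :: nat
  have h: "0 < h n" "h n \<le> 1" for n by (auto simp: h_def field_simps)
  have h0: "h \<longlonglongrightarrow> 0" unfolding h_def by (rule LIMSEQ_inverse_real_of_nat)
  define D where "D n t = (\<psi> (t + h n) - \<psi> t) / h n" for n t
  define G where "G n t = (F (t + h n) - F t) / h n" for n t
  have dG: "(G n has_real_derivative D n t) (at t)" if "a \<le> t" "t \<le> b" for n t
  proof -
    have "((\<lambda>t. F (t + h n)) has_real_derivative \<psi> (t + h n)) (at t)"
      using F[of "t + h n"] that ab h[of n] by (simp add: DERIV_shift)
    moreover have "(F has_real_derivative \<psi> t) (at t)" using F[of t] that ab by simp
    ultimately show ?thesis unfolding G_def D_def by (intro DERIV_cdivide DERIV_diff)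
  qed
  have cD: "isCont (D n) t" if "a \<le> t" "t \<le> b" for n t
  proof -
    have 1: "isCont (\<lambda>t. t + h n) t" by simp
    have 2: "isCont \<psi> (t + h n)" by (rule cont) (use that ab h(1)[of n] in linarith)
    have 3: "isCont \<psi> t" by (rule cont) (use that ab in linarith)
    have "isCont (\<lambda>t. \<psi> (t + h n)) t" by (rule isCont_o2[OF 1 2])
    then show ?thesis
      unfolding D_def using h(1)[of n] by (intro isCont_divide isCont_diff 3 continuous_const) auto
  qed
  have FTC: "(\<integral>t. D n t * indicator {a..b} t \<partial>lborel) = G n b - G n a" for n
    by (rule integral_FTC_Icc_real[OF ab(2)]) (use dG cD in auto)
  have lim1: "(\<lambda>n. G n t) \<longlonglongrightarrow> \<psi> t" if t: "a \<le> t" "t \<le> b" for t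
  proof -
    have "((\<lambda>k. (F (t + k) - F t) / k) \<longlongrightarrow> \<psi> t) (at 0)" using F[of t] t ab by (simp add: DERIV_def)
    moreover have "filterlim h (at 0) sequentially"
      using h0 h(1) by (auto simp: filterlim_at intro!: always_eventually less_imp_neq[symmetric])
    ultimately show ?thesis unfolding G_def by (rule filterlim_compose)
  qed
  obtain K where K: "\<forall>s\<in>{a..b+1}. \<forall>t\<in>{a..b+1}. \<bar>\<psi> s - \<psi> t\<bar> \<le> K * \<bar>s - t\<bar>"
    using lip[of a "b+1"] ab by auto
  have K0: "0 \<le> K" using bspec[OF bspec[OF K, of a], of "a + 1"] ab by (auto simp: abs_if split: if_splits)
  have "(\<lambda>n. \<integral>t. D n t * indicator {a..b} t \<partial>lborel) \<longlonglongrightarrow> (\<integral>(t::real). 0 \<partial>lborel)"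
  proof (rule integral_dominated_convergence[where w="\<lambda>t. K * indicator {a..b} t"])
    show "(\<lambda>t. D n t * indicator {a..b} t) \<in> borel_measurable lborel" for n
      using borel_integrable_atLeastAtMost[of a b "D n"] cD by (intro borel_measurable_integrable) auto
    show "integrable lborel (\<lambda>t. K * indicator {a..b} t)"
      by (intro integrable_mult_right integrable_real_indicator) (use ab in auto)
    show "AE t in lborel. (\<lambda>n. D n t * indicator {a..b} t) \<longlonglongrightarrow> 0"
      using der
    proof (rule AE_mp, intro AE_I2 impI)
      fix t assume *: "t > 0 \<longrightarrow> (\<psi> has_real_derivative 0) (at t)"
      show "(\<lambda>n. D n t * indicator {a..b} t) \<longlonglongrightarrow> 0"
      proof (cases "t \<in> {a..b}")
        case True
        then have "((\<lambda>k. (\<psi> (t + k) - \<psi> t) / k) \<longlongrightarrow> 0) (at 0)" using * ab by (simp add: DERIV_def)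
        moreover have "filterlim h (at 0) sequentially"
          using h0 h(1) by (auto simp: filterlim_at intro!: always_eventually less_imp_neq[symmetric])
        ultimately have "(\<lambda>n. D n t) \<longlonglongrightarrow> 0" unfolding D_def by (rule filterlim_compose)
        then show ?thesis using True by simp
      qed simp
    qed
    show "AE t in lborel. norm (D n t * indicator {a..b} t) \<le> K * indicator {a..b} t" for n
    proof (rule AE_I2)
      fix t
      show "norm (D n t * indicator {a..b} t) \<le> K * indicator {a..b} t"
      proof (cases "t \<in> {a..b}")
        case True
        have "\<bar>\<psi> (t + h n) - \<psi> t\<bar> \<le> K * \<bar>(t + h n) - t\<bar>"
          using True h[of n] by (intro bspec[OF bspec[OF K]]) auto
        then show ?thesis using True h(1)[of n] by (simp add: D_def pos_divide_le_eq)
      qed simp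
    qed
  qed simp
  then have "(\<lambda>n. G n b - G n a) \<longlonglongrightarrow> 0" by (simp add: FTC)
  moreover have "(\<lambda>n. G n b - G n a) \<longlonglongrightarrow> \<psi> b - \<psi> a" using lim1 ab by (intro tendsto_diff) auto
  ultimately show ?thesis using LIMSEQ_unique by fastforce
qed

section \<open>Square integrable, bounded and integrable functions\<close>

lemma L2_measurable [measurable_dest]: "f \<in> L2 m \<Longrightarrow> f \<in> borel_measurable m"
  by (simp add: L2_def)

lemma L2_integrable_sq: "f \<in> L2 m \<Longrightarrow> integrable m (\<lambda>x. (f x)\<^sup>2)"
  by (simp add: L2_def)

lemma L2_mult_integrable:
  assumes "f \<in> L2 m" "g \<in> L2 m"
  shows "integrable m (\<lambda>x. f x * g x)"
proof (rule Bochner_Integration.integrable_bound)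
  show "integrable m (\<lambda>x. (f x)\<^sup>2 + (g x)\<^sup>2)"
    using assms by (auto simp: L2_def)
  show "(\<lambda>x. f x * g x) \<in> borel_measurable m"
    using assms by (auto simp: L2_def)
  have "\<bar>a * b\<bar> \<le> a\<^sup>2 + b\<^sup>2" for a b :: real
  proof -
    have "2 * (\<bar>a\<bar> * \<bar>b\<bar>) \<le> a\<^sup>2 + b\<^sup>2"
      using zero_le_power2[of "\<bar>a\<bar> - \<bar>b\<bar>"] by (simp add: power2_eq_square algebra_simps)
    moreover have "0 \<le> \<bar>a\<bar> * \<bar>b\<bar>" by simp
    ultimately show ?thesis unfolding abs_mult by linarith
  qed
  then show "AE x in m. norm (f x * g x) \<le> norm ((f x)\<^sup>2 + (g x)\<^sup>2)"
    by (intro AE_I2) (simp add: order_trans[OF _ abs_ge_self])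
qed

lemma L2_add: "f \<in> L2 m \<Longrightarrow> g \<in> L2 m \<Longrightarrow> (\<lambda>x. f x + g x) \<in> L2 m"
  using L2_mult_integrable[of f m g] by (auto simp: L2_def power2_sum mult.assoc)

lemma L2_cmult: "f \<in> L2 m \<Longrightarrow> (\<lambda>x. c * f x) \<in> L2 m"
  by (auto simp: L2_def power_mult_distrib)

lemma L2_diff: "f \<in> L2 m \<Longrightarrow> g \<in> L2 m \<Longrightarrow> (\<lambda>x. f x - g x) \<in> L2 m"
  using L2_add[of f m "\<lambda>x. -1 * g x"] L2_cmult[of g m "-1"] by simp

lemma L2_norm_nonneg [simp]: "0 \<le> L2_norm m f"
  by (simp add: L2_norm_def)

lemma L2_norm_sq: "(L2_norm m f)\<^sup>2 = (\<integral>x. (f x)\<^sup>2 \<partial>m)"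
  by (simp add: L2_norm_def)

text \<open>
The quadratic polynomial \<open>s \<mapsto> \<integral> (s f + g)\<^sup>2\<close> is non-negative, hence its discriminant is not positive.
\<close>

lemma L2_cauchy_schwarz:
  assumes f: "f \<in> L2 m" and g: "g \<in> L2 m"
  shows "\<bar>\<integral>x. f x * g x \<partial>m\<bar> \<le> L2_norm m f * L2_norm m g"
proof -
  let ?a = "\<integral>x. (f x)\<^sup>2 \<partial>m" and ?b = "\<integral>x. (g x)\<^sup>2 \<partial>m" and ?c = "\<integral>x. f x * g x \<partial>m"
  have quad: "0 \<le> ?a * s\<^sup>2 + 2 * ?c * s + ?b" for s
  proof -
    have "0 \<le> (\<integral>x. (s * f x + g x)\<^sup>2 \<partial>m)" by simp
    also have "\<dots> = (\<integral>x. s\<^sup>2 * (f x)\<^sup>2 + 2 * s * (f x * g x) + (g x)\<^sup>2 \<partial>m)"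
      by (intro Bochner_Integration.integral_cong refl) (simp add: power2_eq_square algebra_simps)
    also have "\<dots> = s\<^sup>2 * ?a + 2 * s * ?c + ?b"
      using f g L2_mult_integrable[OF f g] by (simp add: L2_integrable_sq)
    finally show ?thesis by (simp add: algebra_simps)
  qed
  have "?c\<^sup>2 \<le> ?a * ?b"
  proof (cases "?a = 0")
    case True
    have "?c = 0"
    proof (rule ccontr)
      assume "?c \<noteq> 0"
      then show False using quad[of "- (?b + 1) / (2 * ?c)"] True by (simp add: field_simps)
    qed
    then show ?thesis using True by simp
  next
    case False
    then have a: "?a > 0" using integral_nonneg_AE[of "\<lambda>x. (f x)\<^sup>2" m] by (simp add: less_le)
    have "0 \<le> ?a * (?a * (- ?c / ?a)\<^sup>2 + 2 * ?c * (- ?c / ?a) + ?b)"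
      using quad[of "- ?c / ?a"] a by (intro mult_nonneg_nonneg) auto
    also have "\<dots> = ?a * ?b - ?c\<^sup>2" using a by (simp add: power2_eq_square field_simps)
    finally show ?thesis by simp
  qed
  then have "sqrt (?c\<^sup>2) \<le> sqrt (?a * ?b)" by (rule real_sqrt_le_mono)
  then show ?thesis by (simp add: L2_norm_def real_sqrt_mult)
qed

lemma L2_norm_triangle:
  assumes f: "f \<in> L2 m" and g: "g \<in> L2 m"
  shows "L2_norm m (\<lambda>x. f x + g x) \<le> L2_norm m f + L2_norm m g"
proof (rule power2_le_imp_le)
  have "(L2_norm m (\<lambda>x. f x + g x))\<^sup>2 = (\<integral>x. (f x)\<^sup>2 + (g x)\<^sup>2 + 2 * (f x * g x) \<partial>m)"
    unfolding L2_norm_sq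
    by (intro Bochner_Integration.integral_cong refl) (simp add: power2_eq_square algebra_simps)
  also have "\<dots> = (L2_norm m f)\<^sup>2 + (L2_norm m g)\<^sup>2 + 2 * (\<integral>x. f x * g x \<partial>m)"
    using f g L2_mult_integrable[OF f g] by (simp add: L2_integrable_sq L2_norm_sq)
  also have "\<dots> \<le> (L2_norm m f + L2_norm m g)\<^sup>2"
    using L2_cauchy_schwarz[OF f g] by (simp add: power2_sum)
  finally show "(L2_norm m (\<lambda>x. f x + g x))\<^sup>2 \<le> (L2_norm m f + L2_norm m g)\<^sup>2" .
qed simp

lemma tendsto_L2_norm_iff:
  "((\<lambda>k. L2_norm m (u k)) \<longlongrightarrow> 0) F \<longleftrightarrow> ((\<lambda>k. \<integral>x. (u k x)\<^sup>2 \<partial>m) \<longlongrightarrow> 0) F"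
proof
  assume "((\<lambda>k. L2_norm m (u k)) \<longlongrightarrow> 0) F"
  then have "((\<lambda>k. (L2_norm m (u k))\<^sup>2) \<longlongrightarrow> 0\<^sup>2) F" by (rule tendsto_power)
  then show "((\<lambda>k. \<integral>x. (u k x)\<^sup>2 \<partial>m) \<longlongrightarrow> 0) F" by (simp add: L2_norm_sq)
next
  assume "((\<lambda>k. \<integral>x. (u k x)\<^sup>2 \<partial>m) \<longlongrightarrow> 0) F"
  then have "((\<lambda>k. sqrt (\<integral>x. (u k x)\<^sup>2 \<partial>m)) \<longlongrightarrow> sqrt 0) F" by (rule tendsto_real_sqrt)
  then show "((\<lambda>k. L2_norm m (u k)) \<longlongrightarrow> 0) F" by (simp add: L2_norm_def)
qed

lemma Linf_bound:
  assumes f: "f \<in> Linf m"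
  shows "AE x in m. \<bar>f x\<bar> \<le> enn2real (Linf_norm m f)"
proof -
  have fin: "Linf_norm m f < top" using f by (simp add: Linf_def)
  have "AE x in m. ennreal \<bar>f x\<bar> \<le> Linf_norm m f" unfolding Linf_norm_def by (rule esssup_AE)
  then show ?thesis
  proof (rule AE_mp, intro AE_I2 impI)
    fix x assume "ennreal \<bar>f x\<bar> \<le> Linf_norm m f"
    then have "enn2real (ennreal \<bar>f x\<bar>) \<le> enn2real (Linf_norm m f)" using fin by (rule enn2real_mono)
    then show "\<bar>f x\<bar> \<le> enn2real (Linf_norm m f)" by simp
  qed
qed

lemma Linf_L1_integrable:
  assumes f: "f \<in> Linf m" and g: "integrable m g"
  shows "integrable m (\<lambda>x. f x * g x)"
proof (rule Bochner_Integration.integrable_bound)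
  show "integrable m (\<lambda>x. enn2real (Linf_norm m f) * g x)" using g by simp
  have "f \<in> borel_measurable m" using f by (simp add: Linf_def)
  then show "(\<lambda>x. f x * g x) \<in> borel_measurable m" using g by measurable
  show "AE x in m. norm (f x * g x) \<le> norm (enn2real (Linf_norm m f) * g x)"
    using Linf_bound[OF f] by (rule AE_mp) (auto simp: abs_mult intro!: mult_right_mono)
qed

lemma Linf_L1_tendsto:
  assumes f: "f \<in> Linf m" and F: "L1_converges m F g"
  shows "(\<lambda>k. \<integral>x. f x * F k x \<partial>m) \<longlonglongrightarrow> (\<integral>x. f x * g x \<partial>m)"
proof -
  define C where "C = enn2real (Linf_norm m f)"
  have Fi: "integrable m (F k)" and gi: "integrable m g" for k
    using F by (auto simp: L1_converges_def L1_def)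
  have ab: "L1_norm m (\<lambda>x. F k x - g x) = ennreal (\<integral>x. \<bar>F k x - g x\<bar> \<partial>m)" for k
    unfolding L1_norm_def using Fi gi by (intro nn_integral_eq_integral) auto
  have "(\<lambda>k. ennreal (\<integral>x. \<bar>F k x - g x\<bar> \<partial>m)) \<longlonglongrightarrow> ennreal 0"
    using F by (simp add: L1_converges_def ab)
  then have lim: "(\<lambda>k. \<integral>x. \<bar>F k x - g x\<bar> \<partial>m) \<longlonglongrightarrow> 0"
    by (subst (asm) tendsto_ennreal_iff) auto
  have "(\<lambda>k. (\<integral>x. f x * F k x \<partial>m) - (\<integral>x. f x * g x \<partial>m)) \<longlonglongrightarrow> 0"
  proof (rule Lim_null_comparison)
    show "(\<lambda>k. C * (\<integral>x. \<bar>F k x - g x\<bar> \<partial>m)) \<longlonglongrightarrow> 0" using tendsto_mult_left[OF lim, of C] by simp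
    show "eventually (\<lambda>k. norm ((\<integral>x. f x * F k x \<partial>m) - (\<integral>x. f x * g x \<partial>m)) \<le> C * (\<integral>x. \<bar>F k x - g x\<bar> \<partial>m)) sequentially"
    proof (intro always_eventually allI)
      fix k
      have i: "integrable m (\<lambda>x. F k x - g x)" using Fi gi by simp
      have "(\<integral>x. f x * F k x \<partial>m) - (\<integral>x. f x * g x \<partial>m) = (\<integral>x. f x * (F k x - g x) \<partial>m)"
        using Linf_L1_integrable[OF f] Fi gi by (simp add: right_diff_distrib)
      also have "\<bar>\<dots>\<bar> \<le> (\<integral>x. \<bar>f x * (F k x - g x)\<bar> \<partial>m)" by (rule integral_abs_bound)
      also have "\<dots> \<le> (\<integral>x. C * \<bar>F k x - g x\<bar> \<partial>m)"
      proof (rule integral_mono_AE)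
        show "AE x in m. \<bar>f x * (F k x - g x)\<bar> \<le> C * \<bar>F k x - g x\<bar>"
          using Linf_bound[OF f] unfolding C_def by (rule AE_mp) (auto simp: abs_mult intro!: mult_right_mono)
      qed (use Linf_L1_integrable[OF f i] i in auto)
      finally show "norm ((\<integral>x. f x * F k x \<partial>m) - (\<integral>x. f x * g x \<partial>m)) \<le> C * (\<integral>x. \<bar>F k x - g x\<bar> \<partial>m)" by simp
    qed
  qed
  then show ?thesis using LIM_zero_iff by blast
qed

lemma integrable_weight:
  assumes w: "integrable m w" "\<And>x. x \<in> space m \<Longrightarrow> 0 \<le> w x" and u: "u \<in> borel_measurable m" "\<And>x. x \<in> space m \<Longrightarrow> \<bar>u x\<bar> \<le> 1"
  shows "integrable m (\<lambda>x. u x * w x :: real)"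
proof (rule Bochner_Integration.integrable_bound[OF w(1)])
  show "(\<lambda>x. u x * w x) \<in> borel_measurable m" using w(1) u(1) by measurable
  show "AE x in m. norm (u x * w x) \<le> norm (w x)"
    using u(2) by (intro AE_I2) (auto simp: abs_mult intro!: mult_left_le_one_le)
qed

lemma indicator_diff_le_1: "0 \<le> s \<Longrightarrow> s \<le> 1 \<Longrightarrow> \<bar>s - indicator A x\<bar> \<le> (1::real)"
  by (auto simp: indicator_def)

section \<open>Calculus and measurability of slopes\<close>

text \<open>
The point \<open>z\<close> is the centre to which distances and balls refer. Finiteness of the balls around it
makes bounded measurable functions with bounded support integrable.
\<close>

locale metric_measure = Metric_space "space m" d
  for m :: "'a measure" and d +
  fixes z :: 'a
  assumes borel_sets: "borel_sets_of d m \<subseteq> sets m"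
    and z: "z \<in> space m"
    and ball_finite: "\<And>r. emeasure m (mball z r) < \<infinity>"
begin

text \<open>
Requiring \<open>0 \<le> K\<close> matters on spaces with at most one point, where the second conjunct holds for
every \<open>K\<close>.
\<close>

definition lip :: "real \<Rightarrow> ('a \<Rightarrow> real) \<Rightarrow> bool" where
  "lip K f \<longleftrightarrow> 0 \<le> K \<and> (\<forall>x\<in>space m. \<forall>y\<in>space m. \<bar>f x - f y\<bar> \<le> K * d x y)"

text \<open>
The slope as a real number. An infinite slope would become \<open>0\<close>; this does not happen for Lipschitz
functions (\<open>slope_lip_le\<close>).
\<close>

definition rslope :: "('a \<Rightarrow> real) \<Rightarrow> 'a \<Rightarrow> real" where
  "rslope f x = enn2real (slope d m f x)"

lemma lipD: "lip K f \<Longrightarrow> x \<in> space m \<Longrightarrow> y \<in> space m \<Longrightarrow> \<bar>f x - f y\<bar> \<le> K * d x y"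
  by (auto simp: lip_def)

lemma lip_nonneg: "lip K f \<Longrightarrow> 0 \<le> K"
  by (auto simp: lip_def)

lemma Lip_iff: "f \<in> Lip d m \<longleftrightarrow> (\<exists>K. lip K f)"
proof -
  have ms: "mspace (metric (space m, d)) = space m" "mdist (metric (space m, d)) = d"
    using Metric_space_axioms by (auto simp: Metric_space.mspace_metric Metric_space.mdist_metric)
  have "lip (max B 0) f" if "\<forall>x\<in>space m. \<forall>y\<in>space m. \<bar>f x - f y\<bar> \<le> B * d x y" for B
    unfolding lip_def
  proof (intro conjI ballI)
    fix x y assume "x \<in> space m" "y \<in> space m"
    then have "\<bar>f x - f y\<bar> \<le> B * d x y" using that by blast
    also have "\<dots> \<le> max B 0 * d x y" by (intro mult_right_mono) auto
    finally show "\<bar>f x - f y\<bar> \<le> max B 0 * d x y" .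
  qed simp
  then show ?thesis
    unfolding Lip_def Lipschitz_continuous_map_def ms
    by (simp add: dist_real_def) (use \<open>\<And>B. _ \<Longrightarrow> lip (max B 0) f\<close> lipD in blast)
qed

text \<open>
The condition on the right asks for nothing at \<open>y = x\<close>, so that the distinction between isolated
and other points disappears from all later arguments.
\<close>

lemma slope_le_iff:
  assumes x: "x \<in> space m" and s: "0 \<le> s"
  shows "slope d m f x \<le> ennreal s \<longleftrightarrow>
    (\<forall>e>0. \<exists>r>0. \<forall>y\<in>space m. d x y < r \<longrightarrow> \<bar>f y - f x\<bar> \<le> (s + e) * d x y)"
    (is "_ \<longleftrightarrow> ?R")
proof
  assume le: "slope d m f x \<le> ennreal s"
  show ?R
  proof (intro allI impI)
    fix e :: real assume e: "0 < e"
    have "ennreal s < ennreal (s + e)"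
      using s e by (simp add: ennreal_lessI)
    then have "\<forall>\<^sub>F y in atin mtopology x. ennreal (\<bar>f y - f x\<bar> / d y x) < ennreal (s + e)"
      using le unfolding slope_def Limsup_le_iff by auto
    then obtain r where r: "r > 0" "\<And>y. y \<in> space m \<Longrightarrow> 0 < d y x \<Longrightarrow> d y x < r \<Longrightarrow>
        ennreal (\<bar>f y - f x\<bar> / d y x) < ennreal (s + e)"
      unfolding eventually_atin_metric using x by auto
    have "\<bar>f y - f x\<bar> \<le> (s + e) * d x y" if y: "y \<in> space m" "d x y < r" for y
    proof (cases "y = x")
      case True then show ?thesis using x by auto
    next
      case False
      then have p: "0 < d y x" using x y by auto
      have "\<bar>f y - f x\<bar> / d y x < s + e"
        using r(2)[OF y(1) p] y(2) s e p commute[of x y] ennreal_less_iff[of "\<bar>f y - f x\<bar> / d y x" "s + e"]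
        by simp
      then have "\<bar>f y - f x\<bar> < (s + e) * d y x" using p by (simp add: pos_divide_less_eq)
      then show ?thesis by (simp add: commute)
    qed
    then show "\<exists>r>0. \<forall>y\<in>space m. d x y < r \<longrightarrow> \<bar>f y - f x\<bar> \<le> (s + e) * d x y"
      using r(1) by blast
  qed
next
  assume R: ?R
  show "slope d m f x \<le> ennreal s"
    unfolding slope_def Limsup_le_iff
  proof (intro allI impI)
    fix c assume c: "ennreal s < c"
    obtain e where e: "e > 0" "ennreal (s + e) < c"
    proof -
      obtain w where w: "ennreal s < w" "w < c" using c dense by blast
      then obtain w' where "w = ennreal w'" "0 \<le> w'"
        by (cases w) auto
      then show thesis using w s by (intro that[of "w' - s"]) (auto simp: ennreal_less_iff)
    qed
    obtain r where r: "r > 0" "\<And>y. y \<in> space m \<Longrightarrow> d x y < r \<Longrightarrow> \<bar>f y - f x\<bar> \<le> (s + e) * d x y"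
      using R e by blast
    have "ennreal (\<bar>f y - f x\<bar> / d y x) < c" if y: "y \<in> space m" "0 < d y x" "d y x < r" for y
    proof -
      have "\<bar>f y - f x\<bar> / d y x \<le> s + e"
        using r(2)[OF y(1)] y by (simp add: commute pos_divide_le_eq)
      then show ?thesis using e(2) ennreal_leI le_less_trans by blast
    qed
    then show "\<forall>\<^sub>F y in atin mtopology x. ennreal (\<bar>f y - f x\<bar> / d y x) < c"
      unfolding eventually_atin_metric using r(1) by blast
  qed
qed

lemma slope_lip_le:
  assumes "lip K f" "x \<in> space m"
  shows "slope d m f x \<le> ennreal K"
proof (subst slope_le_iff)
  show "\<forall>e>0. \<exists>r>0. \<forall>y\<in>space m. d x y < r \<longrightarrow> \<bar>f y - f x\<bar> \<le> (K + e) * d x y"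
  proof (intro allI impI)
    fix e :: real assume "e > 0"
    have "\<bar>f y - f x\<bar> \<le> (K + e) * d x y" if "y \<in> space m" for y
    proof -
      have "0 \<le> e * d x y" using \<open>e > 0\<close> by simp
      then show ?thesis
        using lipD[OF assms(1) that assms(2)] commute[of x y] by (simp add: distrib_right)
    qed
    then show "\<exists>r>0. \<forall>y\<in>space m. d x y < r \<longrightarrow> \<bar>f y - f x\<bar> \<le> (K + e) * d x y"
      by (intro exI[of _ 1]) auto
  qed
qed (use assms lip_nonneg in auto)

lemma rslope_nonneg [simp]: "0 \<le> rslope f x"
  by (simp add: rslope_def)

lemma ennreal_rslope:
  assumes "lip K f" "x \<in> space m"
  shows "ennreal (rslope f x) = slope d m f x"
  unfolding rslope_def using le_less_trans[OF slope_lip_le[OF assms] ennreal_less_top]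
  by (rule ennreal_enn2real)

lemma rslope_le_iff:
  assumes "lip K f" "x \<in> space m" "0 \<le> s"
  shows "rslope f x \<le> s \<longleftrightarrow>
    (\<forall>e>0. \<exists>r>0. \<forall>y\<in>space m. d x y < r \<longrightarrow> \<bar>f y - f x\<bar> \<le> (s + e) * d x y)"
  unfolding slope_le_iff[OF assms(2,3), symmetric] ennreal_rslope[OF assms(1,2), symmetric]
  using assms by simp

lemma rslope_le:
  assumes "lip K f" "x \<in> space m"
  shows "rslope f x \<le> K"
  using slope_lip_le[OF assms] ennreal_rslope[OF assms] lip_nonneg[OF assms(1)]
  by (metis ennreal_le_iff)

lemma slD:
  assumes "lip K f" "x \<in> space m" "e > 0"
  obtains r where "r > 0"
    "\<And>y. y \<in> space m \<Longrightarrow> d x y < r \<Longrightarrow> \<bar>f y - f x\<bar> \<le> (rslope f x + e) * d x y"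
  using rslope_le_iff[OF assms(1,2), of "rslope f x"] assms(3) by auto

text \<open>
Up to second order in \<open>d x y\<close>, the increment of the combination is the sum of the convex combination
of the increments of \<open>f\<close> and \<open>g\<close> and of the increment of \<open>c\<close> times \<open>g x - f x\<close>. The remainder is a
product of two increments of Lipschitz functions.
\<close>

lemma rslope_glue:
  assumes f: "lip K f" and g: "lip K' g" and c: "lip K'' c"
    and h: "lip K3 (\<lambda>x. (1 - c x) * f x + c x * g x)"
    and c01: "\<And>x. x \<in> space m \<Longrightarrow> 0 \<le> c x \<and> c x \<le> 1" and x: "x \<in> space m"
  shows "rslope (\<lambda>x. (1 - c x) * f x + c x * g x) x
     \<le> (1 - c x) * rslope f x + c x * rslope g x + rslope c x * \<bar>g x - f x\<bar>" (is "_ \<le> ?s")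
proof -
  have s0: "0 \<le> ?s" using c01[OF x] by auto
  show ?thesis
  proof (subst rslope_le_iff[OF h x s0], intro allI impI)
    fix e :: real assume e: "0 < e"
    define D where "D = \<bar>g x - f x\<bar>"
    define e1 where "e1 = e / (3 + D)"
    have D0: "D \<ge> 0" by (simp add: D_def)
    have e1: "e1 > 0" using e D0 by (simp add: e1_def)
    obtain r1 where r1: "r1 > 0" "\<And>y. y \<in> space m \<Longrightarrow> d x y < r1 \<Longrightarrow> \<bar>f y - f x\<bar> \<le> (rslope f x + e1) * d x y"
      using slD[OF f x e1] by metis
    obtain r2 where r2: "r2 > 0" "\<And>y. y \<in> space m \<Longrightarrow> d x y < r2 \<Longrightarrow> \<bar>g y - g x\<bar> \<le> (rslope g x + e1) * d x y"
      using slD[OF g x e1] by metis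
    obtain r3 where r3: "r3 > 0" "\<And>y. y \<in> space m \<Longrightarrow> d x y < r3 \<Longrightarrow> \<bar>c y - c x\<bar> \<le> (rslope c x + e1) * d x y"
      using slD[OF c x e1] by metis
    define Q where "Q = K'' * (K + K') + 1"
    have Q: "Q > 0" using lip_nonneg[OF f] lip_nonneg[OF g] lip_nonneg[OF c] by (simp add: Q_def add_nonneg_pos)
    define r where "r = Min {r1, r2, r3, e1 / Q}"
    have r: "r > 0" using r1 r2 r3 e1 Q by (simp add: r_def)
    have "\<bar>((1 - c y) * f y + c y * g y) - ((1 - c x) * f x + c x * g x)\<bar> \<le> (?s + e) * d x y"
      if y: "y \<in> space m" "d x y < r" for y
    proof -
      let ?d = "d x y"
      have d0: "0 \<le> ?d" by simp
      have b1: "\<bar>f y - f x\<bar> \<le> (rslope f x + e1) * ?d" using r1 y by (auto simp: r_def)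
      have b2: "\<bar>g y - g x\<bar> \<le> (rslope g x + e1) * ?d" using r2 y by (auto simp: r_def)
      have b3: "\<bar>c y - c x\<bar> \<le> (rslope c x + e1) * ?d" using r3 y by (auto simp: r_def)
      have b4: "\<bar>c y - c x\<bar> * \<bar>(g y - g x) - (f y - f x)\<bar> \<le> e1 * ?d"
      proof -
        have "\<bar>c y - c x\<bar> * \<bar>(g y - g x) - (f y - f x)\<bar> \<le> (K'' * ?d) * ((K + K') * ?d)"
          using lipD[OF f y(1) x] lipD[OF g y(1) x] lipD[OF c y(1) x]
          by (intro mult_mono) (auto simp: commute algebra_simps)
        also have "\<dots> \<le> Q * ?d * ?d" by (simp add: Q_def algebra_simps)
        also have "Q * ?d \<le> e1" using y Q by (simp add: r_def field_simps)
        then have "Q * ?d * ?d \<le> e1 * ?d" using d0 by (rule mult_right_mono)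
        finally show ?thesis .
      qed
      have "((1 - c y) * f y + c y * g y) - ((1 - c x) * f x + c x * g x) =
        (1 - c x) * (f y - f x) + c x * (g y - g x) + (c y - c x) * (g x - f x)
        + (c y - c x) * ((g y - g x) - (f y - f x))" by (simp add: algebra_simps)
      also have "\<bar>\<dots>\<bar> \<le> (1 - c x) * \<bar>f y - f x\<bar> + c x * \<bar>g y - g x\<bar> + \<bar>c y - c x\<bar> * D
        + \<bar>c y - c x\<bar> * \<bar>(g y - g x) - (f y - f x)\<bar>"
        unfolding D_def using c01[OF x]
        by (intro order_trans[OF abs_triangle_ineq] add_mono) (auto simp: abs_mult)
      also have "\<dots> \<le> (1 - c x) * ((rslope f x + e1) * ?d) + c x * ((rslope g x + e1) * ?d)
          + ((rslope c x + e1) * ?d) * D + e1 * ?d"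
        using c01[OF x] D0 b1 b2 b3 b4 by (intro add_mono mult_left_mono mult_right_mono) auto
      also have "\<dots> = (?s + e1 * (2 + D)) * ?d" by (simp add: D_def algebra_simps)
      also have "\<dots> \<le> (?s + e) * ?d"
        using e D0 d0 by (intro mult_right_mono add_left_mono) (auto simp: e1_def field_simps)
      finally show ?thesis .
    qed
    then show "\<exists>r>0. \<forall>y\<in>space m. d x y < r \<longrightarrow>
       \<bar>(1 - c y) * f y + c y * g y - ((1 - c x) * f x + c x * g x)\<bar> \<le> (?s + e) * d x y"
      using r by blast
  qed
qed

lemma rslope_add_le:
  assumes f: "lip K f" and g: "lip K' g" and h: "lip K'' (\<lambda>x. f x + g x)" and x: "x \<in> space m"
  shows "rslope (\<lambda>x. f x + g x) x \<le> rslope f x + rslope g x"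
proof (subst rslope_le_iff[OF h x], simp, intro allI impI)
  fix e :: real assume e: "0 < e"
  then have e2: "e / 2 > 0" by simp
  obtain r1 where r1: "r1 > 0" "\<And>y. y \<in> space m \<Longrightarrow> d x y < r1 \<Longrightarrow> \<bar>f y - f x\<bar> \<le> (rslope f x + e/2) * d x y"
    using slD[OF f x e2] by metis
  obtain r2 where r2: "r2 > 0" "\<And>y. y \<in> space m \<Longrightarrow> d x y < r2 \<Longrightarrow> \<bar>g y - g x\<bar> \<le> (rslope g x + e/2) * d x y"
    using slD[OF g x e2] by metis
  have "\<bar>f y + g y - (f x + g x)\<bar> \<le> (rslope f x + rslope g x + e) * d x y"
    if "y \<in> space m" "d x y < min r1 r2" for y
  proof -
    have "\<bar>f y + g y - (f x + g x)\<bar> \<le> \<bar>f y - f x\<bar> + \<bar>g y - g x\<bar>" by linarith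
    also have "\<dots> \<le> (rslope f x + e/2) * d x y + (rslope g x + e/2) * d x y"
      using r1 r2 that by (intro add_mono) auto
    also have "\<dots> = (rslope f x + rslope g x + e) * d x y" by (simp add: algebra_simps)
    finally show ?thesis .
  qed
  then show "\<exists>r>0. \<forall>y\<in>space m. d x y < r \<longrightarrow> \<bar>f y + g y - (f x + g x)\<bar> \<le> (rslope f x + rslope g x + e) * d x y"
    using r1 r2 by (intro exI[of _ "min r1 r2"]) auto
qed

text \<open>
Applied below to truncations, which do not increase slopes, and to multiples.
\<close>

lemma rslope_mono:
  assumes f: "lip K f" and g: "lip K' g" and x: "x \<in> space m" and "0 \<le> k"
    and le: "\<And>y. y \<in> space m \<Longrightarrow> \<bar>g y - g x\<bar> \<le> k * \<bar>f y - f x\<bar>"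
  shows "rslope g x \<le> k * rslope f x"
proof (subst rslope_le_iff[OF g x])
  show "0 \<le> k * rslope f x" using \<open>0 \<le> k\<close> by simp
  show "\<forall>e>0. \<exists>r>0. \<forall>y\<in>space m. d x y < r \<longrightarrow> \<bar>g y - g x\<bar> \<le> (k * rslope f x + e) * d x y"
  proof (intro allI impI)
    fix e :: real assume e: "0 < e"
    then have e2: "e / (k + 1) > 0" using \<open>0 \<le> k\<close> by simp
    obtain r where r: "r > 0" "\<And>y. y \<in> space m \<Longrightarrow> d x y < r \<Longrightarrow> \<bar>f y - f x\<bar> \<le> (rslope f x + e / (k + 1)) * d x y"
      using slD[OF f x e2] by metis
    have "\<bar>g y - g x\<bar> \<le> (k * rslope f x + e) * d x y" if y: "y \<in> space m" "d x y < r" for y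
    proof -
      have "\<bar>g y - g x\<bar> \<le> k * ((rslope f x + e / (k + 1)) * d x y)"
        using le[OF y(1)] r(2)[OF y] \<open>0 \<le> k\<close> by (meson mult_left_mono order_trans)
      also have "\<dots> = (k * rslope f x + e * (k / (k + 1))) * d x y" by (simp add: algebra_simps)
      also have "\<dots> \<le> (k * rslope f x + e) * d x y"
        using \<open>0 \<le> k\<close> e by (intro mult_right_mono add_left_mono) (auto simp: field_simps)
      finally show ?thesis .
    qed
    then show "\<exists>r>0. \<forall>y\<in>space m. d x y < r \<longrightarrow> \<bar>g y - g x\<bar> \<le> (k * rslope f x + e) * d x y"
      using r(1) by blast
  qed
qed

lemma rslope_cmult:
  assumes f: "lip K f" and g: "lip K' (\<lambda>x. k * f x)" and x: "x \<in> space m"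
  shows "rslope (\<lambda>x. k * f x) x \<le> \<bar>k\<bar> * rslope f x"
  by (rule rslope_mono[OF f g x]) (auto simp flip: right_diff_distrib simp: abs_mult)

lemma rslope_local_zero:
  assumes f: "lip K f" and x: "x \<in> space m" and "r > 0"
    and c: "\<And>y. y \<in> space m \<Longrightarrow> d x y < r \<Longrightarrow> f y = f x"
  shows "rslope f x = 0"
proof -
  have "rslope f x \<le> 0"
    by (subst rslope_le_iff[OF f x]) (use c \<open>r > 0\<close> in \<open>force intro!: exI[of _ r]\<close>)+
  then show ?thesis by (simp add: antisym)
qed

lemma openin_sets: "openin mtopology U \<Longrightarrow> U \<in> borel_sets_of d m"
  unfolding borel_sets_of_def by auto

lemma openin_sets_m: "openin mtopology U \<Longrightarrow> U \<in> sets m"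
  using openin_sets borel_sets by blast

definition "borel_alg = sigma (space m) {U. openin mtopology U}"

lemma sets_borel_alg: "sets borel_alg = borel_sets_of d m" and space_borel_alg [simp]: "space borel_alg = space m"
  unfolding borel_alg_def borel_sets_of_def
  using openin_mtopology by (auto simp: sets_measure_of_conv space_measure_of_conv)

lemma borel_alg_measurableD: "f \<in> borel_measurable borel_alg \<Longrightarrow> f \<in> borel_measurable m"
  using borel_sets unfolding measurable_def by (auto simp: sets_borel_alg)

text \<open>
Openness of these sets is the source of Borel measurability of slopes: a slope is a countable
infimum, over radii, of suprema of difference quotients over punctured balls, and such a supremum
is lower semicontinuous in the centre.
\<close>

lemma lip_open:
  assumes f: "lip K f" and "0 < r"
  shows "openin mtopology {x \<in> space m. \<exists>y\<in>space m. d x y < r \<and> t * d x y < \<bar>f y - f x\<bar>}"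
  unfolding openin_mtopology
proof (intro conjI allI impI)
  fix x assume "x \<in> {x \<in> space m. \<exists>y\<in>space m. d x y < r \<and> t * d x y < \<bar>f y - f x\<bar>}"
  then obtain y where x: "x \<in> space m" and y: "y \<in> space m" "d x y < r" "t * d x y < \<bar>f y - f x\<bar>" by auto
  define s where "s = min (r - d x y) ((\<bar>f y - f x\<bar> - t * d x y) / (\<bar>t\<bar> + K + 1))"
  have K: "0 \<le> K" using lip_nonneg[OF f] .
  have s: "s > 0" using y K by (simp add: s_def)
  have "d w y < r \<and> t * d w y < \<bar>f y - f w\<bar>" if w: "w \<in> space m" "d x w < s" for w
  proof
    have t1: "d w y \<le> d x w + d x y" using triangle[of w x y] x y w by (simp add: commute)
    have t2: "d x y \<le> d x w + d w y" using triangle[of x w y] x y w by simp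
    show "d w y < r" using t1 w by (simp add: s_def)
    have a: "\<bar>d w y - d x y\<bar> \<le> d x w" using t1 t2 by linarith
    have "t * d w y - t * d x y = t * (d w y - d x y)" by (simp add: algebra_simps)
    also have "\<dots> \<le> \<bar>t\<bar> * d x w" using a
      by (metis abs_ge_self abs_mult abs_ge_zero mult_left_mono order_trans)
    finally have b: "t * d w y \<le> t * d x y + \<bar>t\<bar> * d x w" by simp
    have c: "\<bar>f x - f w\<bar> \<le> K * d x w" using lipD[OF f x w(1)] .
    have "(\<bar>t\<bar> + K + 1) * d x w < \<bar>f y - f x\<bar> - t * d x y"
      using w(2) K by (simp add: s_def pos_less_divide_eq mult.commute)
    moreover have "(\<bar>t\<bar> + K + 1) * d x w = \<bar>t\<bar> * d x w + K * d x w + d x w"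
      by (simp add: distrib_right)
    ultimately have "\<bar>t\<bar> * d x w + K * d x w < \<bar>f y - f x\<bar> - t * d x y"
      using nonneg[of x w] by linarith
    with b c show "t * d w y < \<bar>f y - f w\<bar>" by linarith
  qed
  then show "\<exists>s>0. mball x s \<subseteq> {x \<in> space m. \<exists>y\<in>space m. d x y < r \<and> t * d x y < \<bar>f y - f x\<bar>}"
    using s y(1) by (intro exI[of _ s]) (auto intro!: bexI[of _ y])
qed auto

lemma rslope_measurable_borel_alg:
  assumes f: "lip K f"
  shows "rslope f \<in> borel_measurable borel_alg"
proof (rule borel_measurableI_le)
  fix s
  show "{x \<in> space borel_alg. rslope f x \<le> s} \<in> sets borel_alg"
  proof (cases "0 \<le> s")
    case False
    then have "{x \<in> space borel_alg. rslope f x \<le> s} = {}" using rslope_nonneg[of f] by (auto simp: not_le intro: less_le_trans)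
    then show ?thesis by (simp only: sets.empty_sets)
  next
    case True
    define V where "V n k = {x \<in> space m. \<exists>y\<in>space m. d x y < 1 / real (Suc k) \<and>
       (s + 1 / real (Suc n)) * d x y < \<bar>f y - f x\<bar>}" for n k :: nat
    have V: "V n k \<in> sets borel_alg" for n k
      unfolding V_def sets_borel_alg by (rule openin_sets[OF lip_open[OF f]]) auto
    have "{x \<in> space borel_alg. rslope f x \<le> s} = (\<Inter>n. \<Union>k. space borel_alg - V n k)"
    proof (intro set_eqI iffI)
      fix x assume "x \<in> {x \<in> space borel_alg. rslope f x \<le> s}"
      then have x: "x \<in> space m" "rslope f x \<le> s" by auto
      have "\<exists>k. x \<notin> V n k" for n
      proof -
        obtain r where r: "r > 0" "\<And>y. y \<in> space m \<Longrightarrow> d x y < r \<Longrightarrow> \<bar>f y - f x\<bar> \<le> (s + 1 / real (Suc n)) * d x y"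
          using x(2) unfolding rslope_le_iff[OF f x(1) True]
          by (metis of_nat_0_less_iff zero_less_Suc zero_less_divide_1_iff)
        obtain k where k: "1 / real (Suc k) < r" using r(1) nat_approx_posE by blast
        then show ?thesis using r(2) by (intro exI[of _ k]) (force simp: V_def)
      qed
      then show "x \<in> (\<Inter>n. \<Union>k. space borel_alg - V n k)" using x by auto
    next
      fix x assume *: "x \<in> (\<Inter>n. \<Union>k. space borel_alg - V n k)"
      then have x: "x \<in> space m" by auto
      have "\<exists>r>0. \<forall>y\<in>space m. d x y < r \<longrightarrow> \<bar>f y - f x\<bar> \<le> (s + e) * d x y" if e: "e > 0" for e
      proof -
        obtain n where n: "1 / real (Suc n) < e" using e nat_approx_posE by blast
        obtain k where k: "x \<notin> V n k" using * by blast
        have "\<bar>f y - f x\<bar> \<le> (s + e) * d x y" if y: "y \<in> space m" "d x y < 1 / real (Suc k)" for y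
        proof -
          have "\<bar>f y - f x\<bar> \<le> (s + 1 / real (Suc n)) * d x y"
            using k x y by (auto simp: V_def not_less)
          also have "\<dots> \<le> (s + e) * d x y" using n by (intro mult_right_mono) auto
          finally show ?thesis .
        qed
        then show ?thesis by (intro exI[of _ "1 / real (Suc k)"]) auto
      qed
      then show "x \<in> {x \<in> space borel_alg. rslope f x \<le> s}"
        using rslope_le_iff[OF f x True] x by auto
    qed
    moreover have "(\<Inter>n. \<Union>k. space borel_alg - V n k) \<in> sets borel_alg"
    proof (intro sets.countable_INT image_subsetI)
      show "(\<Union>k. space borel_alg - V n k) \<in> sets borel_alg" for n
        by (intro sets.countable_UN image_subsetI sets.compl_sets V)
    qed simp
    ultimately show ?thesis by simp
  qed
qed

lemma rslope_measurable [measurable]: "lip K f \<Longrightarrow> rslope f \<in> borel_measurable m"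
  using rslope_measurable_borel_alg borel_alg_measurableD by blast

lemma lip_measurable_borel_alg:
  assumes f: "lip K f"
  shows "f \<in> borel_measurable borel_alg"
proof (rule borel_measurableI_greater)
  fix s
  have "openin mtopology {x \<in> space m. s < f x}"
    unfolding openin_mtopology
  proof (intro conjI allI impI)
    fix x assume "x \<in> {x \<in> space m. s < f x}"
    then have x: "x \<in> space m" "s < f x" by auto
    have K: "0 \<le> K" using lip_nonneg[OF f] .
    have "s < f w" if w: "w \<in> space m" "d x w < (f x - s) / (K + 1)" for w
    proof -
      have "(K + 1) * d x w < f x - s" using w(2) K by (simp add: pos_less_divide_eq mult.commute)
      moreover have "K * d x w \<le> (K + 1) * d x w" by (intro mult_right_mono) auto
      ultimately show ?thesis using lipD[OF f x(1) w(1)] by linarith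
    qed
    then show "\<exists>r>0. mball x r \<subseteq> {x \<in> space m. s < f x}"
      using x K by (intro exI[of _ "(f x - s) / (K + 1)"]) auto
  qed auto
  then show "{x \<in> space borel_alg. s < f x} \<in> sets borel_alg" by (simp add: sets_borel_alg openin_sets)
qed

lemma lip_measurable [measurable]: "lip K f \<Longrightarrow> f \<in> borel_measurable m"
  using lip_measurable_borel_alg borel_alg_measurableD by blast

end

section \<open>Lipschitz functions with bounded support\<close>

context metric_measure
begin

lemma mball_sets [measurable]: "mball x r \<in> sets m"
  by (rule openin_sets_m) simp

lemma lip_dist: "lip 1 (\<lambda>x. d z x)"
  unfolding lip_def
  using triangle[OF z] z commute by (smt (verit, best))

lemma dist_measurable [measurable]: "(\<lambda>x. d z x) \<in> borel_measurable m"
  using lip_measurable[OF lip_dist] .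

lemma lip_const [simp]: "lip 0 (\<lambda>x. c)"
  by (simp add: lip_def)

lemma lip_add: "lip K f \<Longrightarrow> lip K' g \<Longrightarrow> lip (K + K') (\<lambda>x. f x + g x)"
  unfolding lip_def by (force simp: distrib_right intro: order_trans[OF _ add_mono])

lemma lip_cmult:
  assumes "lip K f"
  shows "lip (\<bar>c\<bar> * K) (\<lambda>x. c * f x)"
  unfolding lip_def
proof (intro conjI ballI)
  fix x y assume xy: "x \<in> space m" "y \<in> space m"
  have "\<bar>c * f x - c * f y\<bar> = \<bar>c\<bar> * \<bar>f x - f y\<bar>" by (simp flip: right_diff_distrib add: abs_mult)
  also have "\<dots> \<le> \<bar>c\<bar> * (K * d x y)" using lipD[OF assms xy] by (rule mult_left_mono) simp
  finally show "\<bar>c * f x - c * f y\<bar> \<le> \<bar>c\<bar> * K * d x y" by simp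
qed (use lip_nonneg[OF assms] in simp)

lemma lip_diff: "lip K f \<Longrightarrow> lip K' g \<Longrightarrow> lip (K + K') (\<lambda>x. f x - g x)"
  using lip_add[of K f K' "\<lambda>x. -1 * g x"] lip_cmult[of K' g "-1"] by simp

lemma lip_comp:
  assumes f: "lip K f" and k: "0 \<le> k" and g: "\<And>s t. \<bar>g s - g t\<bar> \<le> k * \<bar>s - t\<bar>"
  shows "lip (k * K) (\<lambda>x. g (f x))"
  unfolding lip_def
proof (intro conjI ballI)
  fix x y assume xy: "x \<in> space m" "y \<in> space m"
  have "\<bar>g (f x) - g (f y)\<bar> \<le> k * \<bar>f x - f y\<bar>" by (rule g)
  also have "\<dots> \<le> k * (K * d x y)" using lipD[OF f xy] k by (rule mult_left_mono)
  finally show "\<bar>g (f x) - g (f y)\<bar> \<le> k * K * d x y" by simp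
qed (use lip_nonneg[OF f] k in simp)

lemma Lip_bs_iff:
  "f \<in> Lip_bs d m \<longleftrightarrow> (\<exists>K R. lip K f \<and> (\<forall>x\<in>space m. R \<le> d z x \<longrightarrow> f x = 0))"
proof -
  have "mbounded {x \<in> space m. f x \<noteq> 0} \<longleftrightarrow> (\<exists>R. \<forall>x\<in>space m. R \<le> d z x \<longrightarrow> f x = 0)" (is "?L \<longleftrightarrow> ?R")
  proof
    assume ?L
    then obtain y B where "{x \<in> space m. f x \<noteq> 0} = {} \<or> y \<in> space m \<and> (\<forall>x. x \<in> space m \<and> f x \<noteq> 0 \<longrightarrow> d y x \<le> B)"
      unfolding mbounded by auto
    then show ?R
    proof
      assume "{x \<in> space m. f x \<noteq> 0} = {}" then show ?R by blast
    next
      assume *: "y \<in> space m \<and> (\<forall>x. x \<in> space m \<and> f x \<noteq> 0 \<longrightarrow> d y x \<le> B)"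
      have "f x = 0" if x: "x \<in> space m" "d z y + B + 1 \<le> d z x" for x
        using * x triangle[of z y x] z by fastforce
      then show ?R by blast
    qed
  next
    assume ?R
    then obtain R where R: "\<forall>x\<in>space m. R \<le> d z x \<longrightarrow> f x = 0" by blast
    then have "{x \<in> space m. f x \<noteq> 0} \<subseteq> mball z R" using z by force
    then show ?L by (rule mbounded_subset[OF mbounded_mball])
  qed
  then show ?thesis unfolding Lip_bs_def Lip_iff by auto
qed

lemma Lip_bs_lip: "f \<in> Lip_bs d m \<Longrightarrow> \<exists>K. lip K f"
  by (auto simp: Lip_bs_iff)

lemma Lip_bs_bounded:
  assumes "f \<in> Lip_bs d m"
  obtains C R where "\<And>x. x \<in> space m \<Longrightarrow> \<bar>f x\<bar> \<le> C" "\<And>x. x \<in> space m \<Longrightarrow> rslope f x \<le> C"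
    "\<And>x. x \<in> space m \<Longrightarrow> R \<le> d z x \<Longrightarrow> f x = 0" "\<And>x. x \<in> space m \<Longrightarrow> R \<le> d z x \<Longrightarrow> rslope f x = 0"
    "0 \<le> C" "0 \<le> R"
proof -
  obtain K R where K: "lip K f" and R: "\<And>x. x \<in> space m \<Longrightarrow> R \<le> d z x \<Longrightarrow> f x = 0"
    using assms by (auto simp: Lip_bs_iff)
  have K0: "0 \<le> K" using lip_nonneg[OF K] .
  have b: "\<bar>f x\<bar> \<le> \<bar>f z\<bar> + K * \<bar>R\<bar>" if x: "x \<in> space m" for x
  proof (cases "R \<le> d z x")
    case True then show ?thesis using R[OF x] K0 by simp
  next
    case False
    then have "K * d z x \<le> K * \<bar>R\<bar>" using K0 by (intro mult_left_mono) auto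
    then show ?thesis using lipD[OF K z x] by linarith
  qed
  have s: "rslope f x = 0" if x: "x \<in> space m" "\<bar>R\<bar> + 1 \<le> d z x" for x
  proof (rule rslope_local_zero[OF K x(1), of 1])
    fix y assume y: "y \<in> space m" "d x y < 1"
    have "d z x \<le> d z y + d x y" using triangle[OF z y(1) x(1)] commute by simp
    then show "f y = f x" using R[OF y(1)] R[OF x(1)] x y by simp
  qed simp
  show thesis
  proof (rule that[of "\<bar>f z\<bar> + K * \<bar>R\<bar> + K" "\<bar>R\<bar> + 1"])
    fix x assume x: "x \<in> space m"
    show "\<bar>f x\<bar> \<le> \<bar>f z\<bar> + K * \<bar>R\<bar> + K" using b[OF x] K0 by linarith
    have "0 \<le> K * \<bar>R\<bar>" using K0 by simp
    then show "rslope f x \<le> \<bar>f z\<bar> + K * \<bar>R\<bar> + K" using rslope_le[OF K x] by linarith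
    show "f x = 0" if "\<bar>R\<bar> + 1 \<le> d z x" using R[OF x] that by simp
    show "rslope f x = 0" if "\<bar>R\<bar> + 1 \<le> d z x" using s[OF x that] .
  qed (use K0 in auto)
qed

lemma integrable_bs:
  assumes [measurable]: "g \<in> borel_measurable m"
    and C: "\<And>x. x \<in> space m \<Longrightarrow> \<bar>g x\<bar> \<le> C" and R: "\<And>x. x \<in> space m \<Longrightarrow> R \<le> d z x \<Longrightarrow> g x = 0"
  shows "integrable m (g :: 'a \<Rightarrow> real)"
proof (rule Bochner_Integration.integrable_bound)
  show "integrable m (\<lambda>x. \<bar>C\<bar> * indicator (mball z R) x :: real)"
    using ball_finite[of R] by (intro integrable_mult_right integrable_real_indicator) auto
  have "\<bar>g x\<bar> \<le> \<bar>C\<bar> * indicator (mball z R) x" if "x \<in> space m" for x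
    using C[OF that] R[OF that] z that by (cases "x \<in> mball z R") auto
  then show "AE x in m. norm (g x) \<le> norm (\<bar>C\<bar> * indicator (mball z R) x :: real)"
    by (intro AE_I2) (simp add: abs_mult)
qed simp

lemma Lip_bs_measurable [measurable_dest]: "f \<in> Lip_bs d m \<Longrightarrow> f \<in> borel_measurable m"
  using Lip_bs_lip lip_measurable by blast

lemma Lip_bs_rslope_measurable: "f \<in> Lip_bs d m \<Longrightarrow> rslope f \<in> borel_measurable m"
  using Lip_bs_lip rslope_measurable by blast

lemma Lip_bs_integrable:
  assumes f: "f \<in> Lip_bs d m"
  shows "integrable m f"
  by (rule Lip_bs_bounded[OF f], rule integrable_bs) (use f Lip_bs_measurable in auto)

lemma Lip_bs_rslope_integrable:
  assumes f: "f \<in> Lip_bs d m"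
  shows "integrable m (rslope f)"
  by (rule Lip_bs_bounded[OF f], rule integrable_bs) (use f Lip_bs_rslope_measurable in auto)

lemma Lip_bs_L2:
  assumes f: "f \<in> Lip_bs d m"
  shows "f \<in> L2 m"
proof -
  obtain C R where C: "\<And>x. x \<in> space m \<Longrightarrow> \<bar>f x\<bar> \<le> C" "\<And>x. x \<in> space m \<Longrightarrow> R \<le> d z x \<Longrightarrow> f x = 0"
    using Lip_bs_bounded[OF f] by metis
  have [measurable]: "f \<in> borel_measurable m" using f by (rule Lip_bs_measurable)
  have "integrable m (\<lambda>x. (f x)\<^sup>2)"
    by (rule integrable_bs[where C="C\<^sup>2" and R=R])
      (use C in \<open>auto intro!: abs_le_square_iff[THEN iffD1] intro: order_trans[OF _ abs_ge_self]\<close>)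
  then show ?thesis by (simp add: L2_def)
qed

lemma Lip_bs_rslope_L2:
  assumes f: "f \<in> Lip_bs d m"
  shows "rslope f \<in> L2 m"
proof -
  obtain C R where C: "\<And>x. x \<in> space m \<Longrightarrow> rslope f x \<le> C" "\<And>x. x \<in> space m \<Longrightarrow> R \<le> d z x \<Longrightarrow> rslope f x = 0"
    using Lip_bs_bounded[OF f] by metis
  have [measurable]: "rslope f \<in> borel_measurable m" using f by (rule Lip_bs_rslope_measurable)
  have "integrable m (\<lambda>x. (rslope f x)\<^sup>2)"
    by (rule integrable_bs[where C="C\<^sup>2" and R=R])
      (use C in \<open>auto simp: power_mono\<close>)
  then show ?thesis by (simp add: L2_def)
qed

lemma Lip_bs_add:
  assumes "f \<in> Lip_bs d m" "g \<in> Lip_bs d m"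
  shows "(\<lambda>x. f x + g x) \<in> Lip_bs d m"
proof -
  obtain K R K' R' where "lip K f" "\<forall>x\<in>space m. R \<le> d z x \<longrightarrow> f x = 0"
    "lip K' g" "\<forall>x\<in>space m. R' \<le> d z x \<longrightarrow> g x = 0"
    using assms unfolding Lip_bs_iff by blast
  then have "lip (K + K') (\<lambda>x. f x + g x)" "\<forall>x\<in>space m. max R R' \<le> d z x \<longrightarrow> f x + g x = 0"
    using lip_add by auto
  then show ?thesis unfolding Lip_bs_iff by blast
qed

lemma Lip_bs_cmult: "f \<in> Lip_bs d m \<Longrightarrow> (\<lambda>x. c * f x) \<in> Lip_bs d m"
  unfolding Lip_bs_iff by (metis lip_cmult mult_zero_right)

lemma Lip_bs_diff: "f \<in> Lip_bs d m \<Longrightarrow> g \<in> Lip_bs d m \<Longrightarrow> (\<lambda>x. f x - g x) \<in> Lip_bs d m"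
  using Lip_bs_add[of f "\<lambda>x. -1 * g x"] Lip_bs_cmult[of g "-1"] by simp

text \<open>
The product is compared at a point \<open>x\<close> in a ball containing the support of \<open>c\<close>, where \<open>g\<close> is bounded,
with an arbitrary point \<open>y\<close>.
\<close>

lemma Lip_bs_mult:
  assumes c: "c \<in> Lip_bs d m" and g: "lip K' g"
  shows "(\<lambda>x. c x * g x) \<in> Lip_bs d m"
proof -
  obtain K where K: "lip K c" using Lip_bs_lip[OF c] by blast
  obtain C R where C: "\<And>x. x \<in> space m \<Longrightarrow> \<bar>c x\<bar> \<le> C" "\<And>x. x \<in> space m \<Longrightarrow> R \<le> d z x \<Longrightarrow> c x = 0" "0 \<le> C" "0 \<le> R"
    using Lip_bs_bounded[OF c] by metis
  define G where "G = \<bar>g z\<bar> + K' * R"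
  have G0: "0 \<le> G" using lip_nonneg[OF g] C by (simp add: G_def)
  have G: "\<bar>g x\<bar> \<le> G" if x: "x \<in> space m" "d z x < R" for x
  proof -
    have "K' * d z x \<le> K' * R" using lip_nonneg[OF g] x by (intro mult_left_mono) auto
    then show ?thesis using lipD[OF g z x(1)] unfolding G_def by linarith
  qed
  define D where "D = K * G + C * K'"
  have D0: "0 \<le> D" using lip_nonneg[OF g] lip_nonneg[OF K] C G0 by (simp add: D_def)
  have one: "\<bar>c x * g x - c y * g y\<bar> \<le> D * d x y" if x: "x \<in> space m" "d z x < R" and y: "y \<in> space m" for x y
  proof -
    have "c x * g x - c y * g y = (c x - c y) * g x + c y * (g x - g y)" by (simp add: algebra_simps)
    also have "\<bar>\<dots>\<bar> \<le> \<bar>c x - c y\<bar> * \<bar>g x\<bar> + \<bar>c y\<bar> * \<bar>g x - g y\<bar>"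
      by (metis abs_mult abs_triangle_ineq)
    also have "\<dots> \<le> (K * d x y) * G + C * (K' * d x y)"
      using lipD[OF K x(1) y] G[OF x] C(1)[OF y] lipD[OF g x(1) y] lip_nonneg[OF K] C
      by (intro add_mono mult_mono) auto
    finally show ?thesis by (simp add: D_def algebra_simps)
  qed
  have "lip D (\<lambda>x. c x * g x)"
    unfolding lip_def
  proof (intro conjI ballI)
    fix x y assume x: "x \<in> space m" and y: "y \<in> space m"
    consider "d z x < R" | "d z y < R" | "R \<le> d z x" "R \<le> d z y" by linarith
    then show "\<bar>c x * g x - c y * g y\<bar> \<le> D * d x y"
    proof cases
      case 1 then show ?thesis using one x y by blast
    next
      case 2 then show ?thesis using one[OF y _ x] by (simp add: commute abs_minus_commute)
    next
      case 3 then show ?thesis using C x y D0 by simp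
    qed
  qed (rule D0)
  moreover have "\<forall>x\<in>space m. R \<le> d z x \<longrightarrow> c x * g x = 0" using C by simp
  ultimately show ?thesis unfolding Lip_bs_iff by blast
qed

end

section \<open>The Cheeger energy as a relaxation\<close>

context metric_measure
begin

definition energy :: "('a \<Rightarrow> real) \<Rightarrow> real" where
  "energy f = (\<integral>x. (rslope f x)\<^sup>2 \<partial>m)"

definition cheeger :: "('a \<Rightarrow> real) \<Rightarrow> real" where
  "cheeger f = enn2real (Ch d m f)"

lemma energy_nonneg [simp]: "0 \<le> energy f" by (simp add: energy_def)
lemma cheeger_nonneg [simp]: "0 \<le> cheeger f" by (simp add: cheeger_def)

lemma nn_slope_sq:
  assumes f: "f \<in> Lip_bs d m"
  shows "(\<integral>\<^sup>+x. (slope d m f x)\<^sup>2 \<partial>m) / 2 = ennreal (energy f / 2)"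
proof -
  obtain K where K: "lip K f" using Lip_bs_lip[OF f] by blast
  have "(\<integral>\<^sup>+x. (slope d m f x)\<^sup>2 \<partial>m) = (\<integral>\<^sup>+x. ennreal ((rslope f x)\<^sup>2) \<partial>m)"
    by (intro nn_integral_cong) (simp add: ennreal_rslope[OF K, symmetric] ennreal_power)
  also have "\<dots> = ennreal (energy f)"
    unfolding energy_def using Lip_bs_rslope_L2[OF f] by (intro nn_integral_eq_integral) (auto simp: L2_def)
  finally show ?thesis using divide_ennreal[of "energy f" 2] by simp
qed

lemma nn_slope:
  assumes f: "f \<in> Lip_bs d m"
  shows "(\<integral>\<^sup>+x. slope d m f x \<partial>m) = ennreal (\<integral>x. rslope f x \<partial>m)"
proof -
  obtain K where K: "lip K f" using Lip_bs_lip[OF f] by blast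
  have "(\<integral>\<^sup>+x. slope d m f x \<partial>m) = (\<integral>\<^sup>+x. ennreal (rslope f x) \<partial>m)"
    by (intro nn_integral_cong) (simp add: ennreal_rslope[OF K, symmetric])
  also have "\<dots> = ennreal (\<integral>x. rslope f x \<partial>m)"
    using Lip_bs_rslope_integrable[OF f] by (intro nn_integral_eq_integral) auto
  finally show ?thesis .
qed

text \<open>
Together with \<open>cheeger_lower\<close> and \<open>cheeger_approx\<close> this turns the relaxation into statements about
single functions near \<open>f\<close>, without sequences: energies near \<open>f\<close> cannot drop below twice the Cheeger
energy, and they come arbitrarily close to it. The factor two is due to the one half in the
definition of the Cheeger energy.
\<close>

lemma Ch_leI:
  assumes f: "f \<in> L2 m"
    and ap: "\<And>e. e > 0 \<Longrightarrow> \<exists>g\<in>Lip_bs d m. (\<integral>x. (g x - f x)\<^sup>2 \<partial>m) < e \<and> energy g \<le> c + e"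
  shows "Ch d m f \<le> ennreal (c / 2)"
proof -
  have "\<forall>k. \<exists>g. g \<in> Lip_bs d m \<and> (\<integral>x. (g x - f x)\<^sup>2 \<partial>m) < 1 / real (Suc k) \<and> energy g \<le> c + 1 / real (Suc k)"
    using ap[of "1 / real (Suc _)"] by (metis of_nat_0_less_iff zero_less_Suc zero_less_divide_1_iff)
  then obtain F where F: "\<And>k. F k \<in> Lip_bs d m" "\<And>k. (\<integral>x. (F k x - f x)\<^sup>2 \<partial>m) < 1 / real (Suc k)"
      "\<And>k. energy (F k) \<le> c + 1 / real (Suc k)" by metis
  have "(\<lambda>k. \<integral>x. (F k x - f x)\<^sup>2 \<partial>m) \<longlonglongrightarrow> 0"
    by (rule tendsto_sandwich[OF _ _ tendsto_const LIMSEQ_inverse_real_of_nat])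
      (use F(2) in \<open>auto intro!: always_eventually less_imp_le simp: inverse_eq_divide\<close>)
  then have "L2_converges m F f"
    unfolding L2_converges_def tendsto_L2_norm_iff using F(1) f Lip_bs_L2 by auto
  then have "Ch d m f \<le> liminf (\<lambda>k. (\<integral>\<^sup>+x. (slope d m (F k) x)\<^sup>2 \<partial>m) / 2)"
    unfolding Ch_def using F(1) by (intro INF_lower) auto
  also have "\<dots> = liminf (\<lambda>k. ennreal (energy (F k) / 2))"
    using nn_slope_sq[OF F(1)] by simp
  also have "\<dots> \<le> liminf (\<lambda>k. ennreal ((c + 1 / real (Suc k)) / 2))"
    using F(3) by (intro Liminf_mono always_eventually allI ennreal_leI) simp
  also have "\<dots> = ennreal (c / 2)"
  proof (rule lim_imp_Liminf)
    have "(\<lambda>k. (c + inverse (real (Suc k))) / 2) \<longlonglongrightarrow> (c + 0) / 2"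
      by (intro tendsto_intros LIMSEQ_inverse_real_of_nat) auto
    then show "(\<lambda>k. ennreal ((c + 1 / real (Suc k)) / 2)) \<longlonglongrightarrow> ennreal (c / 2)"
      by (intro tendsto_ennrealI) (simp add: inverse_eq_divide)
  qed simp
  finally show ?thesis .
qed

lemma W12_L2: "f \<in> W12 d m \<Longrightarrow> f \<in> L2 m" by (simp add: W12_def)

lemma W12_Ch: "f \<in> W12 d m \<Longrightarrow> Ch d m f = ennreal (cheeger f)"
  by (simp add: W12_def cheeger_def)

lemma cheeger_leI:
  assumes "f \<in> L2 m"
    and "\<And>e. e > 0 \<Longrightarrow> \<exists>g\<in>Lip_bs d m. (\<integral>x. (g x - f x)\<^sup>2 \<partial>m) < e \<and> energy g \<le> c + e"
  shows "f \<in> W12 d m" "cheeger f \<le> c / 2" "0 \<le> c"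
proof -
  have le: "Ch d m f \<le> ennreal (c / 2)" by (rule Ch_leI[OF assms])
  then show W: "f \<in> W12 d m" using assms(1) by (auto simp: W12_def intro: le_less_trans)
  show c: "0 \<le> c"
  proof (rule field_le_epsilon)
    fix e :: real assume "e > 0"
    then obtain g where "energy g \<le> c + e" using assms(2) by blast
    then show "0 \<le> c + e" using energy_nonneg[of g] by linarith
  qed
  show "cheeger f \<le> c / 2" using le c by (simp add: W12_Ch[OF W])
qed

lemma cheeger_lower:
  assumes f: "f \<in> W12 d m" and e: "e > 0"
  obtains \<eta> where "\<eta> > 0" "\<And>g. g \<in> Lip_bs d m \<Longrightarrow> (\<integral>x. (g x - f x)\<^sup>2 \<partial>m) < \<eta> \<Longrightarrow> energy g > 2 * cheeger f - e"
proof (rule ccontr)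
  note obt = that
  assume "\<not> thesis"
  then have *: "\<exists>g\<in>Lip_bs d m. (\<integral>x. (g x - f x)\<^sup>2 \<partial>m) < \<eta> \<and> energy g \<le> 2 * cheeger f - e" if "\<eta> > 0" for \<eta>
    using that obt[of \<eta>] by (meson not_le)
  have "\<exists>g\<in>Lip_bs d m. (\<integral>x. (g x - f x)\<^sup>2 \<partial>m) < \<eta> \<and> energy g \<le> (2 * cheeger f - e) + \<eta>" if "\<eta> > 0" for \<eta>
    using *[OF that] that by force
  from cheeger_leI(2)[OF W12_L2[OF f] this] show False using e by simp
qed

lemma cheeger_approx:
  assumes f: "f \<in> W12 d m" and e: "e > 0"
  obtains g where "g \<in> Lip_bs d m" "(\<integral>x. (g x - f x)\<^sup>2 \<partial>m) < e" "energy g < 2 * cheeger f + e"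
proof -
  have "Ch d m f < ennreal (cheeger f + e / 2)"
    using e by (simp add: W12_Ch[OF f] ennreal_lessI)
  then obtain F where F: "\<And>k. F k \<in> Lip_bs d m" "L2_converges m F f"
    "liminf (\<lambda>k. (\<integral>\<^sup>+x. (slope d m (F k) x)\<^sup>2 \<partial>m) / 2) < ennreal (cheeger f + e / 2)"
    unfolding Ch_def INF_less_iff by auto
  have lim: "(\<lambda>k. \<integral>x. (F k x - f x)\<^sup>2 \<partial>m) \<longlonglongrightarrow> 0"
    using F(2) unfolding L2_converges_def tendsto_L2_norm_iff by auto
  have "\<not> eventually (\<lambda>k. ennreal (cheeger f + e / 2) \<le> ennreal (energy (F k) / 2)) sequentially"
    using F(3) Liminf_bounded[of "ennreal (cheeger f + e / 2)" "\<lambda>k. ennreal (energy (F k) / 2)" sequentially]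
    by (auto simp: nn_slope_sq[OF F(1)] not_le[symmetric])
  moreover have "eventually (\<lambda>k. (\<integral>x. (F k x - f x)\<^sup>2 \<partial>m) < e) sequentially"
    using lim e by (auto dest: order_tendstoD(2))
  ultimately have "\<exists>k. (\<integral>x. (F k x - f x)\<^sup>2 \<partial>m) < e \<and> \<not> ennreal (cheeger f + e / 2) \<le> ennreal (energy (F k) / 2)"
    by (metis (mono_tags, lifting) eventually_mono)
  then obtain k where "(\<integral>x. (F k x - f x)\<^sup>2 \<partial>m) < e" "\<not> ennreal (cheeger f + e / 2) \<le> ennreal (energy (F k) / 2)"
    by blast
  moreover then have "energy (F k) < 2 * cheeger f + e"
    using ennreal_leI[of "cheeger f + e / 2" "energy (F k) / 2"] by (auto simp: not_less)
  ultimately show thesis using that F(1) by blast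
qed

lemma Lip_bs_W12:
  assumes f: "f \<in> Lip_bs d m"
  shows "f \<in> W12 d m" "cheeger f \<le> energy f / 2"
proof -
  have "\<exists>g\<in>Lip_bs d m. (\<integral>x. (g x - f x)\<^sup>2 \<partial>m) < e \<and> energy g \<le> energy f + e" if "e > 0" for e
    using f that by (intro bexI[of _ f]) auto
  then show "f \<in> W12 d m" "cheeger f \<le> energy f / 2"
    using cheeger_leI[OF Lip_bs_L2[OF f], of "energy f"] by auto
qed

end

section \<open>The Cheeger energy as a quadratic form\<close>

context metric_measure
begin

lemma energy_cmult:
  assumes f: "f \<in> Lip_bs d m"
  shows "energy (\<lambda>x. c * f x) \<le> c\<^sup>2 * energy f"
proof -
  obtain K where K: "lip K f" using Lip_bs_lip[OF f] by blast
  have c: "(\<lambda>x. c * f x) \<in> Lip_bs d m" by (rule Lip_bs_cmult[OF f])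
  have "energy (\<lambda>x. c * f x) \<le> (\<integral>x. c\<^sup>2 * (rslope f x)\<^sup>2 \<partial>m)"
    unfolding energy_def
  proof (rule integral_mono)
    fix x assume x: "x \<in> space m"
    have "(rslope (\<lambda>x. c * f x) x)\<^sup>2 \<le> (\<bar>c\<bar> * rslope f x)\<^sup>2"
      by (intro power_mono rslope_cmult[OF K lip_cmult[OF K] x]) simp
    then show "(rslope (\<lambda>x. c * f x) x)\<^sup>2 \<le> c\<^sup>2 * (rslope f x)\<^sup>2" by (simp add: power_mult_distrib)
  qed (use Lip_bs_rslope_L2[OF c] Lip_bs_rslope_L2[OF f] in \<open>auto simp: L2_def\<close>)
  then show ?thesis by (simp add: energy_def)
qed

lemma
  assumes f: "f \<in> W12 d m"
  shows W12_cmult: "(\<lambda>x. c * f x) \<in> W12 d m" and cheeger_cmult_le: "cheeger (\<lambda>x. c * f x) \<le> c\<^sup>2 * cheeger f"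
proof -
  have "\<exists>g\<in>Lip_bs d m. (\<integral>x. (g x - c * f x)\<^sup>2 \<partial>m) < e \<and> energy g \<le> 2 * c\<^sup>2 * cheeger f + e" if e: "e > 0" for e
  proof -
    define e' where "e' = e / (c\<^sup>2 + 1)"
    have c1: "c\<^sup>2 + 1 > 0" by (simp add: add_nonneg_pos)
    have e': "e' > 0" using e c1 by (simp add: e'_def)
    have ce: "c\<^sup>2 * e' < e" using e c1 by (simp add: e'_def field_simps)
    obtain g where g: "g \<in> Lip_bs d m" "(\<integral>x. (g x - f x)\<^sup>2 \<partial>m) < e'" "energy g < 2 * cheeger f + e'"
      using cheeger_approx[OF f e'] by metis
    have "(\<integral>x. (c * g x - c * f x)\<^sup>2 \<partial>m) = c\<^sup>2 * (\<integral>x. (g x - f x)\<^sup>2 \<partial>m)"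
      by (simp flip: right_diff_distrib add: power_mult_distrib)
    also have "\<dots> \<le> c\<^sup>2 * e'" using g(2) by (intro mult_left_mono) auto
    also note ce
    finally have 1: "(\<integral>x. (c * g x - c * f x)\<^sup>2 \<partial>m) < e" .
    have "energy (\<lambda>x. c * g x) \<le> c\<^sup>2 * energy g" by (rule energy_cmult[OF g(1)])
    also have "\<dots> \<le> c\<^sup>2 * (2 * cheeger f + e')" using g(3) by (intro mult_left_mono) auto
    also have "\<dots> \<le> 2 * c\<^sup>2 * cheeger f + e" using ce by (simp add: algebra_simps)
    finally show ?thesis using 1 by (intro bexI[OF _ Lip_bs_cmult[OF g(1), of c]]) simp
  qed
  from cheeger_leI[OF L2_cmult[OF W12_L2[OF f]] this]
  show "(\<lambda>x. c * f x) \<in> W12 d m" "cheeger (\<lambda>x. c * f x) \<le> c\<^sup>2 * cheeger f" by auto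
qed

lemma cheeger_cmult:
  assumes f: "f \<in> W12 d m" and "c \<noteq> 0"
  shows "cheeger (\<lambda>x. c * f x) = c\<^sup>2 * cheeger f"
proof (rule antisym[OF cheeger_cmult_le[OF f]])
  have "cheeger (\<lambda>x. inverse c * (c * f x)) \<le> (inverse c)\<^sup>2 * cheeger (\<lambda>x. c * f x)"
    by (rule cheeger_cmult_le[OF W12_cmult[OF f]])
  then have "cheeger f \<le> (inverse c)\<^sup>2 * cheeger (\<lambda>x. c * f x)" using \<open>c \<noteq> 0\<close> by (simp flip: mult.assoc)
  then show "c\<^sup>2 * cheeger f \<le> cheeger (\<lambda>x. c * f x)"
    using \<open>c \<noteq> 0\<close> by (simp add: power_inverse inverse_eq_divide field_simps)
qed

lemma subdiffD:
  assumes v: "v \<in> Ch_subdiff d m f"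
  shows "v \<in> L2 m" "f \<in> W12 d m"
    and "g \<in> W12 d m \<Longrightarrow> cheeger f + (\<integral>x. v x * (g x - f x) \<partial>m) \<le> cheeger g"
proof -
  show "v \<in> L2 m" and f: "f \<in> W12 d m" using v by (auto simp: Ch_subdiff_def)
  show "cheeger f + (\<integral>x. v x * (g x - f x) \<partial>m) \<le> cheeger g" if g: "g \<in> W12 d m"
  proof -
    have "enn2ereal (Ch d m f) + ereal (\<integral>x. v x * (g x - f x) \<partial>m) \<le> enn2ereal (Ch d m g)"
      using v W12_L2[OF g] by (auto simp: Ch_subdiff_def)
    then show ?thesis unfolding W12_Ch[OF f] W12_Ch[OF g] by (simp add: enn2ereal_ennreal)
  qed
qed

lemma subdiff_add_le:
  assumes v: "v \<in> Ch_subdiff d m f" and h: "(\<lambda>x. f x + h x) \<in> W12 d m"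
  shows "cheeger f + (\<integral>x. v x * h x \<partial>m) \<le> cheeger (\<lambda>x. f x + h x)"
  using subdiffD(3)[OF v h] by simp

end

locale hilbertian_space = metric_measure +
  assumes hilbertian: "infinitesimally_Hilbertian d m"
begin

lemma W12_add_aux:
  assumes f: "f \<in> W12 d m" and g: "g \<in> W12 d m"
  shows "(\<lambda>x. f x + g x) \<in> W12 d m \<and> (\<lambda>x. f x - g x) \<in> W12 d m \<and>
    cheeger (\<lambda>x. f x + g x) + cheeger (\<lambda>x. f x - g x) = 2 * cheeger f + 2 * cheeger g"
proof -
  have eq: "2 * Ch d m f + 2 * Ch d m g = Ch d m (\<lambda>x. f x + g x) + Ch d m (\<lambda>x. f x - g x)"
    using hilbertian f g unfolding infinitesimally_Hilbertian_def by blast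
  have "2 * Ch d m f + 2 * Ch d m g = ennreal (2 * cheeger f + 2 * cheeger g)"
    unfolding W12_Ch[OF f] W12_Ch[OF g] by (simp add: ennreal_plus ennreal_mult)
  then have s: "Ch d m (\<lambda>x. f x + g x) + Ch d m (\<lambda>x. f x - g x) = ennreal (2 * cheeger f + 2 * cheeger g)"
    using eq by simp
  then have "Ch d m (\<lambda>x. f x + g x) + Ch d m (\<lambda>x. f x - g x) < \<infinity>" by simp
  then have "Ch d m (\<lambda>x. f x + g x) < \<infinity>" "Ch d m (\<lambda>x. f x - g x) < \<infinity>"
    by auto
  then have W: "(\<lambda>x. f x + g x) \<in> W12 d m" "(\<lambda>x. f x - g x) \<in> W12 d m"
    using f g by (auto simp: W12_def L2_add L2_diff)
  have "ennreal (cheeger (\<lambda>x. f x + g x) + cheeger (\<lambda>x. f x - g x)) = ennreal (2 * cheeger f + 2 * cheeger g)"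
    using s unfolding W12_Ch[OF W(1)] W12_Ch[OF W(2)] by (simp add: ennreal_plus)
  then have "cheeger (\<lambda>x. f x + g x) + cheeger (\<lambda>x. f x - g x) = 2 * cheeger f + 2 * cheeger g"
    by (subst (asm) ennreal_inj) auto
  with W show ?thesis by simp
qed

lemma W12_add: "f \<in> W12 d m \<Longrightarrow> g \<in> W12 d m \<Longrightarrow> (\<lambda>x. f x + g x) \<in> W12 d m"
  using W12_add_aux by blast

lemma parallelogram:
  "f \<in> W12 d m \<Longrightarrow> g \<in> W12 d m \<Longrightarrow>
    cheeger (\<lambda>x. f x + g x) + cheeger (\<lambda>x. f x - g x) = 2 * cheeger f + 2 * cheeger g"
  using W12_add_aux by blast

text \<open>
The remainder \<open>r t\<close> of the first-order expansion of \<open>t \<mapsto> cheeger (f + t h)\<close> is non-negative, and by the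
parallelogram law \<open>r t + r (- t) = 2 t\<^sup>2 cheeger h\<close>, so it is of order \<open>t\<^sup>2\<close>. The parallelogram law
also shows that \<open>p t = r t - t\<^sup>2 cheeger h\<close> satisfies \<open>p (2 t) = 2 p t\<close>. A function of order \<open>t\<^sup>2\<close> with
this property vanishes, as one sees by going down the dyadic scales.
\<close>

lemma cheeger_expand:
  assumes v: "v \<in> Ch_subdiff d m f" and h: "h \<in> W12 d m"
  shows "cheeger (\<lambda>x. f x + h x) = cheeger f + (\<integral>x. v x * h x \<partial>m) + cheeger h"
proof -
  define I where "I = (\<integral>x. v x * h x \<partial>m)"
  define r where "r t = cheeger (\<lambda>x. f x + t * h x) - cheeger f - t * I" for t
  define p where "p t = r t - t\<^sup>2 * cheeger h" for t
  have f: "f \<in> W12 d m" using subdiffD(2)[OF v] .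
  have th: "(\<lambda>x. t * h x) \<in> W12 d m" for t by (rule W12_cmult[OF h])
  have fth: "(\<lambda>x. f x + t * h x) \<in> W12 d m" for t by (rule W12_add[OF f th])
  have r0: "0 \<le> r t" for t
  proof -
    have "(\<integral>x. v x * (t * h x) \<partial>m) = t * I"
      unfolding I_def by (simp add: mult.left_commute)
    then show ?thesis using subdiff_add_le[OF v fth, of t] by (simp add: r_def)
  qed
  have dbl: "p (2 * t) = 2 * p t" if t: "t \<noteq> 0" for t
  proof -
    have "cheeger (\<lambda>x. (f x + t * h x) + t * h x) + cheeger (\<lambda>x. (f x + t * h x) - t * h x)
        = 2 * cheeger (\<lambda>x. f x + t * h x) + 2 * cheeger (\<lambda>x. t * h x)"
      by (rule parallelogram[OF fth th])
    moreover have "(\<lambda>x. (f x + t * h x) + t * h x) = (\<lambda>x. f x + 2 * t * h x)" by (simp add: algebra_simps)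
    moreover have "(\<lambda>x. (f x + t * h x) - t * h x) = f" by simp
    ultimately have "cheeger (\<lambda>x. f x + 2 * t * h x) + cheeger f = 2 * cheeger (\<lambda>x. f x + t * h x) + 2 * (t\<^sup>2 * cheeger h)"
      using cheeger_cmult[OF h t] by simp
    then show ?thesis unfolding p_def r_def by (simp add: power2_eq_square algebra_simps)
  qed
  have bd: "\<bar>p t\<bar> \<le> t\<^sup>2 * cheeger h" if t: "t \<noteq> 0" for t
  proof -
    have "cheeger (\<lambda>x. f x + t * h x) + cheeger (\<lambda>x. f x - t * h x) = 2 * cheeger f + 2 * cheeger (\<lambda>x. t * h x)"
      by (rule parallelogram[OF f th])
    then have "r t + r (- t) = 2 * (t\<^sup>2 * cheeger h)"
      using cheeger_cmult[OF h t] by (simp add: r_def)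
    then show ?thesis using r0[of t] r0[of "- t"] unfolding p_def abs_le_iff by linarith
  qed
  have it: "p 1 = 2 ^ n * p (1 / 2 ^ n)" for n
  proof (induction n)
    case (Suc n)
    have "p (1 / 2 ^ n) = 2 * p (1 / 2 ^ Suc n)" using dbl[of "1 / 2 ^ Suc n"] by simp
    then show ?case using Suc by simp
  qed simp
  have "\<bar>p 1\<bar> \<le> (1 / 2) ^ n * cheeger h" for n
  proof -
    have "\<bar>p 1\<bar> = 2 ^ n * \<bar>p (1 / 2 ^ n)\<bar>" by (subst it[of n]) (simp add: abs_mult)
    also have "\<dots> \<le> 2 ^ n * ((1 / 2 ^ n)\<^sup>2 * cheeger h)" by (intro mult_left_mono bd) auto
    also have "\<dots> = (1 / 2) ^ n * cheeger h" by (simp add: power2_eq_square power_divide field_simps)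
    finally show ?thesis .
  qed
  moreover have "(\<lambda>n. (1 / 2 :: real) ^ n * cheeger h) \<longlonglongrightarrow> 0 * cheeger h"
    by (intro tendsto_mult_right LIMSEQ_realpow_zero) auto
  ultimately have "\<bar>p 1\<bar> \<le> 0"
    by (intro tendsto_lowerbound[where F=sequentially and f="\<lambda>n. (1 / 2 :: real) ^ n * cheeger h"]) auto
  then show ?thesis by (simp add: p_def r_def I_def)
qed

text \<open>
Both sides are \<open>cheeger (f + g) - cheeger f - cheeger g\<close>.
\<close>

lemma subdiff_sym:
  assumes v: "v \<in> Ch_subdiff d m f" and w: "w \<in> Ch_subdiff d m g"
  shows "(\<integral>x. v x * g x \<partial>m) = (\<integral>x. w x * f x \<partial>m)"
  using cheeger_expand[OF v subdiffD(2)[OF w]] cheeger_expand[OF w subdiffD(2)[OF v]]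
  by (simp add: add.commute)

end

section \<open>Approximation of Borel sets by Lipschitz functions\<close>

context metric_measure
begin

lemma lip_max:
  assumes f: "lip K f" and g: "lip K' g"
  shows "lip (K + K') (\<lambda>x. max (f x) (g x))"
  unfolding lip_def
proof (intro conjI ballI)
  fix x y assume x: "x \<in> space m" and y: "y \<in> space m"
  have "\<bar>max (f x) (g x) - max (f y) (g y)\<bar> \<le> \<bar>f x - f y\<bar> + \<bar>g x - g y\<bar>" by linarith
  then show "\<bar>max (f x) (g x) - max (f y) (g y)\<bar> \<le> (K + K') * d x y"
    using lipD[OF f x y] lipD[OF g x y] by (simp add: distrib_right)
qed (use lip_nonneg[OF f] lip_nonneg[OF g] in simp)

lemma lip_clamp:
  assumes f: "lip K f"
  shows "lip K (\<lambda>x. max 0 (min 1 (f x)))"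
proof -
  have "\<bar>max 0 (min 1 s) - max 0 (min 1 t)\<bar> \<le> 1 * \<bar>s - t\<bar>" for s t :: real
    by (auto simp: min_def max_def abs_if)
  then show ?thesis using lip_comp[OF f, of 1 "\<lambda>s. max 0 (min 1 s)"] by simp
qed

text \<open>
Density of Lipschitz functions, in the form needed for a single indicator: the finite measure has
density \<open>w\<close> with respect to \<open>m\<close>, and the approximations stay between \<open>0\<close> and \<open>1\<close>.
\<close>

definition approximable :: "('a \<Rightarrow> real) \<Rightarrow> 'a set \<Rightarrow> bool" where
  "approximable w A \<longleftrightarrow> (\<forall>e>0. \<exists>h K. lip K h \<and> (\<forall>x\<in>space m. 0 \<le> h x \<and> h x \<le> 1) \<and>
     (\<integral>x. \<bar>h x - indicator A x\<bar> * w x \<partial>m) < e)"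

text \<open>
The functions \<open>min 1 (j \<delta>)\<close>, with \<open>\<delta>\<close> the distance to the complement of \<open>U\<close>, increase to the indicator of
\<open>U\<close>. The whole space is treated separately because its complement is empty.
\<close>

lemma approximable_open:
  assumes U: "openin mtopology U" and w: "integrable m w" "\<And>x. x \<in> space m \<Longrightarrow> 0 \<le> w x"
  shows "approximable w U"
  unfolding approximable_def
proof (intro allI impI)
  fix e :: real assume e: "e > 0"
  have Us: "U \<in> sets m" "U \<subseteq> space m" using U openin_sets_m openin_subset by fastforce+
  show "\<exists>h K. lip K h \<and> (\<forall>x\<in>space m. 0 \<le> h x \<and> h x \<le> 1) \<and>
     (\<integral>x. \<bar>h x - indicator U x\<bar> * w x \<partial>m) < e"
  proof (cases "U = space m")
    case True
    have "(\<integral>x. \<bar>1 - indicator U x\<bar> * w x \<partial>m) = (\<integral>x. 0 \<partial>m)"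
      by (intro Bochner_Integration.integral_cong refl) (simp add: True)
    then show ?thesis using e by (intro exI[of _ "\<lambda>x. 1"] exI[of _ 0]) simp
  next
    case False
    then obtain y0 where y0: "y0 \<in> space m - U" using Us by blast
    define \<delta> where "\<delta> x = (INF y\<in>space m - U. d x y)" for x
    have bdd: "bdd_below (d x ` (space m - U))" for x by (rule bdd_belowI[of _ 0]) auto
    have le: "\<delta> x \<le> d x y" if "y \<in> space m - U" for x y
      unfolding \<delta>_def using that by (intro cINF_lower bdd)
    have ge: "c \<le> \<delta> x" if "\<And>y. y \<in> space m - U \<Longrightarrow> c \<le> d x y" for c x
      unfolding \<delta>_def using that y0 by (intro cINF_greatest) auto
    have half: "\<delta> x - d x y \<le> \<delta> y" if xy: "x \<in> space m" "y \<in> space m" for x y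
    proof (rule ge)
      fix u assume u: "u \<in> space m - U"
      have "\<delta> x \<le> d x u" by (rule le[OF u])
      then show "\<delta> x - d x y \<le> d y u" using triangle[of x y u] xy u by simp
    qed
    have L: "lip 1 \<delta>"
      unfolding lip_def
    proof (intro conjI ballI)
      fix x y assume "x \<in> space m" "y \<in> space m"
      then show "\<bar>\<delta> x - \<delta> y\<bar> \<le> 1 * d x y" using half[of x y] half[of y x] commute[of x y] by (simp add: abs_le_iff)
    qed simp
    have out: "\<delta> x = 0" if "x \<in> space m" "x \<notin> U" for x
      using le[of x x] ge[of 0 x] that by (intro antisym) auto
    have inn: "0 < \<delta> x" if x: "x \<in> U" for x
    proof -
      obtain r where r: "r > 0" "mball x r \<subseteq> U" using U x unfolding openin_mtopology by blast
      have "r \<le> d x y" if "y \<in> space m - U" for y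
        using r that x Us by (force simp: not_less[symmetric])
      then show ?thesis using ge[of r x] r by force
    qed
    define h where "h j x = max 0 (min 1 (real j * \<delta> x))" for j :: nat and x
    have Lc: "lip (real j) (h j)" for j
      unfolding h_def using lip_clamp[OF lip_cmult[OF L, of "real j"]] by simp
    have "(\<lambda>j. \<integral>x. \<bar>h j x - indicator U x\<bar> * w x \<partial>m) \<longlonglongrightarrow> (\<integral>x. 0 \<partial>m)"
    proof (rule integral_dominated_convergence[where w=w])
      show "AE x in m. (\<lambda>j. \<bar>h j x - indicator U x\<bar> * w x) \<longlonglongrightarrow> 0"
      proof (rule AE_I2)
        fix x assume x: "x \<in> space m"
        have "eventually (\<lambda>j. h j x = indicator U x) sequentially"
        proof (cases "x \<in> U")
          case True
          then obtain N :: nat where N: "1 / \<delta> x \<le> real N" using real_arch_simple by blast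
          have "h j x = indicator U x" if "j \<ge> N" for j
          proof -
            have "1 / \<delta> x \<le> real j" using N that by simp
            then have "1 \<le> real j * \<delta> x" using inn[OF True] by (simp add: field_simps)
            then show ?thesis using True by (simp add: h_def)
          qed
          then show ?thesis unfolding eventually_sequentially by blast
        qed (use out[OF x] in \<open>simp add: h_def\<close>)
        then have "eventually (\<lambda>j. \<bar>h j x - indicator U x\<bar> * w x = 0) sequentially"
          by (rule eventually_mono) simp
        then show "(\<lambda>j. \<bar>h j x - indicator U x\<bar> * w x) \<longlonglongrightarrow> 0"
          by (rule tendsto_eventually)
      qed
      show "AE x in m. norm (\<bar>h j x - indicator U x\<bar> * w x) \<le> w x" for j
        using w(2) by (intro AE_I2) (auto simp: abs_mult h_def intro!: mult_left_le_one_le indicator_diff_le_1)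
      show "(\<lambda>x. \<bar>h j x - indicator U x\<bar> * w x) \<in> borel_measurable m" for j
        using lip_measurable[OF Lc[of j]] Us(1) w(1) by measurable
    qed (use w(1) in auto)
    then have "eventually (\<lambda>j. (\<integral>x. \<bar>h j x - indicator U x\<bar> * w x \<partial>m) < e) sequentially"
      using e by (auto dest: order_tendstoD(2))
    then obtain j where "(\<integral>x. \<bar>h j x - indicator U x\<bar> * w x \<partial>m) < e"
      unfolding eventually_sequentially by blast
    then show ?thesis using Lc[of j] by (intro exI[of _ "h j"] exI[of _ "real j"]) (auto simp: h_def)
  qed
qed

lemma approximable_Un:
  assumes A: "approximable w A" "A \<in> sets m" and B: "approximable w B" "B \<in> sets m"
    and w: "integrable m w" "\<And>x. x \<in> space m \<Longrightarrow> 0 \<le> w x"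
  shows "approximable w (A \<union> B)"
  unfolding approximable_def
proof (intro allI impI)
  fix e :: real assume e: "e > 0"
  then have e2: "e / 2 > 0" by simp
  obtain a K where a: "lip K a" "\<And>x. x \<in> space m \<Longrightarrow> 0 \<le> a x \<and> a x \<le> 1"
     "(\<integral>x. \<bar>a x - indicator A x\<bar> * w x \<partial>m) < e / 2"
    using A(1) e2 unfolding approximable_def by blast
  obtain b K' where b: "lip K' b" "\<And>x. x \<in> space m \<Longrightarrow> 0 \<le> b x \<and> b x \<le> 1"
     "(\<integral>x. \<bar>b x - indicator B x\<bar> * w x \<partial>m) < e / 2"
    using B(1) e2 unfolding approximable_def by blast
  note [measurable] = lip_measurable[OF a(1)] lip_measurable[OF b(1)] A(2) B(2)
  have ia: "integrable m (\<lambda>x. \<bar>a x - indicator A x\<bar> * w x)"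
    using a(2) by (intro integrable_weight[OF w]) (auto intro: indicator_diff_le_1)
  have ib: "integrable m (\<lambda>x. \<bar>b x - indicator B x\<bar> * w x)"
    using b(2) by (intro integrable_weight[OF w]) (auto intro: indicator_diff_le_1)
  have iab: "integrable m (\<lambda>x. \<bar>max (a x) (b x) - indicator (A \<union> B) x\<bar> * w x)"
    using a(2) b(2) by (intro integrable_weight[OF w]) (auto intro!: indicator_diff_le_1 simp: le_max_iff_disj)
  have "(\<integral>x. \<bar>max (a x) (b x) - indicator (A \<union> B) x\<bar> * w x \<partial>m)
     \<le> (\<integral>x. \<bar>a x - indicator A x\<bar> * w x + \<bar>b x - indicator B x\<bar> * w x \<partial>m)"
  proof (rule integral_mono[OF iab Bochner_Integration.integrable_add[OF ia ib]])
    fix x assume x: "x \<in> space m"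
    have "\<bar>max (a x) (b x) - indicator (A \<union> B) x\<bar> \<le> \<bar>a x - indicator A x\<bar> + \<bar>b x - indicator B x\<bar>"
      using a(2)[OF x] b(2)[OF x] by (auto simp: indicator_def)
    then have "\<bar>max (a x) (b x) - indicator (A \<union> B) x\<bar> * w x \<le> (\<bar>a x - indicator A x\<bar> + \<bar>b x - indicator B x\<bar>) * w x"
      using w(2)[OF x] by (rule mult_right_mono)
    then show "\<bar>max (a x) (b x) - indicator (A \<union> B) x\<bar> * w x \<le> \<bar>a x - indicator A x\<bar> * w x + \<bar>b x - indicator B x\<bar> * w x"
      by (simp add: distrib_right)
  qed
  also have "\<dots> < e" using a(3) b(3) ia ib by simp
  finally have "(\<integral>x. \<bar>max (a x) (b x) - indicator (A \<union> B) x\<bar> * w x \<partial>m) < e" .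
  then show "\<exists>h K. lip K h \<and> (\<forall>x\<in>space m. 0 \<le> h x \<and> h x \<le> 1) \<and>
     (\<integral>x. \<bar>h x - indicator (A \<union> B) x\<bar> * w x \<partial>m) < e"
    using lip_max[OF a(1) b(1)] a(2) b(2)
    by (intro exI[of _ "\<lambda>x. max (a x) (b x)"] exI[of _ "K + K'"]) (auto simp: le_max_iff_disj)
qed

lemma approximable_borel:
  assumes A: "A \<in> borel_sets_of d m" and w: "integrable m w" "\<And>x. x \<in> space m \<Longrightarrow> 0 \<le> w x"
  shows "approximable w A"
  using A unfolding borel_sets_of_def
proof (induction A rule: sigma_sets.induct)
  case (Basic A)
  then show ?case using approximable_open w by blast
next
  case Empty
  show ?case using approximable_open[OF openin_empty] w by blast
next
  case (Compl A)
  have As: "A \<in> sets m" using Compl.hyps borel_sets by (auto simp: borel_sets_of_def)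
  show ?case unfolding approximable_def
  proof (intro allI impI)
    fix e :: real assume "e > 0"
    then obtain a K where a: "lip K a" "\<And>x. x \<in> space m \<Longrightarrow> 0 \<le> a x \<and> a x \<le> 1"
     "(\<integral>x. \<bar>a x - indicator A x\<bar> * w x \<partial>m) < e"
      using Compl.IH unfolding approximable_def by blast
    have "(\<integral>x. \<bar>(1 - a x) - indicator (space m - A) x\<bar> * w x \<partial>m) = (\<integral>x. \<bar>a x - indicator A x\<bar> * w x \<partial>m)"
      by (intro Bochner_Integration.integral_cong refl) (auto simp: indicator_def)
    moreover have "lip (0 + K) (\<lambda>x. 1 - a x)" by (rule lip_diff[OF lip_const a(1)])
    ultimately show "\<exists>h K. lip K h \<and> (\<forall>x\<in>space m. 0 \<le> h x \<and> h x \<le> 1) \<and>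
       (\<integral>x. \<bar>h x - indicator (space m - A) x\<bar> * w x \<partial>m) < e"
      using a by (intro exI[of _ "\<lambda>x. 1 - a x"] exI[of _ "0 + K"]) auto
  qed
next
  case (Union A)
  have As [measurable]: "A i \<in> sets m" for i using Union.hyps borel_sets by (auto simp: borel_sets_of_def)
  define U where "U n = (\<Union>i<n. A i)" for n
  have Us [measurable]: "U n \<in> sets m" for n unfolding U_def by auto
  have U: "approximable w (U n)" for n
  proof (induction n)
    case 0
    show ?case unfolding U_def using approximable_open[OF openin_empty] w by simp
  next
    case (Suc n)
    have "U (Suc n) = A n \<union> U n" by (auto simp: U_def lessThan_Suc)
    then show ?case using approximable_Un[OF Union.IH As Suc Us w] by simp
  qed
  let ?A = "\<Union>i. A i"
  have Am [measurable]: "?A \<in> sets m" by auto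
  show ?case unfolding approximable_def
  proof (intro allI impI)
    fix e :: real assume e: "e > 0"
    then have e2: "e / 2 > 0" by simp
    have "(\<lambda>n. \<integral>x. \<bar>indicator (U n) x - indicator ?A x\<bar> * w x \<partial>m) \<longlonglongrightarrow> (\<integral>x. 0 \<partial>m)"
    proof (rule integral_dominated_convergence[where w=w])
      show "AE x in m. (\<lambda>n. \<bar>indicator (U n) x - indicator ?A x\<bar> * w x) \<longlonglongrightarrow> 0"
      proof (rule AE_I2)
        fix x
        have "eventually (\<lambda>n. indicator (U n) x = (indicator ?A x :: real)) sequentially"
        proof (cases "x \<in> ?A")
          case True
          then obtain i where "x \<in> A i" by blast
          then have "indicator (U n) x = (indicator ?A x :: real)" if "n \<ge> Suc i" for n
            using that True by (auto simp: U_def indicator_def)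
          then show ?thesis unfolding eventually_sequentially by blast
        qed (auto simp: U_def)
        then have "eventually (\<lambda>n. \<bar>indicator (U n) x - indicator ?A x\<bar> * w x = 0) sequentially"
          by (rule eventually_mono) simp
        then show "(\<lambda>n. \<bar>indicator (U n) x - indicator ?A x\<bar> * w x) \<longlonglongrightarrow> 0"
          by (rule tendsto_eventually)
      qed
      show "AE x in m. norm (\<bar>indicator (U n) x - indicator ?A x\<bar> * w x) \<le> w x" for n
        using w(2) by (intro AE_I2) (auto simp: abs_mult intro!: mult_left_le_one_le indicator_diff_le_1)
      show "(\<lambda>x. \<bar>indicator (U n) x - indicator ?A x\<bar> * w x) \<in> borel_measurable m" for n
        using w(1) by measurable
    qed (use w(1) in auto)
    then have "eventually (\<lambda>n. (\<integral>x. \<bar>indicator (U n) x - indicator ?A x\<bar> * w x \<partial>m) < e / 2) sequentially"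
      by (rule order_tendstoD(2)) (use e2 in simp)
    then obtain n where n: "(\<integral>x. \<bar>indicator (U n) x - indicator ?A x\<bar> * w x \<partial>m) < e / 2"
      unfolding eventually_sequentially by blast
    obtain a K where a: "lip K a" "\<And>x. x \<in> space m \<Longrightarrow> 0 \<le> a x \<and> a x \<le> 1"
      "(\<integral>x. \<bar>a x - indicator (U n) x\<bar> * w x \<partial>m) < e / 2"
      using U[of n] e2 unfolding approximable_def by blast
    note [measurable] = lip_measurable[OF a(1)]
    have i1: "integrable m (\<lambda>x. \<bar>a x - indicator (U n) x\<bar> * w x)"
      using a(2) by (intro integrable_weight[OF w]) (auto intro: indicator_diff_le_1)
    have i2: "integrable m (\<lambda>x. \<bar>indicator (U n) x - indicator ?A x\<bar> * w x)"
      by (intro integrable_weight[OF w]) (auto intro: indicator_diff_le_1)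
    have i3: "integrable m (\<lambda>x. \<bar>a x - indicator ?A x\<bar> * w x)"
      using a(2) by (intro integrable_weight[OF w]) (auto intro: indicator_diff_le_1)
    have "(\<integral>x. \<bar>a x - indicator ?A x\<bar> * w x \<partial>m) \<le>
      (\<integral>x. \<bar>a x - indicator (U n) x\<bar> * w x + \<bar>indicator (U n) x - indicator ?A x\<bar> * w x \<partial>m)"
    proof (rule integral_mono[OF i3 Bochner_Integration.integrable_add[OF i1 i2]])
      fix x assume x: "x \<in> space m"
      show "\<bar>a x - indicator ?A x\<bar> * w x \<le> \<bar>a x - indicator (U n) x\<bar> * w x + \<bar>indicator (U n) x - indicator ?A x\<bar> * w x"
        unfolding distrib_right[symmetric] using w(2)[OF x] by (intro mult_right_mono) linarith+
    qed
    also have "\<dots> < e" using n a(3) i1 i2 by simp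
    finally show "\<exists>h K. lip K h \<and> (\<forall>x\<in>space m. 0 \<le> h x \<and> h x \<le> 1) \<and>
       (\<integral>x. \<bar>h x - indicator ?A x\<bar> * w x \<partial>m) < e"
      using a by blast
  qed
qed

end

section \<open>An integration by parts inequality\<close>

context metric_measure
begin

definition near_opt :: "('a \<Rightarrow> real) \<Rightarrow> real \<Rightarrow> ('a \<Rightarrow> real) set" where
  "near_opt f \<eta> = {g \<in> Lip_bs d m. (\<integral>x. (g x - f x)\<^sup>2 \<partial>m) < \<eta> \<and> energy g < 2 * cheeger f + \<eta>}"

lemma near_opt_ex: "f \<in> W12 d m \<Longrightarrow> \<eta> > 0 \<Longrightarrow> \<exists>g. g \<in> near_opt f \<eta>"
  unfolding near_opt_def using cheeger_approx[of f \<eta>] by blast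

lemma near_opt_mono: "g \<in> near_opt f \<eta> \<Longrightarrow> \<eta> \<le> \<eta>' \<Longrightarrow> g \<in> near_opt f \<eta>'"
  unfolding near_opt_def by auto

lemma near_optD:
  assumes "g \<in> near_opt f \<eta>"
  shows "g \<in> Lip_bs d m" "(\<integral>x. (g x - f x)\<^sup>2 \<partial>m) < \<eta>" "energy g < 2 * cheeger f + \<eta>"
  using assms by (auto simp: near_opt_def)

text \<open>
Uniform convexity: the midpoint of two near optimal functions is near \<open>f\<close>, so its energy cannot be
much smaller than theirs, while the parallelogram identity puts it below their average by at least
a quarter of the squared \<open>L\<^sup>2\<close> distance of their slopes.
\<close>

lemma near_opt_cauchy:
  assumes f: "f \<in> W12 d m" and e: "e > 0"
  obtains \<eta> where "\<eta> > 0"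
    "\<And>g h. g \<in> near_opt f \<eta> \<Longrightarrow> h \<in> near_opt f \<eta> \<Longrightarrow> (\<integral>x. (rslope g x - rslope h x)\<^sup>2 \<partial>m) < e"
proof -
  have e8: "e / 8 > 0" using e by simp
  obtain \<eta>0 where \<eta>0: "\<eta>0 > 0" "\<And>g. g \<in> Lip_bs d m \<Longrightarrow> (\<integral>x. (g x - f x)\<^sup>2 \<partial>m) < \<eta>0 \<Longrightarrow> energy g > 2 * cheeger f - e / 8"
    using cheeger_lower[OF f e8] by metis
  define \<eta> where "\<eta> = min \<eta>0 (e / 8)"
  have "(\<integral>x. (rslope g x - rslope h x)\<^sup>2 \<partial>m) < e" if gh: "g \<in> near_opt f \<eta>" "h \<in> near_opt f \<eta>" for g h
  proof -
    note g = near_optD[OF gh(1)] and h = near_optD[OF gh(2)]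
    obtain K where K: "lip K g" using Lip_bs_lip[OF g(1)] by blast
    obtain K' where K': "lip K' h" using Lip_bs_lip[OF h(1)] by blast
    define k where "k x = 1/2 * (g x + h x)" for x
    have k: "k \<in> Lip_bs d m" unfolding k_def by (intro Lip_bs_cmult Lip_bs_add g h)
    have gh2: "(\<lambda>x. g x - f x) \<in> L2 m" "(\<lambda>x. h x - f x) \<in> L2 m" "(\<lambda>x. k x - f x) \<in> L2 m"
      by (intro L2_diff Lip_bs_L2 g h k W12_L2 f)+
    have "(\<integral>x. (k x - f x)\<^sup>2 \<partial>m) \<le> (\<integral>x. 1/2 * (g x - f x)\<^sup>2 + 1/2 * (h x - f x)\<^sup>2 \<partial>m)"
    proof (rule integral_mono)
      fix x
      have "(k x - f x)\<^sup>2 + 1/4 * (g x - h x)\<^sup>2 = 1/2 * (g x - f x)\<^sup>2 + 1/2 * (h x - f x)\<^sup>2"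
        by (simp add: k_def power2_eq_square field_simps)
      moreover have "0 \<le> (g x - h x)\<^sup>2" by simp
      ultimately show "(k x - f x)\<^sup>2 \<le> 1/2 * (g x - f x)\<^sup>2 + 1/2 * (h x - f x)\<^sup>2" by linarith
    qed (use gh2 in \<open>auto simp: L2_integrable_sq\<close>)
    also have "\<dots> < \<eta>0" using g(2) h(2) gh2 by (simp add: L2_integrable_sq \<eta>_def)
    finally have kE: "energy k > 2 * cheeger f - e / 8" using \<eta>0(2)[OF k] by blast
    have kk: "rslope k x \<le> 1/2 * (rslope g x + rslope h x)" if x: "x \<in> space m" for x
    proof -
      have "rslope k x \<le> \<bar>1/2\<bar> * rslope (\<lambda>x. g x + h x) x"
        unfolding k_def by (rule rslope_cmult[OF lip_add[OF K K'] lip_cmult[OF lip_add[OF K K']] x])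
      also have "\<dots> \<le> 1/2 * (rslope g x + rslope h x)"
        using rslope_add_le[OF K K' lip_add[OF K K'] x] by simp
      finally show ?thesis .
    qed
    have sL: "rslope g \<in> L2 m" "rslope h \<in> L2 m" "rslope k \<in> L2 m" using Lip_bs_rslope_L2 g h k by auto
    have sd: "(\<lambda>x. rslope g x - rslope h x) \<in> L2 m" by (rule L2_diff[OF sL(1,2)])
    have "energy k \<le> (\<integral>x. 1/2 * (rslope g x)\<^sup>2 + 1/2 * (rslope h x)\<^sup>2 - 1/4 * (rslope g x - rslope h x)\<^sup>2 \<partial>m)"
      unfolding energy_def
    proof (rule integral_mono)
      fix x assume x: "x \<in> space m"
      have "(rslope k x)\<^sup>2 \<le> (1/2 * (rslope g x + rslope h x))\<^sup>2" using kk[OF x] by (intro power_mono) auto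
      also have "\<dots> = 1/2 * (rslope g x)\<^sup>2 + 1/2 * (rslope h x)\<^sup>2 - 1/4 * (rslope g x - rslope h x)\<^sup>2"
        by (simp add: power2_eq_square algebra_simps)
      finally show "(rslope k x)\<^sup>2 \<le> 1/2 * (rslope g x)\<^sup>2 + 1/2 * (rslope h x)\<^sup>2 - 1/4 * (rslope g x - rslope h x)\<^sup>2" .
    qed (use sL sd in \<open>auto simp: L2_integrable_sq\<close>)
    also have "\<dots> = 1/2 * energy g + 1/2 * energy h - 1/4 * (\<integral>x. (rslope g x - rslope h x)\<^sup>2 \<partial>m)"
      unfolding energy_def using sL sd by (simp add: L2_integrable_sq)
    finally have "(\<integral>x. (rslope g x - rslope h x)\<^sup>2 \<partial>m) \<le> 2 * energy g + 2 * energy h - 4 * energy k" by simp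
    also have "\<dots> < e" using g(3) h(3) kE by (simp add: \<eta>_def)
    finally show ?thesis .
  qed
  then show thesis using \<eta>0 e by (intro that[of \<eta>]) (auto simp: \<eta>_def)
qed

text \<open>
The competitor \<open>(1 - h) g + h f\<close> is as close to \<open>f\<close> as \<open>g\<close> is. By the Leibniz rule and convexity, its
squared slope is at most \<open>(1 - h) |Dg|\<^sup>2 + h L\<^sup>2\<close>, up to an error controlled by the \<open>L\<^sup>2\<close> distance of \<open>f\<close>
and \<open>g\<close>. Its energy cannot be much smaller than that of \<open>g\<close>, which bounds \<open>\<integral> h (|Dg|\<^sup>2 - L\<^sup>2)\<close>.
\<close>

lemma near_opt_weighted:
  assumes f: "f \<in> W12 d m" and L: "lip L f" and h: "h \<in> Lip_bs d m"
    and h01: "\<And>x. x \<in> space m \<Longrightarrow> 0 \<le> h x \<and> h x \<le> 1" and e: "e > 0"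
  obtains \<eta> where "\<eta> > 0"
    "\<And>g. g \<in> near_opt f \<eta> \<Longrightarrow> (\<integral>x. h x * ((rslope g x)\<^sup>2 - L\<^sup>2) \<partial>m) < e"
proof -
  obtain K where K: "lip K h" using Lip_bs_lip[OF h] by blast
  have K0: "0 \<le> K" by (rule lip_nonneg[OF K])
  \<comment> \<open>\<open>s\<close> weighs the two terms of \<open>(A + B)\<^sup>2\<close> below. The relative loss \<open>s\<close> on the main term costs at most
    \<open>e / 4\<close>; the large factor on the other term is then absorbed by \<open>\<eta>\<close>.\<close>
  define s where "s = min 1 (e / (8 * (cheeger f + 1)))"
  have s: "s > 0" "s \<le> 1" using e by (auto simp: s_def add_nonneg_pos)
  have "2 * cheeger f * s \<le> 2 * cheeger f * (e / (8 * (cheeger f + 1)))" by (intro mult_left_mono) (auto simp: s_def)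
  also have "\<dots> = e / 4 * (cheeger f / (cheeger f + 1))"
  proof -
    have "2 * a * (e / (8 * D)) = e / 4 * (a / D)" for a D :: real by simp
    then show ?thesis .
  qed
  also have "cheeger f / (cheeger f + 1) \<le> 1"
    by (subst pos_divide_le_eq) (auto intro: add_nonneg_pos)
  then have "e / 4 * (cheeger f / (cheeger f + 1)) \<le> e / 4" using e by (intro mult_left_le) auto
  finally have sq: "2 * cheeger f * s \<le> e / 4" .
  define \<epsilon> where "\<epsilon> = e / 12"
  have \<epsilon>: "\<epsilon> > 0" using e by (simp add: \<epsilon>_def)
  obtain \<eta>0 where \<eta>0: "\<eta>0 > 0" "\<And>g. g \<in> Lip_bs d m \<Longrightarrow> (\<integral>x. (g x - f x)\<^sup>2 \<partial>m) < \<eta>0 \<Longrightarrow> energy g > 2 * cheeger f - \<epsilon>"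
    using cheeger_lower[OF f \<epsilon>] by metis
  define c where "c = (1 + 1 / s) * K\<^sup>2"
  have c: "0 \<le> c" using s by (simp add: c_def)
  define \<eta> where "\<eta> = Min {\<eta>0, \<epsilon>, e / (4 * (c + 1))}"
  have \<eta>: "\<eta> > 0" "\<eta> \<le> \<eta>0" "\<eta> \<le> \<epsilon>" "\<eta> \<le> e / (4 * (c + 1))" using \<eta>0 \<epsilon> e c by (auto simp: \<eta>_def)
  have "c * \<eta> \<le> c * (e / (4 * (c + 1)))" using \<eta> c by (intro mult_left_mono) auto
  also have "\<dots> \<le> e / 4" using e c by (simp add: field_simps)
  finally have c\<eta>: "c * \<eta> \<le> e / 4" .
  have "(\<integral>x. h x * ((rslope g x)\<^sup>2 - L\<^sup>2) \<partial>m) < e" if g': "g \<in> near_opt f \<eta>" for g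
  proof -
    note g = near_optD[OF g']
    obtain Kg where Kg: "lip Kg g" using Lip_bs_lip[OF g(1)] by blast
    define k where "k x = (1 - h x) * g x + h x * f x" for x
    have keq: "k = (\<lambda>x. g x + h x * (f x - g x))" by (simp add: k_def fun_eq_iff algebra_simps)
    have k: "k \<in> Lip_bs d m" unfolding keq
      by (intro Lip_bs_add g Lip_bs_mult[OF h, of "L + Kg"] lip_diff L Kg)
    obtain Kk where Kk: "lip Kk k" using Lip_bs_lip[OF k] by blast
    have dL: "(\<lambda>x. g x - f x) \<in> L2 m" "(\<lambda>x. k x - f x) \<in> L2 m"
      by (intro L2_diff Lip_bs_L2 g k W12_L2 f)+
    have "(\<integral>x. (k x - f x)\<^sup>2 \<partial>m) \<le> (\<integral>x. (g x - f x)\<^sup>2 \<partial>m)"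
    proof (rule integral_mono)
      fix x assume x: "x \<in> space m"
      have "k x - f x = (1 - h x) * (g x - f x)" by (simp add: k_def algebra_simps)
      then have "\<bar>k x - f x\<bar> \<le> \<bar>g x - f x\<bar>"
        using h01[OF x] by (auto simp: abs_mult intro!: mult_left_le_one_le)
      then show "(k x - f x)\<^sup>2 \<le> (g x - f x)\<^sup>2" by (simp add: abs_le_square_iff)
    qed (use dL in \<open>auto simp: L2_integrable_sq\<close>)
    also have "\<dots> < \<eta>0" using g(2) \<eta>(2) by simp
    finally have kE: "energy k > 2 * cheeger f - \<epsilon>" using \<eta>0(2)[OF k] by blast
    have sL: "rslope g \<in> L2 m" "rslope k \<in> L2 m" using Lip_bs_rslope_L2 g k by auto
    have ih: "integrable m (\<lambda>x. h x * (rslope g x)\<^sup>2)"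
      using integrable_weight[OF L2_integrable_sq[OF sL(1)] _ Lip_bs_measurable[OF h]] h01 by fastforce
    have ih2: "integrable m (\<lambda>x. h x * L\<^sup>2)" using Lip_bs_integrable[OF h] by simp
    have ih3: "integrable m (\<lambda>x. h x * ((rslope g x)\<^sup>2 - L\<^sup>2))"
      using Bochner_Integration.integrable_diff[OF ih ih2] by (simp add: algebra_simps)
    define T where "T = (\<integral>x. h x * ((rslope g x)\<^sup>2 - L\<^sup>2) \<partial>m)"
    have "energy k \<le> (\<integral>x. (1 + s) * ((rslope g x)\<^sup>2 - h x * ((rslope g x)\<^sup>2 - L\<^sup>2)) + c * (g x - f x)\<^sup>2 \<partial>m)"
      unfolding energy_def
    proof (rule integral_mono)
      fix x assume x: "x \<in> space m"
      define A where "A = (1 - h x) * rslope g x + h x * L"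
      define B where "B = K * \<bar>f x - g x\<bar>"
      have "rslope k x \<le> (1 - h x) * rslope g x + h x * rslope f x + rslope h x * \<bar>f x - g x\<bar>"
        using rslope_glue[OF Kg L K Kk[unfolded k_def] h01 x] by (simp add: k_def[abs_def])
      also have "\<dots> \<le> A + B"
        unfolding A_def B_def using h01[OF x] rslope_le[OF L x] rslope_le[OF K x]
        by (intro add_mono mult_left_mono mult_right_mono) auto
      finally have "(rslope k x)\<^sup>2 \<le> (A + B)\<^sup>2" by (intro power_mono) auto
      also have "\<dots> \<le> (1 + s) * A\<^sup>2 + (1 + 1 / s) * B\<^sup>2"
      proof -
        have "0 \<le> (s * A - B)\<^sup>2 / s" using s by simp
        also have "\<dots> = s * A\<^sup>2 - 2 * A * B + B\<^sup>2 / s"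
          using s by (simp add: power2_eq_square field_simps)
        finally show ?thesis by (simp add: power2_eq_square algebra_simps)
      qed
      also have "A\<^sup>2 \<le> (1 - h x) * (rslope g x)\<^sup>2 + h x * L\<^sup>2"
      proof -
        have "(1 - h x) * (rslope g x)\<^sup>2 + h x * L\<^sup>2 - A\<^sup>2 = h x * (1 - h x) * (rslope g x - L)\<^sup>2"
          unfolding A_def by (simp add: power2_eq_square algebra_simps)
        moreover have "0 \<le> h x * (1 - h x) * (rslope g x - L)\<^sup>2" using h01[OF x] by simp
        ultimately show ?thesis by linarith
      qed
      then have "(1 + s) * A\<^sup>2 \<le> (1 + s) * ((1 - h x) * (rslope g x)\<^sup>2 + h x * L\<^sup>2)"
        using s by (intro mult_left_mono) auto
      moreover have "B\<^sup>2 = K\<^sup>2 * (g x - f x)\<^sup>2"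
        by (simp add: B_def power_mult_distrib power2_commute)
      ultimately show "(rslope k x)\<^sup>2 \<le> (1 + s) * ((rslope g x)\<^sup>2 - h x * ((rslope g x)\<^sup>2 - L\<^sup>2)) + c * (g x - f x)\<^sup>2"
        by (simp add: c_def algebra_simps)
    qed (use sL dL ih3 in \<open>auto simp: L2_integrable_sq\<close>)
    also have "\<dots> = (1 + s) * (energy g - T) + c * (\<integral>x. (g x - f x)\<^sup>2 \<partial>m)"
      using sL dL ih3 by (simp add: L2_integrable_sq T_def energy_def)
    also have "\<dots> \<le> (1 + s) * (2 * cheeger f + \<epsilon> - T) + c * \<eta>"
      using g \<eta> s c by (intro add_mono mult_left_mono) auto
    finally have "2 * cheeger f - \<epsilon> < (1 + s) * (2 * cheeger f + \<epsilon> - T) + c * \<eta>" using kE by simp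
    then have "(1 + s) * T < 2 * cheeger f * s + (2 + s) * \<epsilon> + c * \<eta>" by (simp add: algebra_simps)
    also have "\<dots> \<le> e / 4 + 3 * \<epsilon> + e / 4" using sq c\<eta> s \<epsilon> by (intro add_mono) auto
    also have "\<dots> < e" using e by (simp add: \<epsilon>_def)
    finally have "(1 + s) * T < e" .
    moreover have "T \<le> (1 + s) * T" if "T \<ge> 0" using s that by (simp add: distrib_right)
    ultimately show ?thesis using e unfolding T_def[symmetric] by linarith
  qed
  then show thesis using \<eta>(1) that by blast
qed

text \<open>
For a fixed near optimal \<open>g\<close>, the bound of \<open>near_opt_weighted\<close> for even better functions \<open>u\<close> transfers
to \<open>g\<close> itself, because the slopes of \<open>u\<close> and \<open>g\<close> are close in \<open>L\<^sup>2\<close>; the transferred bound is uniform in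
the cutoff \<open>h\<close>. Hence \<open>h\<close> may approach the indicator of the set where the slope of \<open>g\<close> exceeds \<open>L\<close>.
\<close>

lemma near_opt_excess:
  assumes f: "f \<in> W12 d m" and L: "lip L f" and k: "k \<in> Lip_bs d m"
    and k01: "\<And>x. x \<in> space m \<Longrightarrow> 0 \<le> k x \<and> k x \<le> 1" and e: "e > 0"
  obtains \<eta> where "\<eta> > 0"
    "\<And>g. g \<in> near_opt f \<eta> \<Longrightarrow> (\<integral>x. k x * (max 0 (rslope g x - L))\<^sup>2 \<partial>m) < e"
proof -
  have L0: "0 \<le> L" by (rule lip_nonneg[OF L])
  define Q where "Q = sqrt (2 * cheeger f + 1)"
  have Q: "Q \<ge> 1" unfolding Q_def by simp
  \<comment> \<open>\<open>Q\<close> bounds the \<open>L\<^sup>2\<close> norms of slopes of near optimal functions. Slopes at distance \<open>e / (4 Q)\<close> have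
    squares whose integrals differ by at most \<open>e / 2\<close>.\<close>
  define e1 where "e1 = (e / (4 * Q))\<^sup>2"
  have e1: "e1 > 0" using e Q by (simp add: e1_def)
  have sqe1: "sqrt e1 = e / (4 * Q)" using e Q by (simp add: e1_def real_sqrt_unique)
  obtain \<eta>1 where \<eta>1: "\<eta>1 > 0"
    "\<And>g h. g \<in> near_opt f \<eta>1 \<Longrightarrow> h \<in> near_opt f \<eta>1 \<Longrightarrow> (\<integral>x. (rslope g x - rslope h x)\<^sup>2 \<partial>m) < e1"
    using near_opt_cauchy[OF f e1] by metis
  define \<eta> where "\<eta> = min 1 \<eta>1"
  have sle: "L2_norm m (rslope g) \<le> Q" if "g \<in> near_opt f \<eta>" for g
    using near_optD(3)[OF that] unfolding L2_norm_def Q_def energy_def[symmetric] \<eta>_def by simp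
  have "(\<integral>x. k x * (max 0 (rslope g x - L))\<^sup>2 \<partial>m) < e" if g': "g \<in> near_opt f \<eta>" for g
  proof -
    note g = near_optD[OF g']
    have gL: "rslope g \<in> L2 m" by (rule Lip_bs_rslope_L2[OF g(1)])
    obtain Kg where Kg: "lip Kg g" using Lip_bs_lip[OF g(1)] by blast
    define w where "w x = k x * ((rslope g x)\<^sup>2 + L\<^sup>2)" for x
    have iw1: "integrable m (\<lambda>x. k x * (rslope g x)\<^sup>2)"
      using integrable_weight[OF L2_integrable_sq[OF gL] _ Lip_bs_measurable[OF k]] k01 by fastforce
    have iw2: "integrable m (\<lambda>x. k x * L\<^sup>2)" using Lip_bs_integrable[OF k] by simp
    have iw: "integrable m w" unfolding w_def
      using Bochner_Integration.integrable_add[OF iw1 iw2] by (simp add: algebra_simps)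
    have w0: "0 \<le> w x" if "x \<in> space m" for x using k01[OF that] by (simp add: w_def)
    have ikd: "integrable m (\<lambda>x. k x * ((rslope g x)\<^sup>2 - L\<^sup>2))"
      using Bochner_Integration.integrable_diff[OF iw1 iw2] by (simp add: algebra_simps)
    define A where "A = {x \<in> space m. L < rslope g x}"
    have Ab: "A \<in> borel_sets_of d m"
      using borel_measurable_less[OF borel_measurable_const rslope_measurable_borel_alg[OF Kg], of L]
      by (simp add: A_def sets_borel_alg)
    then have Am [measurable]: "A \<in> sets m" using borel_sets by blast
    have main: "(\<integral>x. h x * (k x * ((rslope g x)\<^sup>2 - L\<^sup>2)) \<partial>m) \<le> e / 2"
      if h: "lip K h" and h01: "\<And>x. x \<in> space m \<Longrightarrow> 0 \<le> h x \<and> h x \<le> 1" for h K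
    proof (rule field_le_epsilon)
      fix e2 :: real assume e2: "e2 > 0"
      define kh where "kh x = k x * h x" for x
      have kh: "kh \<in> Lip_bs d m" unfolding kh_def by (rule Lip_bs_mult[OF k h])
      have kh01: "0 \<le> kh x \<and> kh x \<le> 1" if "x \<in> space m" for x
        using k01[OF that] h01[OF that] by (simp add: kh_def mult_le_one)
      obtain \<eta>2 where \<eta>2: "\<eta>2 > 0"
        "\<And>g. g \<in> near_opt f \<eta>2 \<Longrightarrow> (\<integral>x. kh x * ((rslope g x)\<^sup>2 - L\<^sup>2) \<partial>m) < e2"
        using near_opt_weighted[OF f L kh kh01 e2] by metis
      obtain u where u: "u \<in> near_opt f (min \<eta> \<eta>2)"
        using near_opt_ex[OF f, of "min \<eta> \<eta>2"] \<eta>1(1) \<eta>2(1) by (auto simp: \<eta>_def)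
      have u1: "u \<in> near_opt f \<eta>" and u2: "u \<in> near_opt f \<eta>2" using near_opt_mono[OF u] by auto
      have uB: "u \<in> Lip_bs d m" by (rule near_optD[OF u])
      have uL: "rslope u \<in> L2 m" by (rule Lip_bs_rslope_L2[OF uB])
      have D: "L2_norm m (\<lambda>x. rslope g x - rslope u x) \<le> e / (4 * Q)"
        unfolding sqe1[symmetric] L2_norm_def
        using \<eta>1(2)[of g u] near_opt_mono[OF g', of \<eta>1] near_opt_mono[OF u1, of \<eta>1]
        by (intro real_sqrt_le_mono) (simp add: \<eta>_def)
      have dL: "(\<lambda>x. rslope g x - rslope u x) \<in> L2 m" and aL: "(\<lambda>x. kh x * (rslope g x + rslope u x)) \<in> L2 m"
        and aL': "(\<lambda>x. rslope g x + rslope u x) \<in> L2 m"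
      proof -
        show "(\<lambda>x. rslope g x - rslope u x) \<in> L2 m" by (rule L2_diff[OF gL uL])
        show 2: "(\<lambda>x. rslope g x + rslope u x) \<in> L2 m" by (rule L2_add[OF gL uL])
        have [measurable]: "kh \<in> borel_measurable m" by (rule Lip_bs_measurable[OF kh])
        have "integrable m (\<lambda>x. (kh x)\<^sup>2 * (rslope g x + rslope u x)\<^sup>2)"
          using kh01 by (intro integrable_weight[OF L2_integrable_sq[OF 2]]) (auto simp: power_le_one)
        then show "(\<lambda>x. kh x * (rslope g x + rslope u x)) \<in> L2 m"
          using 2 unfolding L2_def by (auto simp: power_mult_distrib)
      qed
      have na: "L2_norm m (\<lambda>x. kh x * (rslope g x + rslope u x)) \<le> L2_norm m (\<lambda>x. rslope g x + rslope u x)"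
        unfolding L2_norm_def
      proof (intro real_sqrt_le_mono integral_mono)
        fix x assume "x \<in> space m"
        then have "(kh x)\<^sup>2 \<le> 1" using kh01 by (simp add: power_le_one)
        then show "(kh x * (rslope g x + rslope u x))\<^sup>2 \<le> (rslope g x + rslope u x)\<^sup>2"
          by (simp add: power_mult_distrib mult_left_le_one_le)
      qed (use aL aL' in \<open>auto simp: L2_integrable_sq\<close>)
      have ikg: "integrable m (\<lambda>x. kh x * ((rslope u x)\<^sup>2 - L\<^sup>2))"
      proof -
        have "integrable m (\<lambda>x. kh x * (rslope u x)\<^sup>2)"
          using integrable_weight[OF L2_integrable_sq[OF uL] _ Lip_bs_measurable[OF kh]] kh01 by fastforce
        moreover have "integrable m (\<lambda>x. kh x * L\<^sup>2)" using Lip_bs_integrable[OF kh] by simp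
        ultimately show ?thesis using Bochner_Integration.integrable_diff by (fastforce simp: algebra_simps)
      qed
      have "(\<integral>x. h x * (k x * ((rslope g x)\<^sup>2 - L\<^sup>2)) \<partial>m) =
        (\<integral>x. (rslope g x - rslope u x) * (kh x * (rslope g x + rslope u x)) + kh x * ((rslope u x)\<^sup>2 - L\<^sup>2) \<partial>m)"
        by (intro Bochner_Integration.integral_cong refl) (simp add: kh_def power2_eq_square algebra_simps)
      also have "\<dots> = (\<integral>x. (rslope g x - rslope u x) * (kh x * (rslope g x + rslope u x)) \<partial>m) + (\<integral>x. kh x * ((rslope u x)\<^sup>2 - L\<^sup>2) \<partial>m)"
        by (intro Bochner_Integration.integral_add ikg L2_mult_integrable dL aL)
      also have "\<dots> \<le> L2_norm m (\<lambda>x. rslope g x - rslope u x) * L2_norm m (\<lambda>x. kh x * (rslope g x + rslope u x)) + e2"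
        using L2_cauchy_schwarz[OF dL aL] \<eta>2(2)[OF u2] by linarith
      also have "\<dots> \<le> (e / (4 * Q)) * (2 * Q) + e2"
        using D na L2_norm_triangle[OF gL uL] sle[OF g'] sle[OF u1] e Q
        by (intro add_mono mult_mono) auto
      also have "\<dots> = e / 2 + e2" using Q by simp
      finally show "(\<integral>x. h x * (k x * ((rslope g x)\<^sup>2 - L\<^sup>2)) \<partial>m) \<le> e / 2 + e2" .
    qed
    have ap: "approximable w A" by (rule approximable_borel[OF Ab iw w0])
    have iA: "integrable m (\<lambda>x. indicator A x * (k x * ((rslope g x)\<^sup>2 - L\<^sup>2)))"
      using ikd integrable_mult_indicator[OF Am ikd] by simp
    have "(\<integral>x. indicator A x * (k x * ((rslope g x)\<^sup>2 - L\<^sup>2)) \<partial>m) \<le> e / 2"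
    proof (rule field_le_epsilon)
      fix e3 :: real assume e3: "e3 > 0"
      obtain h K where h: "lip K h" "\<And>x. x \<in> space m \<Longrightarrow> 0 \<le> h x \<and> h x \<le> 1"
        "(\<integral>x. \<bar>h x - indicator A x\<bar> * w x \<partial>m) < e3"
        using ap e3 unfolding approximable_def by blast
      note [measurable] = lip_measurable[OF h(1)]
      have i1: "integrable m (\<lambda>x. \<bar>h x - indicator A x\<bar> * w x)"
        using h(2) by (intro integrable_weight[OF iw w0]) (auto intro: indicator_diff_le_1)
      have i2: "integrable m (\<lambda>x. h x * (k x * ((rslope g x)\<^sup>2 - L\<^sup>2)))"
      proof (rule Bochner_Integration.integrable_bound[OF iw])
        show "AE x in m. norm (h x * (k x * ((rslope g x)\<^sup>2 - L\<^sup>2))) \<le> norm (w x)"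
        proof (rule AE_I2)
          fix x assume x: "x \<in> space m"
          have "\<bar>(rslope g x)\<^sup>2 - L\<^sup>2\<bar> \<le> (rslope g x)\<^sup>2 + L\<^sup>2" by (simp add: abs_le_iff)
          then have "\<bar>h x\<bar> * (\<bar>k x\<bar> * \<bar>(rslope g x)\<^sup>2 - L\<^sup>2\<bar>) \<le> 1 * (k x * ((rslope g x)\<^sup>2 + L\<^sup>2))"
            using h(2)[OF x] k01[OF x] by (intro mult_mono) auto
          then have "\<bar>h x * (k x * ((rslope g x)\<^sup>2 - L\<^sup>2))\<bar> \<le> w x"
            by (simp add: abs_mult w_def)
          then show "norm (h x * (k x * ((rslope g x)\<^sup>2 - L\<^sup>2))) \<le> norm (w x)"
            using w0[OF x] by simp
        qed
      qed (use ikd in measurable)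
      have "(\<integral>x. indicator A x * (k x * ((rslope g x)\<^sup>2 - L\<^sup>2)) \<partial>m) \<le>
        (\<integral>x. h x * (k x * ((rslope g x)\<^sup>2 - L\<^sup>2)) + \<bar>h x - indicator A x\<bar> * w x \<partial>m)"
      proof (rule integral_mono[OF iA Bochner_Integration.integrable_add[OF i2 i1]])
        fix x assume x: "x \<in> space m"
        have "\<bar>k x * ((rslope g x)\<^sup>2 - L\<^sup>2)\<bar> \<le> w x"
          unfolding w_def abs_mult using k01[OF x] by (intro mult_mono) (auto simp: abs_le_iff)
        then have "\<bar>h x - indicator A x\<bar> * \<bar>k x * ((rslope g x)\<^sup>2 - L\<^sup>2)\<bar> \<le> \<bar>h x - indicator A x\<bar> * w x"
          by (rule mult_left_mono) simp
        moreover have "(indicator A x - h x) * (k x * ((rslope g x)\<^sup>2 - L\<^sup>2)) \<le>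
            \<bar>indicator A x - h x\<bar> * \<bar>k x * ((rslope g x)\<^sup>2 - L\<^sup>2)\<bar>"
          unfolding abs_mult[symmetric] by (rule abs_ge_self)
        ultimately have "(indicator A x - h x) * (k x * ((rslope g x)\<^sup>2 - L\<^sup>2)) \<le> \<bar>h x - indicator A x\<bar> * w x"
          by (simp only: abs_minus_commute)
        then show "indicator A x * (k x * ((rslope g x)\<^sup>2 - L\<^sup>2)) \<le>
           h x * (k x * ((rslope g x)\<^sup>2 - L\<^sup>2)) + \<bar>h x - indicator A x\<bar> * w x"
          by (simp add: left_diff_distrib)
      qed
      also have "\<dots> = (\<integral>x. h x * (k x * ((rslope g x)\<^sup>2 - L\<^sup>2)) \<partial>m) + (\<integral>x. \<bar>h x - indicator A x\<bar> * w x \<partial>m)"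
        by (rule Bochner_Integration.integral_add[OF i2 i1])
      also have "\<dots> \<le> e / 2 + e3" using main[OF h(1,2)] h(3) by simp
      finally show "(\<integral>x. indicator A x * (k x * ((rslope g x)\<^sup>2 - L\<^sup>2)) \<partial>m) \<le> e / 2 + e3" .
    qed
    moreover have "(\<integral>x. k x * (max 0 (rslope g x - L))\<^sup>2 \<partial>m) \<le> (\<integral>x. indicator A x * (k x * ((rslope g x)\<^sup>2 - L\<^sup>2)) \<partial>m)"
    proof (rule integral_mono'[OF iA])
      fix x assume x: "x \<in> space m"
      show "k x * (max 0 (rslope g x - L))\<^sup>2 \<le> indicator A x * (k x * ((rslope g x)\<^sup>2 - L\<^sup>2))"
      proof (cases "x \<in> A")
        case True
        then have "L < rslope g x" by (simp add: A_def)
        then have "2 * (L * L) \<le> 2 * (L * rslope g x)" using L0 by (intro mult_left_mono) auto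
        then have "(max 0 (rslope g x - L))\<^sup>2 \<le> (rslope g x)\<^sup>2 - L\<^sup>2"
          using \<open>L < rslope g x\<close> by (simp add: power2_eq_square algebra_simps)
        then show ?thesis using True k01[OF x] by (simp add: mult_left_mono)
      next
        case False
        then show ?thesis using x by (simp add: A_def)
      qed
      show "0 \<le> indicator A x * (k x * ((rslope g x)\<^sup>2 - L\<^sup>2))"
      proof (cases "x \<in> A")
        case True
        then have "L\<^sup>2 \<le> (rslope g x)\<^sup>2" using L0 by (intro power_mono) (auto simp: A_def)
        then show ?thesis using k01[OF x] by simp
      qed simp
    qed
    ultimately show ?thesis using e by linarith
  qed
  then show thesis using \<eta>1(1) by (intro that[of \<eta>]) (auto simp: \<eta>_def)
qed

definition cutoff :: "real \<Rightarrow> 'a \<Rightarrow> real" where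
  "cutoff R x = max 0 (min 1 (R + 1 - d z x))"

lemma cutoff:
  "cutoff R \<in> Lip_bs d m" "0 \<le> cutoff R x \<and> cutoff R x \<le> 1" "d z x \<le> R \<Longrightarrow> cutoff R x = 1"
proof -
  have "lip (0 + 1) (\<lambda>x. (R + 1) - d z x)" by (rule lip_diff[OF lip_const lip_dist])
  then have "lip (0 + 1) (cutoff R)" unfolding cutoff_def by (rule lip_clamp)
  then show "cutoff R \<in> Lip_bs d m"
    unfolding Lip_bs_iff by (intro exI[of _ "0 + 1"] exI[of _ "R + 1"]) (auto simp: cutoff_def)
qed (auto simp: cutoff_def)

lemma energy_add_le:
  assumes g: "g \<in> Lip_bs d m" and F: "F \<in> Lip_bs d m" and \<epsilon>: "0 \<le> \<epsilon>"
  shows "energy (\<lambda>x. g x + \<epsilon> * F x) \<le> energy g + 2 * \<epsilon> * (\<integral>x. rslope g x * rslope F x \<partial>m) + \<epsilon>\<^sup>2 * energy F"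
proof -
  obtain K where K: "lip K g" using Lip_bs_lip[OF g] by blast
  obtain K' where K': "lip K' F" using Lip_bs_lip[OF F] by blast
  note K'' = lip_cmult[OF K', of \<epsilon>]
  have h: "(\<lambda>x. g x + \<epsilon> * F x) \<in> Lip_bs d m" by (intro Lip_bs_add g Lip_bs_cmult F)
  have gL: "rslope g \<in> L2 m" and FL: "rslope F \<in> L2 m" and hL: "rslope (\<lambda>x. g x + \<epsilon> * F x) \<in> L2 m"
    using Lip_bs_rslope_L2 g F h by auto
  have "energy (\<lambda>x. g x + \<epsilon> * F x) \<le> (\<integral>x. (rslope g x)\<^sup>2 + 2 * \<epsilon> * (rslope g x * rslope F x) + \<epsilon>\<^sup>2 * (rslope F x)\<^sup>2 \<partial>m)"
    unfolding energy_def
  proof (rule integral_mono)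
    fix x assume x: "x \<in> space m"
    have "rslope (\<lambda>x. g x + \<epsilon> * F x) x \<le> rslope g x + rslope (\<lambda>x. \<epsilon> * F x) x"
      by (rule rslope_add_le[OF K K'' lip_add[OF K K''] x])
    also have "\<dots> \<le> rslope g x + \<epsilon> * rslope F x" using rslope_cmult[OF K' K'' x] \<epsilon> by simp
    finally have "(rslope (\<lambda>x. g x + \<epsilon> * F x) x)\<^sup>2 \<le> (rslope g x + \<epsilon> * rslope F x)\<^sup>2" by (intro power_mono) auto
    then show "(rslope (\<lambda>x. g x + \<epsilon> * F x) x)\<^sup>2 \<le> (rslope g x)\<^sup>2 + 2 * \<epsilon> * (rslope g x * rslope F x) + \<epsilon>\<^sup>2 * (rslope F x)\<^sup>2"
      by (simp add: power2_eq_square algebra_simps)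
  qed (use gL FL hL L2_mult_integrable[OF gL FL] in \<open>auto simp: L2_integrable_sq\<close>)
  also have "\<dots> = energy g + 2 * \<epsilon> * (\<integral>x. rslope g x * rslope F x \<partial>m) + \<epsilon>\<^sup>2 * energy F"
    unfolding energy_def using gL FL L2_mult_integrable[OF gL FL] by (simp add: L2_integrable_sq)
  finally show ?thesis .
qed

text \<open>
By the subgradient inequality, \<open>\<epsilon> \<integral> v F\<close> is at most the increase of the Cheeger energy from \<open>f\<close> to
\<open>f + \<epsilon> F\<close>. The latter is estimated with the functions \<open>g + \<epsilon> F\<close>, where \<open>g\<close> is near optimal for \<open>f\<close>; the
term linear in \<open>\<epsilon>\<close> is \<open>\<integral> |Dg| |DF|\<close>, and \<open>|Dg|\<close> is essentially at most \<open>L\<close> on the support of \<open>F\<close>.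
\<close>

lemma subdiff_lip_le:
  assumes v: "v \<in> Ch_subdiff d m f" and L: "lip L f" and F: "F \<in> Lip_bs d m"
  shows "(\<integral>x. v x * F x \<partial>m) \<le> L * (\<integral>x. rslope F x \<partial>m)"
proof -
  have f: "f \<in> W12 d m" by (rule subdiffD(2)[OF v])
  have L0: "0 \<le> L" by (rule lip_nonneg[OF L])
  have FL: "rslope F \<in> L2 m" by (rule Lip_bs_rslope_L2[OF F])
  define J where "J = L * (\<integral>x. rslope F x \<partial>m)"
  obtain R where R: "\<And>x. x \<in> space m \<Longrightarrow> R \<le> d z x \<Longrightarrow> rslope F x = 0"
    using Lip_bs_bounded[OF F] by metis
  \<comment> \<open>\<open>near_opt_excess\<close> only controls the excess on bounded regions; \<open>k\<close> covers the support of the slope of \<open>F\<close>.\<close>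
  define k where "k = cutoff R"
  have k: "k \<in> Lip_bs d m" "\<And>x. 0 \<le> k x \<and> k x \<le> 1" "\<And>x. d z x \<le> R \<Longrightarrow> k x = 1"
    unfolding k_def by (simp_all add: cutoff)
  have mixed: "\<exists>\<eta>>0. \<forall>g\<in>near_opt f \<eta>. (\<integral>x. rslope g x * rslope F x \<partial>m) \<le> J + e" if e: "e > 0" for e
  proof -
    define N where "N = L2_norm m (rslope F) + 1"
    have N: "N > 0" by (simp add: N_def add_nonneg_pos)
    have eN: "(e / N)\<^sup>2 > 0" using e N by simp
    obtain \<eta> where \<eta>: "\<eta> > 0"
      "\<And>g. g \<in> near_opt f \<eta> \<Longrightarrow> (\<integral>x. k x * (max 0 (rslope g x - L))\<^sup>2 \<partial>m) < (e / N)\<^sup>2"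
      using near_opt_excess[OF f L k(1) _ eN] k(2) by metis
    have "(\<integral>x. rslope g x * rslope F x \<partial>m) \<le> J + e" if g': "g \<in> near_opt f \<eta>" for g
    proof -
      have g: "g \<in> Lip_bs d m" by (rule near_optD[OF g'])
      have gL: "rslope g \<in> L2 m" by (rule Lip_bs_rslope_L2[OF g])
      define p where "p x = sqrt (k x) * max 0 (rslope g x - L)" for x
      have psq: "(p x)\<^sup>2 = k x * (max 0 (rslope g x - L))\<^sup>2" for x using k(2)[of x] by (simp add: p_def power_mult_distrib)
      have pm: "p \<in> borel_measurable m"
        unfolding p_def using Lip_bs_measurable[OF k(1)] Lip_bs_rslope_measurable[OF g] by measurable
      have pL: "p \<in> L2 m" unfolding L2_def
      proof (intro CollectI conjI pm Bochner_Integration.integrable_bound[OF L2_integrable_sq[OF gL]])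
        have "(p x)\<^sup>2 \<le> (rslope g x)\<^sup>2" for x
        proof -
          have "max 0 (rslope g x - L) \<le> rslope g x" using L0 by simp
          then have "(max 0 (rslope g x - L))\<^sup>2 \<le> (rslope g x)\<^sup>2" by (intro power_mono) auto
          then have "k x * (max 0 (rslope g x - L))\<^sup>2 \<le> 1 * (rslope g x)\<^sup>2" using k(2)[of x] by (intro mult_mono) auto
          then show ?thesis by (simp add: psq)
        qed
        then show "AE x in m. norm ((p x)\<^sup>2) \<le> norm ((rslope g x)\<^sup>2)" by simp
      qed (use pm in measurable)
      have "(\<integral>x. rslope g x * rslope F x \<partial>m) \<le> (\<integral>x. L * rslope F x + p x * rslope F x \<partial>m)"
      proof (rule integral_mono)
        fix x assume x: "x \<in> space m"
        show "rslope g x * rslope F x \<le> L * rslope F x + p x * rslope F x"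
        proof (cases "R \<le> d z x")
          case True then show ?thesis using R[OF x] by simp
        next
          case False
          then have "rslope g x \<le> L + p x" using k(3)[of x] by (simp add: p_def)
          then have "rslope g x * rslope F x \<le> (L + p x) * rslope F x" by (rule mult_right_mono) simp
          then show ?thesis by (simp add: distrib_right)
        qed
      qed (use Lip_bs_rslope_integrable[OF F] L2_mult_integrable[OF gL FL] L2_mult_integrable[OF pL FL] in auto)
      also have "\<dots> = J + (\<integral>x. p x * rslope F x \<partial>m)"
        unfolding J_def using Lip_bs_rslope_integrable[OF F] L2_mult_integrable[OF pL FL] by simp
      also have "(\<integral>x. p x * rslope F x \<partial>m) \<le> L2_norm m p * L2_norm m (rslope F)"
        using L2_cauchy_schwarz[OF pL FL] by linarith
      also have "\<dots> \<le> (e / N) * N"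
      proof (intro mult_mono)
        have "L2_norm m p \<le> sqrt ((e / N)\<^sup>2)"
          unfolding L2_norm_def psq using \<eta>(2)[OF g'] by (intro real_sqrt_le_mono) simp
        then show "L2_norm m p \<le> e / N" using e N by simp
      qed (use e N in \<open>auto simp: N_def\<close>)
      also have "\<dots> = e" using N by simp
      finally show ?thesis by simp
    qed
    then show ?thesis using \<eta>(1) by blast
  qed
  have var: "(\<integral>x. v x * F x \<partial>m) \<le> J + \<epsilon> * (energy F / 2)" if \<epsilon>: "\<epsilon> > 0" for \<epsilon>
  proof -
    let ?h = "\<lambda>x. f x + \<epsilon> * F x"
    have ap: "\<exists>g\<in>Lip_bs d m. (\<integral>x. (g x - ?h x)\<^sup>2 \<partial>m) < e \<and> energy g \<le> (2 * cheeger f + 2 * \<epsilon> * J + \<epsilon>\<^sup>2 * energy F) + e"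
      if e: "e > 0" for e
    proof -
      define e' where "e' = e / (4 * \<epsilon>)"
      have e': "e' > 0" using e \<epsilon> by (simp add: e'_def)
      obtain \<eta> where \<eta>: "\<eta> > 0" "\<And>g. g \<in> near_opt f \<eta> \<Longrightarrow> (\<integral>x. rslope g x * rslope F x \<partial>m) \<le> J + e'"
        using mixed[OF e'] by blast
      obtain g where g': "g \<in> near_opt f (min \<eta> (e / 2))"
        using near_opt_ex[OF f, of "min \<eta> (e / 2)"] \<eta>(1) e by auto
      note g = near_optD[OF g']
      have mx: "(\<integral>x. rslope g x * rslope F x \<partial>m) \<le> J + e'" using \<eta>(2) near_opt_mono[OF g'] by simp
      have "energy (\<lambda>x. g x + \<epsilon> * F x) \<le> energy g + 2 * \<epsilon> * (\<integral>x. rslope g x * rslope F x \<partial>m) + \<epsilon>\<^sup>2 * energy F"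
        using \<epsilon> by (intro energy_add_le g F) simp
      also have "\<dots> \<le> (2 * cheeger f + e / 2) + 2 * \<epsilon> * (J + e') + \<epsilon>\<^sup>2 * energy F"
        using g(3) mx \<epsilon> by (intro add_mono mult_left_mono) auto
      also have "\<dots> = (2 * cheeger f + 2 * \<epsilon> * J + \<epsilon>\<^sup>2 * energy F) + e"
        using \<epsilon> by (simp add: e'_def field_simps)
      finally have "energy (\<lambda>x. g x + \<epsilon> * F x) \<le> (2 * cheeger f + 2 * \<epsilon> * J + \<epsilon>\<^sup>2 * energy F) + e" .
      moreover have "(\<lambda>x. g x + \<epsilon> * F x) \<in> Lip_bs d m" by (intro Lip_bs_add g Lip_bs_cmult F)
      ultimately show ?thesis using g(2) e by (intro bexI[of _ "\<lambda>x. g x + \<epsilon> * F x"]) auto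
    qed
    have hL: "?h \<in> L2 m" by (intro L2_add L2_cmult W12_L2 f Lip_bs_L2 F)
    note h = cheeger_leI[OF hL ap]
    have "cheeger f + (\<integral>x. v x * (\<epsilon> * F x) \<partial>m) \<le> cheeger ?h" by (rule subdiff_add_le[OF v h(1)])
    also have "\<dots> \<le> (2 * cheeger f + 2 * \<epsilon> * J + \<epsilon>\<^sup>2 * energy F) / 2" by (rule h(2))
    finally have "\<epsilon> * (\<integral>x. v x * F x \<partial>m) \<le> \<epsilon> * (J + \<epsilon> * (energy F / 2))"
      by (simp add: mult.left_commute power2_eq_square algebra_simps)
    then show ?thesis using \<epsilon> by simp
  qed
  have "(\<integral>x. v x * F x \<partial>m) \<le> J"
  proof (rule field_le_epsilon)
    fix e :: real assume e: "e > 0"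
    have E: "energy F / 2 + 1 > 0" by (simp add: add_nonneg_pos)
    have "(\<integral>x. v x * F x \<partial>m) \<le> J + (e / (energy F / 2 + 1)) * (energy F / 2)"
      using e E by (intro var) simp
    also have "\<dots> \<le> J + e" using e E by (simp add: field_simps)
    finally show "(\<integral>x. v x * F x \<partial>m) \<le> J + e" .
  qed
  then show ?thesis by (simp add: J_def)
qed

end

section \<open>One implicit Euler step with an exponential weight\<close>

context metric_measure
begin

text \<open>
Minimising the Cheeger energy of \<open>g\<close> plus the second term is the implicit Euler step of size \<open>1 / \<mu>\<close>
from \<open>u\<close> for the heat equation. On Lipschitz functions, \<open>energy g / 2\<close> takes the place of the Cheeger
energy.
\<close>

definition penalty :: "real \<Rightarrow> ('a \<Rightarrow> real) \<Rightarrow> ('a \<Rightarrow> real) \<Rightarrow> real" where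
  "penalty \<mu> u g = energy g / 2 + \<mu> / 2 * (\<integral>x. (g x - u x)\<^sup>2 \<partial>m)"

definition near_min :: "real \<Rightarrow> real \<Rightarrow> ('a \<Rightarrow> real) \<Rightarrow> ('a \<Rightarrow> real) \<Rightarrow> bool" where
  "near_min \<mu> \<delta> u v \<longleftrightarrow> v \<in> Lip_bs d m \<and> (\<forall>g\<in>Lip_bs d m. penalty \<mu> u v \<le> penalty \<mu> u g + \<delta>)"

definition unit_valued :: "('a \<Rightarrow> real) \<Rightarrow> bool" where
  "unit_valued u \<longleftrightarrow> (\<forall>x\<in>space m. 0 \<le> u x \<and> u x \<le> 1)"

text \<open>
As \<open>u\<close> takes values between \<open>0\<close> and \<open>1\<close>, truncating a competitor to this range does not increase
the functional.
\<close>

lemma near_min_ex: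
  assumes u: "u \<in> Lip_bs d m" "unit_valued u" and \<mu>: "0 < \<mu>" and \<delta>: "0 < \<delta>"
  obtains v where "near_min \<mu> \<delta> u v" "unit_valued v"
proof -
  define I where "I = (INF g\<in>Lip_bs d m. penalty \<mu> u g)"
  have pen0: "0 \<le> penalty \<mu> u g" for g using \<mu> by (simp add: penalty_def)
  have bdd: "bdd_below (penalty \<mu> u ` Lip_bs d m)" by (rule bdd_belowI[of _ 0]) (use pen0 in auto)
  have "I < I + \<delta>" using \<delta> by simp
  then obtain g where g: "g \<in> Lip_bs d m" "penalty \<mu> u g < I + \<delta>"
    unfolding I_def using u(1) cInf_lessD[of "penalty \<mu> u ` Lip_bs d m"] by blast
  define v where "v x = max 0 (min 1 (g x))" for x
  obtain K R where K: "lip K g" and R: "\<And>x. x \<in> space m \<Longrightarrow> R \<le> d z x \<Longrightarrow> g x = 0"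
    using g(1) by (auto simp: Lip_bs_iff)
  have Kv: "lip K v" unfolding v_def by (rule lip_clamp[OF K])
  have v: "v \<in> Lip_bs d m"
    unfolding Lip_bs_iff using Kv R by (intro exI[of _ K] exI[of _ R]) (auto simp: v_def)
  have "energy v \<le> energy g"
    unfolding energy_def
  proof (rule integral_mono)
    fix x assume x: "x \<in> space m"
    have "\<bar>v y - v x\<bar> \<le> 1 * \<bar>g y - g x\<bar>" for y
      unfolding v_def by (auto simp: min_def max_def abs_if)
    then have "rslope v x \<le> 1 * rslope g x" by (intro rslope_mono[OF K Kv x]) auto
    then show "(rslope v x)\<^sup>2 \<le> (rslope g x)\<^sup>2" by (intro power_mono) auto
  qed (use Lip_bs_rslope_L2[OF v] Lip_bs_rslope_L2[OF g(1)] in \<open>auto simp: L2_integrable_sq\<close>)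
  moreover have "(\<integral>x. (v x - u x)\<^sup>2 \<partial>m) \<le> (\<integral>x. (g x - u x)\<^sup>2 \<partial>m)"
  proof (rule integral_mono)
    fix x assume x: "x \<in> space m"
    have "\<bar>v x - u x\<bar> \<le> \<bar>g x - u x\<bar>"
      using u(2) x unfolding v_def unit_valued_def by (auto simp: min_def max_def abs_if)
    then show "(v x - u x)\<^sup>2 \<le> (g x - u x)\<^sup>2" by (simp add: abs_le_square_iff)
  qed (use L2_diff[OF Lip_bs_L2[OF v] Lip_bs_L2[OF u(1)]] L2_diff[OF Lip_bs_L2[OF g(1)] Lip_bs_L2[OF u(1)]]
      in \<open>auto simp: L2_integrable_sq\<close>)
  ultimately have "penalty \<mu> u v \<le> penalty \<mu> u g"
    unfolding penalty_def using \<mu> by (intro add_mono divide_right_mono mult_left_mono) auto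
  moreover have "I \<le> penalty \<mu> u h" if "h \<in> Lip_bs d m" for h
    unfolding I_def using that by (intro cINF_lower bdd)
  ultimately have "near_min \<mu> \<delta> u v"
    unfolding near_min_def using v g(2) by fastforce
  moreover have "unit_valued v" by (simp add: unit_valued_def v_def)
  ultimately show thesis by (rule that)
qed

lemma near_min_mono: "near_min \<mu> \<delta> u v \<Longrightarrow> \<delta> \<le> \<delta>' \<Longrightarrow> near_min \<mu> \<delta>' u v"
  unfolding near_min_def by force

text \<open>
By relaxation, near minimality among Lipschitz functions extends to competitors of finite Cheeger
energy; perturbations by multiples of an eigenfunction are competitors of this kind.
\<close>

lemma near_min_W12:
  assumes v: "near_min \<mu> \<delta> u v" and u: "u \<in> Lip_bs d m" and \<mu>: "0 < \<mu>" and g: "g \<in> W12 d m"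
  shows "penalty \<mu> u v \<le> cheeger g + \<mu> / 2 * (\<integral>x. (g x - u x)\<^sup>2 \<partial>m) + \<delta>"
proof -
  define N where "N = L2_norm m (\<lambda>x. g x - u x)"
  have gu: "(\<lambda>x. g x - u x) \<in> L2 m" by (intro L2_diff W12_L2 g Lip_bs_L2 u)
  have le: "penalty \<mu> u v \<le> (cheeger g + inverse (real (Suc n)) / 2) + \<mu> / 2 * (sqrt (inverse (real (Suc n))) + N)\<^sup>2 + \<delta>" for n
  proof -
    define e where "e = inverse (real (Suc n))"
    have e: "e > 0" by (simp add: e_def)
    obtain h where h: "h \<in> Lip_bs d m" "(\<integral>x. (h x - g x)\<^sup>2 \<partial>m) < e" "energy h < 2 * cheeger g + e"
      using cheeger_approx[OF g e] by metis
    have hg: "(\<lambda>x. h x - g x) \<in> L2 m" by (intro L2_diff W12_L2 g Lip_bs_L2 h)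
    have "L2_norm m (\<lambda>x. (h x - g x) + (g x - u x)) \<le> L2_norm m (\<lambda>x. h x - g x) + N"
      unfolding N_def by (rule L2_norm_triangle[OF hg gu])
    also have "L2_norm m (\<lambda>x. h x - g x) \<le> sqrt e"
      unfolding L2_norm_def using h(2) by (intro real_sqrt_le_mono) simp
    finally have "L2_norm m (\<lambda>x. h x - u x) \<le> sqrt e + N" by simp
    then have "(L2_norm m (\<lambda>x. h x - u x))\<^sup>2 \<le> (sqrt e + N)\<^sup>2" by (intro power_mono) auto
    then have *: "(\<integral>x. (h x - u x)\<^sup>2 \<partial>m) \<le> (sqrt e + N)\<^sup>2" by (simp add: L2_norm_sq)
    have "penalty \<mu> u v \<le> penalty \<mu> u h + \<delta>" using v h(1) by (auto simp: near_min_def)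
    also have "penalty \<mu> u h \<le> (cheeger g + e / 2) + \<mu> / 2 * (sqrt e + N)\<^sup>2"
      unfolding penalty_def using h(3) * \<mu> by (intro add_mono mult_left_mono) auto
    finally show ?thesis by (simp add: e_def)
  qed
  have "(\<lambda>n. (cheeger g + inverse (real (Suc n)) / 2) + \<mu> / 2 * (sqrt (inverse (real (Suc n))) + N)\<^sup>2 + \<delta>)
     \<longlonglongrightarrow> (cheeger g + 0 / 2) + \<mu> / 2 * (sqrt 0 + N)\<^sup>2 + \<delta>"
    by (intro tendsto_intros LIMSEQ_inverse_real_of_nat) auto
  then have "penalty \<mu> u v \<le> (cheeger g + 0 / 2) + \<mu> / 2 * (sqrt 0 + N)\<^sup>2 + \<delta>"
    by (rule LIMSEQ_le_const) (use le in blast)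
  then show ?thesis by (simp add: N_def L2_norm_sq)
qed

definition weight :: "real \<Rightarrow> 'a \<Rightarrow> real" where
  "weight \<theta> x = exp (- (\<theta> * d z x))"

lemma weight_bounds: "0 < weight \<theta> x" "0 \<le> \<theta> \<Longrightarrow> weight \<theta> x \<le> 1"
  by (auto simp: weight_def)

lemma weight_lip:
  assumes \<theta>: "0 \<le> \<theta>"
  shows "lip \<theta> (weight \<theta>)"
proof -
  have half: "exp (- s) - exp (- t) \<le> t - s" if "0 \<le> s" "s \<le> t" for s t :: real
  proof -
    have "exp (- s) - exp (- t) = exp (- s) * (1 - exp (s - t))" by (simp add: algebra_simps flip: exp_add)
    also have "\<dots> \<le> 1 * (1 - exp (s - t))" using that by (intro mult_right_mono) auto
    also have "\<dots> \<le> t - s"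
    proof -
      have "1 * (1 - E) \<le> t - s" if "1 + (s - t) \<le> E" for E using that by simp
      then show ?thesis using exp_ge_add_one_self[of "s - t"] by blast
    qed
    finally show ?thesis .
  qed
  have ab: "\<bar>exp (- s) - exp (- t)\<bar> \<le> \<bar>s - t\<bar>" if "0 \<le> s" "0 \<le> t" for s t :: real
    using half[of s t] half[of t s] that by (cases "s \<le> t") (auto simp: abs_if)
  show ?thesis
    unfolding lip_def weight_def
  proof (intro conjI ballI \<theta>)
    fix x y assume xy: "x \<in> space m" "y \<in> space m"
    have "\<bar>exp (- (\<theta> * d z x)) - exp (- (\<theta> * d z y))\<bar> \<le> \<bar>\<theta> * d z x - \<theta> * d z y\<bar>"
      using \<theta> by (intro ab) auto
    also have "\<dots> = \<theta> * \<bar>d z x - d z y\<bar>" using \<theta> by (simp flip: right_diff_distrib add: abs_mult)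
    also have "\<dots> \<le> \<theta> * (1 * d x y)" using lipD[OF lip_dist xy] \<theta> by (intro mult_left_mono) auto
    finally show "\<bar>exp (- (\<theta> * d z x)) - exp (- (\<theta> * d z y))\<bar> \<le> \<theta> * d x y" by simp
  qed
qed

text \<open>
The logarithmic derivative of the weight is at most \<open>\<theta>\<close>. That the slope is bounded by a multiple of
the weight at the same point is what lets the weighted energy estimate close.
\<close>

lemma rslope_weight_le:
  assumes \<theta>: "0 \<le> \<theta>" and \<epsilon>: "0 \<le> \<epsilon>" and x: "x \<in> space m"
  shows "rslope (\<lambda>x. \<epsilon> * weight \<theta> x) x \<le> \<epsilon> * \<theta> * weight \<theta> x"
proof -
  have "rslope (weight \<theta>) x \<le> \<theta> * weight \<theta> x"
  proof (subst rslope_le_iff[OF weight_lip[OF \<theta>] x])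
    show "\<forall>e>0. \<exists>r>0. \<forall>y\<in>space m. d x y < r \<longrightarrow> \<bar>weight \<theta> y - weight \<theta> x\<bar> \<le> (\<theta> * weight \<theta> x + e) * d x y"
    proof (intro allI impI)
      fix e :: real assume e: "0 < e"
      define a where "a = \<theta> * weight \<theta> x"
      have a: "0 \<le> a" using \<theta> weight_bounds(1)[of \<theta> x] by (simp add: a_def)
      \<comment> \<open>On the ball of radius \<open>r\<close> the weight varies by a factor of at most \<open>1 + e / (a + 1)\<close>.\<close>
      define r where "r = ln (1 + e / (a + 1)) / (\<theta> + 1)"
      have p: "1 + e / (a + 1) > 1" using e a by simp
      have r: "r > 0" using p \<theta> by (simp add: r_def)
      have "\<bar>weight \<theta> y - weight \<theta> x\<bar> \<le> (a + e) * d x y" if y: "y \<in> space m" "d x y < r" for y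
      proof -
        define t where "t = \<theta> * d z x - \<theta> * d z y"
        have t: "\<bar>t\<bar> \<le> \<theta> * d x y"
        proof -
          have "\<bar>t\<bar> = \<theta> * \<bar>d z x - d z y\<bar>" using \<theta> by (simp add: t_def flip: right_diff_distrib add: abs_mult)
          also have "\<dots> \<le> \<theta> * (1 * d x y)" using lipD[OF lip_dist x y(1)] \<theta> by (intro mult_left_mono) auto
          finally show ?thesis by simp
        qed
        have "\<theta> * d x y \<le> (\<theta> + 1) * d x y" by (intro mult_right_mono) auto
        also have "\<dots> \<le> ln (1 + e / (a + 1))" using y(2) \<theta> by (simp add: r_def field_simps)
        finally have "exp \<bar>t\<bar> \<le> exp (ln (1 + e / (a + 1)))" using t by simp
        then have et: "exp \<bar>t\<bar> \<le> 1 + e / (a + 1)" using p by simp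
        have "weight \<theta> y - weight \<theta> x = weight \<theta> x * (exp t - 1)"
          by (simp add: weight_def t_def algebra_simps flip: exp_add)
        then have "\<bar>weight \<theta> y - weight \<theta> x\<bar> = weight \<theta> x * \<bar>exp t - 1\<bar>"
          using weight_bounds(1)[of \<theta> x] by (simp add: abs_mult)
        also have "\<dots> \<le> weight \<theta> x * (exp \<bar>t\<bar> * \<bar>t\<bar>)"
          using weight_bounds(1)[of \<theta> x] by (intro mult_left_mono abs_exp_minus_1_le) auto
        also have "\<dots> \<le> weight \<theta> x * ((1 + e / (a + 1)) * (\<theta> * d x y))"
          using weight_bounds(1)[of \<theta> x] et t p by (intro mult_left_mono mult_mono) auto
        also have "\<dots> = (a + e * (a / (a + 1))) * d x y" by (simp add: a_def algebra_simps)
        also have "\<dots> \<le> (a + e) * d x y"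
          using a e by (intro mult_right_mono add_left_mono mult_left_le) auto
        finally show ?thesis .
      qed
      then show "\<exists>r>0. \<forall>y\<in>space m. d x y < r \<longrightarrow> \<bar>weight \<theta> y - weight \<theta> x\<bar> \<le> (\<theta> * weight \<theta> x + e) * d x y"
        using r unfolding a_def by blast
    qed
  qed (use \<theta> weight_bounds(1)[of \<theta> x] in simp)
  then have "\<bar>\<epsilon>\<bar> * rslope (weight \<theta>) x \<le> \<bar>\<epsilon>\<bar> * (\<theta> * weight \<theta> x)" by (rule mult_left_mono) simp
  moreover have "rslope (\<lambda>x. \<epsilon> * weight \<theta> x) x \<le> \<bar>\<epsilon>\<bar> * rslope (weight \<theta>) x"
    by (rule rslope_cmult[OF weight_lip[OF \<theta>] lip_cmult[OF weight_lip[OF \<theta>]] x])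
  ultimately show ?thesis using \<epsilon> by simp
qed

text \<open>
The weighted squared \<open>L\<^sup>2\<close> distance of \<open>v\<close> from the initial datum \<open>\<eta>\<close> of the scheme.
\<close>

definition deviation :: "real \<Rightarrow> ('a \<Rightarrow> real) \<Rightarrow> ('a \<Rightarrow> real) \<Rightarrow> real" where
  "deviation \<theta> \<eta> v = (\<integral>x. weight \<theta> x * (v x - \<eta> x)\<^sup>2 \<partial>m)"

lemma weight_sq_integrable:
  assumes \<theta>: "0 \<le> \<theta>" and g: "g \<in> L2 m"
  shows "integrable m (\<lambda>x. weight \<theta> x * (g x)\<^sup>2)"
  using weight_bounds[of \<theta>] \<theta> lip_measurable[OF weight_lip[OF \<theta>]]
  by (intro integrable_weight[OF L2_integrable_sq[OF g]]) (auto simp: abs_of_pos)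

text \<open>
This is the discrete form of differentiating the weighted distance along the heat flow. The
competitor moves \<open>v\<close> towards \<open>\<eta>\<close> by the fraction \<open>\<epsilon> wt\<close>, where \<open>wt\<close> denotes the weight. With
\<open>c = \<epsilon> wt\<close>, the Leibniz rule and \<open>rslope_weight_le\<close> bound its slope by the convex combination of
\<open>|Dv|\<close> and \<open>|D\<eta>| + \<theta> |v - \<eta>|\<close> with coefficients \<open>1 - c\<close> and \<open>c\<close>. By convexity of the square the
energy grows by no more than \<open>\<epsilon>\<close> times a weighted integral that does not contain \<open>|Dv|\<close>.
\<close>

lemma near_min_deviation:
  assumes v: "near_min \<mu> \<delta> u v" and u: "u \<in> Lip_bs d m" and \<eta>: "\<eta> \<in> Lip_bs d m"
    and \<mu>: "0 < \<mu>" and \<epsilon>: "0 < \<epsilon>" "\<epsilon> \<le> 1" and \<theta>: "0 \<le> \<theta>"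
  shows "\<mu> / 2 * (deviation \<theta> \<eta> v - deviation \<theta> \<eta> u) \<le>
    (\<integral>x. weight \<theta> x * (rslope \<eta> x)\<^sup>2 \<partial>m) + (\<theta>\<^sup>2 + \<mu> * \<epsilon> / 2) * deviation \<theta> \<eta> v + \<delta> / \<epsilon>"
proof -
  define E where "E = (\<integral>x. weight \<theta> x * (rslope \<eta> x)\<^sup>2 \<partial>m)"
  have vB: "v \<in> Lip_bs d m" using v by (simp add: near_min_def)
  obtain Kv where Kv: "lip Kv v" using Lip_bs_lip[OF vB] by blast
  obtain Ke where Ke: "lip Ke \<eta>" using Lip_bs_lip[OF \<eta>] by blast
  define c where "c x = \<epsilon> * weight \<theta> x" for x
  have Kc: "lip (\<bar>\<epsilon>\<bar> * \<theta>) c" unfolding c_def by (rule lip_cmult[OF weight_lip[OF \<theta>]])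
  have c01: "0 \<le> c x \<and> c x \<le> 1" for x
    using weight_bounds[of \<theta> x] \<theta> \<epsilon> by (simp add: c_def mult_le_one)
  define g where "g x = (1 - c x) * v x + c x * \<eta> x" for x
  have geq: "g = (\<lambda>x. v x + (\<eta> x - v x) * c x)" by (simp add: g_def fun_eq_iff algebra_simps)
  have gB: "g \<in> Lip_bs d m" unfolding geq
    by (intro Lip_bs_add vB Lip_bs_mult[OF Lip_bs_diff[OF \<eta> vB] Kc])
  obtain Kg where Kg: "lip Kg g" using Lip_bs_lip[OF gB] by blast
  have L: "rslope v \<in> L2 m" "rslope \<eta> \<in> L2 m" "rslope g \<in> L2 m" using Lip_bs_rslope_L2 vB \<eta> gB by auto
  have D: "(\<lambda>x. v x - \<eta> x) \<in> L2 m" "(\<lambda>x. u x - \<eta> x) \<in> L2 m" "(\<lambda>x. v x - u x) \<in> L2 m" "(\<lambda>x. g x - u x) \<in> L2 m"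
    by (intro L2_diff Lip_bs_L2 vB \<eta> u gB)+
  have i1: "integrable m (\<lambda>x. weight \<theta> x * (rslope \<eta> x)\<^sup>2)" by (rule weight_sq_integrable[OF \<theta> L(2)])
  have i2: "integrable m (\<lambda>x. weight \<theta> x * (v x - \<eta> x)\<^sup>2)" by (rule weight_sq_integrable[OF \<theta> D(1)])
  have i3: "integrable m (\<lambda>x. weight \<theta> x * (u x - \<eta> x)\<^sup>2)" by (rule weight_sq_integrable[OF \<theta> D(2)])
  have "energy g \<le> (\<integral>x. (rslope v x)\<^sup>2 + (2 * \<epsilon> * (weight \<theta> x * (rslope \<eta> x)\<^sup>2) + 2 * \<epsilon> * \<theta>\<^sup>2 * (weight \<theta> x * (v x - \<eta> x)\<^sup>2)) \<partial>m)"
    unfolding energy_def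
  proof (rule integral_mono)
    fix x assume x: "x \<in> space m"
    define b where "b = rslope \<eta> x + \<theta> * \<bar>v x - \<eta> x\<bar>"
    have "rslope g x \<le> (1 - c x) * rslope v x + c x * rslope \<eta> x + rslope c x * \<bar>\<eta> x - v x\<bar>"
      using rslope_glue[OF Kv Ke Kc Kg[unfolded g_def] c01 x] by (simp add: g_def[abs_def])
    also have "rslope c x * \<bar>\<eta> x - v x\<bar> \<le> (c x * \<theta>) * \<bar>\<eta> x - v x\<bar>"
      using rslope_weight_le[OF \<theta> _ x, of \<epsilon>] \<epsilon> unfolding c_def by (intro mult_right_mono) (auto simp: algebra_simps)
    finally have "rslope g x \<le> (1 - c x) * rslope v x + c x * b"
      by (simp add: b_def algebra_simps abs_minus_commute)
    then have "(rslope g x)\<^sup>2 \<le> ((1 - c x) * rslope v x + c x * b)\<^sup>2" by (intro power_mono) auto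
    also have "\<dots> \<le> (1 - c x) * (rslope v x)\<^sup>2 + c x * b\<^sup>2"
    proof -
      have "(1 - c x) * (rslope v x)\<^sup>2 + c x * b\<^sup>2 - ((1 - c x) * rslope v x + c x * b)\<^sup>2 = c x * (1 - c x) * (rslope v x - b)\<^sup>2"
        by (simp add: power2_eq_square algebra_simps)
      moreover have "0 \<le> c x * (1 - c x) * (rslope v x - b)\<^sup>2" using c01[of x] by simp
      ultimately show ?thesis by linarith
    qed
    also have "\<dots> \<le> 1 * (rslope v x)\<^sup>2 + c x * (2 * (rslope \<eta> x)\<^sup>2 + 2 * \<theta>\<^sup>2 * (v x - \<eta> x)\<^sup>2)"
    proof (intro add_mono mult_right_mono mult_left_mono)
      have "b\<^sup>2 + (rslope \<eta> x - \<theta> * \<bar>v x - \<eta> x\<bar>)\<^sup>2 = 2 * (rslope \<eta> x)\<^sup>2 + 2 * \<theta>\<^sup>2 * \<bar>v x - \<eta> x\<bar>\<^sup>2"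
        unfolding b_def by (simp add: power2_eq_square algebra_simps)
      moreover have "0 \<le> (rslope \<eta> x - \<theta> * \<bar>v x - \<eta> x\<bar>)\<^sup>2" by simp
      ultimately show "b\<^sup>2 \<le> 2 * (rslope \<eta> x)\<^sup>2 + 2 * \<theta>\<^sup>2 * (v x - \<eta> x)\<^sup>2" unfolding power2_abs by linarith
    qed (use c01[of x] in auto)
    also have "\<dots> = (rslope v x)\<^sup>2 + (2 * \<epsilon> * (weight \<theta> x * (rslope \<eta> x)\<^sup>2) + 2 * \<epsilon> * \<theta>\<^sup>2 * (weight \<theta> x * (v x - \<eta> x)\<^sup>2))"
      by (simp add: c_def algebra_simps)
    finally show "(rslope g x)\<^sup>2 \<le> (rslope v x)\<^sup>2 + (2 * \<epsilon> * (weight \<theta> x * (rslope \<eta> x)\<^sup>2) + 2 * \<epsilon> * \<theta>\<^sup>2 * (weight \<theta> x * (v x - \<eta> x)\<^sup>2))" .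
  qed (use L i1 i2 in \<open>auto simp: L2_integrable_sq\<close>)
  also have "\<dots> = energy v + (2 * \<epsilon> * E + 2 * \<epsilon> * \<theta>\<^sup>2 * deviation \<theta> \<eta> v)"
    unfolding energy_def E_def deviation_def using L i1 i2 by (simp add: L2_integrable_sq)
  finally have energy: "energy g \<le> energy v + (2 * \<epsilon> * E + 2 * \<epsilon> * \<theta>\<^sup>2 * deviation \<theta> \<eta> v)" .
  have "(\<integral>x. (g x - u x)\<^sup>2 \<partial>m) \<le> (\<integral>x. (v x - u x)\<^sup>2 - \<epsilon> * (weight \<theta> x * (v x - \<eta> x)\<^sup>2)
      + \<epsilon> * (weight \<theta> x * (u x - \<eta> x)\<^sup>2) + \<epsilon>\<^sup>2 * (weight \<theta> x * (v x - \<eta> x)\<^sup>2) \<partial>m)"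
  proof (rule integral_mono)
    fix x assume x: "x \<in> space m"
    define W where "W = weight \<theta> x"
    have W: "0 \<le> W" "W \<le> 1" using weight_bounds[of \<theta> x] \<theta> by (auto simp: W_def)
    have gu: "g x - u x = (v x - u x) - \<epsilon> * W * (v x - \<eta> x)" by (simp add: g_def c_def W_def algebra_simps)
    have "(g x - u x)\<^sup>2 = (v x - u x)\<^sup>2 - \<epsilon> * W * (2 * (v x - u x) * (v x - \<eta> x)) + \<epsilon>\<^sup>2 * (W * W * (v x - \<eta> x)\<^sup>2)"
      unfolding gu by (simp add: power2_eq_square algebra_simps)
    moreover have "\<epsilon> * W * ((v x - \<eta> x)\<^sup>2 - (u x - \<eta> x)\<^sup>2) \<le> \<epsilon> * W * (2 * (v x - u x) * (v x - \<eta> x))"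
    proof (rule mult_left_mono)
      have "2 * (v x - u x) * (v x - \<eta> x) - ((v x - \<eta> x)\<^sup>2 - (u x - \<eta> x)\<^sup>2) = (v x - u x)\<^sup>2"
        by (simp add: power2_eq_square algebra_simps)
      moreover have "0 \<le> (v x - u x)\<^sup>2" by simp
      ultimately show "(v x - \<eta> x)\<^sup>2 - (u x - \<eta> x)\<^sup>2 \<le> 2 * (v x - u x) * (v x - \<eta> x)" by linarith
    qed (use W \<epsilon> in simp)
    moreover have "\<epsilon>\<^sup>2 * (W * W * (v x - \<eta> x)\<^sup>2) \<le> \<epsilon>\<^sup>2 * (W * (v x - \<eta> x)\<^sup>2)"
      using W by (intro mult_left_mono mult_right_mono mult_left_le) auto
    ultimately show "(g x - u x)\<^sup>2 \<le> (v x - u x)\<^sup>2 - \<epsilon> * (weight \<theta> x * (v x - \<eta> x)\<^sup>2)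
      + \<epsilon> * (weight \<theta> x * (u x - \<eta> x)\<^sup>2) + \<epsilon>\<^sup>2 * (weight \<theta> x * (v x - \<eta> x)\<^sup>2)"
      unfolding W_def[symmetric] by (simp add: algebra_simps)
  qed (use D i2 i3 in \<open>auto simp: L2_integrable_sq\<close>)
  also have "\<dots> = (\<integral>x. (v x - u x)\<^sup>2 \<partial>m) - \<epsilon> * deviation \<theta> \<eta> v + \<epsilon> * deviation \<theta> \<eta> u + \<epsilon>\<^sup>2 * deviation \<theta> \<eta> v"
    unfolding deviation_def using D i2 i3 by (simp add: L2_integrable_sq)
  finally have P: "(\<integral>x. (g x - u x)\<^sup>2 \<partial>m) \<le>
     (\<integral>x. (v x - u x)\<^sup>2 \<partial>m) + (- \<epsilon> * deviation \<theta> \<eta> v + \<epsilon> * deviation \<theta> \<eta> u + \<epsilon>\<^sup>2 * deviation \<theta> \<eta> v)" by simp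
  have "\<mu> / 2 * (\<integral>x. (g x - u x)\<^sup>2 \<partial>m) \<le> \<mu> / 2 *
     ((\<integral>x. (v x - u x)\<^sup>2 \<partial>m) + (- \<epsilon> * deviation \<theta> \<eta> v + \<epsilon> * deviation \<theta> \<eta> u + \<epsilon>\<^sup>2 * deviation \<theta> \<eta> v))"
    using P \<mu> by (intro mult_left_mono) auto
  moreover have "penalty \<mu> u v \<le> penalty \<mu> u g + \<delta>" using v gB by (auto simp: near_min_def)
  ultimately have "0 \<le> (\<epsilon> * E + \<epsilon> * \<theta>\<^sup>2 * deviation \<theta> \<eta> v)
     + \<mu> / 2 * (- \<epsilon> * deviation \<theta> \<eta> v + \<epsilon> * deviation \<theta> \<eta> u + \<epsilon>\<^sup>2 * deviation \<theta> \<eta> v) + \<delta>"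
    using energy unfolding penalty_def distrib_left[of "\<mu> / 2"] by linarith
  also have "\<dots> = \<epsilon> * (E + \<theta>\<^sup>2 * deviation \<theta> \<eta> v
     + \<mu> / 2 * (- deviation \<theta> \<eta> v + deviation \<theta> \<eta> u + \<epsilon> * deviation \<theta> \<eta> v) + \<delta> / \<epsilon>)"
    using \<epsilon> by (simp add: power2_eq_square algebra_simps)
  finally have "0 \<le> E + \<theta>\<^sup>2 * deviation \<theta> \<eta> v
     + \<mu> / 2 * (- deviation \<theta> \<eta> v + deviation \<theta> \<eta> u + \<epsilon> * deviation \<theta> \<eta> v) + \<delta> / \<epsilon>"
    using \<epsilon> by (simp add: zero_le_mult_iff)
  then show ?thesis unfolding E_def[symmetric] by (simp add: algebra_simps)
qed

end

section \<open>Eigenfunctions have mean zero\<close>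

context metric_measure
begin

text \<open>
The slope of this cutoff function is concentrated at distances between \<open>R\<close> and \<open>2 R\<close>; the radius
\<open>3 R\<close> leaves a margin, since the slope at distance exactly \<open>2 R\<close> need not vanish.
\<close>

definition bump :: "real \<Rightarrow> 'a \<Rightarrow> real" where
  "bump R x = max 0 (min 1 (2 - 1 / R * d z x))"

lemma bump:
  assumes R: "1 \<le> R"
  shows "bump R \<in> Lip_bs d m" "unit_valued (bump R)" "d z x \<le> R \<Longrightarrow> bump R x = 1"
    "x \<in> space m \<Longrightarrow> rslope (bump R) x \<le> 1" "x \<in> space m \<Longrightarrow> d z x < R \<Longrightarrow> rslope (bump R) x = 0"
    "x \<in> space m \<Longrightarrow> 3 * R \<le> d z x \<Longrightarrow> rslope (bump R) x = 0"
proof -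
  have K: "lip (0 + \<bar>1 / R\<bar> * 1) (bump R)"
    unfolding bump_def by (intro lip_clamp lip_diff lip_const lip_cmult lip_dist)
  have zero: "bump R x = 0" if "2 * R \<le> d z x" for x
    using that R by (simp add: bump_def field_simps)
  show one: "bump R x = 1" if "d z x \<le> R" for x
    using that R by (simp add: bump_def field_simps)
  show "bump R \<in> Lip_bs d m" unfolding Lip_bs_iff using K zero by blast
  show "unit_valued (bump R)" by (simp add: unit_valued_def bump_def)
  show "rslope (bump R) x \<le> 1" if x: "x \<in> space m"
    using rslope_le[OF K x] R by (simp add: order_trans[where y="1 / R"])
  show "rslope (bump R) x = 0" if x: "x \<in> space m" "d z x < R"
  proof (rule rslope_local_zero[OF K x(1), of "R - d z x"])
    fix y assume y: "y \<in> space m" "d x y < R - d z x"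
    have "d z y \<le> d z x + d x y" using triangle[OF z x(1) y(1)] .
    then show "bump R y = bump R x" using one[of y] one[of x] x y by simp
  qed (use x in simp)
  show "rslope (bump R) x = 0" if x: "x \<in> space m" "3 * R \<le> d z x"
  proof (rule rslope_local_zero[OF K x(1), of R])
    fix y assume y: "y \<in> space m" "d x y < R"
    have "d z x \<le> d z y + d x y" using triangle[OF z y(1) x(1)] by (simp add: commute)
    then show "bump R y = bump R x" using zero[of y] zero[of x] x y R by simp
  qed (use R in simp)
qed

lemma bump_energy:
  assumes R: "1 \<le> R" and \<theta>: "0 \<le> \<theta>"
    and A: "emeasure m (mball z (3 * R)) \<le> ennreal V" "0 \<le> V"
  shows "(\<integral>x. weight \<theta> x * (rslope (bump R) x)\<^sup>2 \<partial>m) \<le> exp (- (\<theta> * R)) * V"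
proof -
  have "(\<integral>x. weight \<theta> x * (rslope (bump R) x)\<^sup>2 \<partial>m) \<le> (\<integral>x. exp (- (\<theta> * R)) * indicator (mball z (3 * R)) x \<partial>m)"
  proof (rule integral_mono)
    show "integrable m (\<lambda>x. weight \<theta> x * (rslope (bump R) x)\<^sup>2)"
      by (rule weight_sq_integrable[OF \<theta> Lip_bs_rslope_L2[OF bump(1)[OF R]]])
    show "integrable m (\<lambda>x. exp (- (\<theta> * R)) * indicator (mball z (3 * R)) x)"
      using ball_finite[of "3 * R"] by (intro integrable_mult_right integrable_real_indicator) auto
    fix x assume x: "x \<in> space m"
    consider "d z x < R" | "3 * R \<le> d z x" | "R \<le> d z x" "d z x < 3 * R" by linarith
    then show "weight \<theta> x * (rslope (bump R) x)\<^sup>2 \<le> exp (- (\<theta> * R)) * indicator (mball z (3 * R)) x"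
    proof cases
      case 3
      have "weight \<theta> x \<le> exp (- (\<theta> * R))" unfolding weight_def using 3 \<theta> by (simp add: mult_left_mono)
      moreover have "(rslope (bump R) x)\<^sup>2 \<le> 1" using bump(4)[OF R x] by (simp add: power_le_one)
      ultimately have "weight \<theta> x * (rslope (bump R) x)\<^sup>2 \<le> exp (- (\<theta> * R)) * 1" by (intro mult_mono) auto
      then show ?thesis using 3 x z by simp
    qed (simp_all add: bump(5,6)[OF R x])
  qed
  also have "\<dots> = exp (- (\<theta> * R)) * measure m (mball z (3 * R))"
    using ball_finite[of "3 * R"] by simp
  also have "\<dots> \<le> exp (- (\<theta> * R)) * V"
    using A by (intro mult_left_mono) (auto simp: measure_def intro: enn2real_leI)
  finally show ?thesis .
qed

end

context hilbertian_space
begin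

text \<open>
The expansion \<open>cheeger_expand\<close> around \<open>f\<close>, rescaled so that the roles of base point and direction are
exchanged: \<open>v + s f\<close> equals \<open>s (f + v / s)\<close>.
\<close>

lemma cheeger_eigen_expand:
  assumes f: "(\<lambda>x. l * f x) \<in> Ch_subdiff d m f" and v: "v \<in> W12 d m" and s: "s \<noteq> 0"
  shows "cheeger (\<lambda>x. v x + s * f x) = cheeger v + s * l * (\<integral>x. f x * v x \<partial>m) + s\<^sup>2 * cheeger f"
proof -
  have fW: "f \<in> W12 d m" by (rule subdiffD(2)[OF f])
  have iv: "(\<lambda>x. (1 / s) * v x) \<in> W12 d m" by (rule W12_cmult[OF v])
  have "cheeger (\<lambda>x. v x + s * f x) = cheeger (\<lambda>x. s * (f x + (1 / s) * v x))"
    using s by (simp add: algebra_simps)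
  also have "\<dots> = s\<^sup>2 * cheeger (\<lambda>x. f x + (1 / s) * v x)"
    by (rule cheeger_cmult[OF W12_add[OF fW iv] s])
  also have "cheeger (\<lambda>x. f x + (1 / s) * v x) = cheeger f + (\<integral>x. l * f x * ((1 / s) * v x) \<partial>m) + cheeger (\<lambda>x. (1 / s) * v x)"
    by (rule cheeger_expand[OF f iv])
  also have "cheeger (\<lambda>x. (1 / s) * v x) = (1 / s)\<^sup>2 * cheeger v" by (rule cheeger_cmult[OF v]) (use s in simp)
  also have "(\<lambda>x. l * f x * ((1 / s) * v x)) = (\<lambda>x. (l / s) * (f x * v x))" by (simp add: fun_eq_iff)
  also have "s\<^sup>2 * (cheeger f + (\<integral>x. (l / s) * (f x * v x) \<partial>m) + (1 / s)\<^sup>2 * cheeger v)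
    = cheeger v + s * l * (\<integral>x. f x * v x \<partial>m) + s\<^sup>2 * cheeger f"
    using s by (simp add: power2_eq_square field_simps)
  finally show ?thesis .
qed

text \<open>
An exact Euler step satisfies \<open>(l + \<mu>) \<integral> f v = \<mu> \<integral> f u\<close>, by symmetry of the Laplacian. For a near
minimiser, comparison with \<open>v + \<sigma> f\<close> and \<open>v - \<sigma> f\<close> bounds the defect by \<open>\<sigma> C + \<delta> / \<sigma>\<close>, and \<open>\<sigma>\<close>, \<open>\<delta>\<close>
are chosen in this order.
\<close>

lemma near_min_eigen:
  assumes f: "(\<lambda>x. l * f x) \<in> Ch_subdiff d m f" and \<mu>: "0 < \<mu>" and \<kappa>: "0 < \<kappa>"
  obtains \<delta> where "\<delta> > 0" "\<And>u v. u \<in> Lip_bs d m \<Longrightarrow> near_min \<mu> \<delta> u v \<Longrightarrow>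
    \<bar>(l + \<mu>) * (\<integral>x. f x * v x \<partial>m) - \<mu> * (\<integral>x. f x * u x \<partial>m)\<bar> \<le> \<kappa>"
proof -
  have fW: "f \<in> W12 d m" by (rule subdiffD(2)[OF f])
  have fL: "f \<in> L2 m" by (rule W12_L2[OF fW])
  define C where "C = cheeger f + \<mu> / 2 * (\<integral>x. (f x)\<^sup>2 \<partial>m)"
  have C: "0 \<le> C" using \<mu> by (simp add: C_def)
  \<comment> \<open>\<open>C\<close> is the coefficient of \<open>s\<^sup>2\<close> when \<open>v\<close> is perturbed to \<open>v + s f\<close>.\<close>
  define \<sigma> where "\<sigma> = \<kappa> / (2 * (C + 1))"
  have \<sigma>: "\<sigma> > 0" using \<kappa> C by (simp add: \<sigma>_def)
  have \<sigma>C: "\<sigma> * C \<le> \<kappa> / 2" using \<kappa> C by (simp add: \<sigma>_def field_simps)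
  define \<delta> where "\<delta> = \<sigma> * (\<kappa> / 2)"
  have \<delta>: "\<delta> > 0" using \<sigma> \<kappa> by (simp add: \<delta>_def)
  have "\<bar>(l + \<mu>) * (\<integral>x. f x * v x \<partial>m) - \<mu> * (\<integral>x. f x * u x \<partial>m)\<bar> \<le> \<kappa>"
    if u: "u \<in> Lip_bs d m" and v: "near_min \<mu> \<delta> u v" for u v
  proof -
    have vB: "v \<in> Lip_bs d m" using v by (simp add: near_min_def)
    have vW: "v \<in> W12 d m" by (rule Lip_bs_W12(1)[OF vB])
    have vu: "(\<lambda>x. v x - u x) \<in> L2 m" by (intro L2_diff Lip_bs_L2 vB u)
    define X where "X = l * (\<integral>x. f x * v x \<partial>m) + \<mu> * (\<integral>x. f x * (v x - u x) \<partial>m)"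
    have key: "0 \<le> s * X + s\<^sup>2 * C + \<delta>" if s: "s \<noteq> 0" for s
    proof -
      have g: "(\<lambda>x. v x + s * f x) \<in> W12 d m" by (intro W12_add W12_cmult fW vW)
      have "(\<integral>x. (v x + s * f x - u x)\<^sup>2 \<partial>m) =
        (\<integral>x. (v x - u x)\<^sup>2 + (2 * s * (f x * (v x - u x)) + s\<^sup>2 * (f x)\<^sup>2) \<partial>m)"
        by (intro Bochner_Integration.integral_cong refl) (simp add: power2_eq_square algebra_simps)
      also have "\<dots> = (\<integral>x. (v x - u x)\<^sup>2 \<partial>m) + (2 * s * (\<integral>x. f x * (v x - u x) \<partial>m) + s\<^sup>2 * (\<integral>x. (f x)\<^sup>2 \<partial>m))"
        using vu fL L2_mult_integrable[OF fL vu] by (simp add: L2_integrable_sq)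
      finally have "penalty \<mu> u v \<le> (cheeger v + s * l * (\<integral>x. f x * v x \<partial>m) + s\<^sup>2 * cheeger f) +
         \<mu> / 2 * ((\<integral>x. (v x - u x)\<^sup>2 \<partial>m) + (2 * s * (\<integral>x. f x * (v x - u x) \<partial>m) + s\<^sup>2 * (\<integral>x. (f x)\<^sup>2 \<partial>m))) + \<delta>"
        using near_min_W12[OF v u \<mu> g] cheeger_eigen_expand[OF f vW s] by simp
      moreover have "cheeger v \<le> energy v / 2" by (rule Lip_bs_W12(2)[OF vB])
      ultimately show ?thesis unfolding penalty_def X_def C_def by (simp add: algebra_simps)
    qed
    have "\<bar>X\<bar> \<le> \<kappa>"
    proof -
      have "\<sigma> * \<bar>X\<bar> \<le> \<sigma>\<^sup>2 * C + \<delta>" using key[of \<sigma>] key[of "- \<sigma>"] \<sigma> by (simp add: abs_if)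
      also have "\<dots> = \<sigma> * (\<sigma> * C + \<kappa> / 2)" by (simp add: \<delta>_def power2_eq_square algebra_simps)
      also have "\<dots> \<le> \<sigma> * \<kappa>" using \<sigma>C \<sigma> by (intro mult_left_mono) auto
      finally show ?thesis using \<sigma> by simp
    qed
    moreover have "(\<integral>x. f x * (v x - u x) \<partial>m) = (\<integral>x. f x * v x \<partial>m) - (\<integral>x. f x * u x \<partial>m)"
      using L2_mult_integrable[OF fL Lip_bs_L2[OF vB]] L2_mult_integrable[OF fL Lip_bs_L2[OF u]]
      by (simp add: right_diff_distrib)
    moreover have "l * a + \<mu> * (a - b) = (l + \<mu>) * a - \<mu> * b" for a b :: real
      by (simp add: algebra_simps)
    ultimately show ?thesis unfolding X_def by simp
  qed
  then show thesis using \<delta> that by blast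
qed

text \<open>
After \<open>n\<close> steps the weighted distance from \<open>\<eta>\<close> obeys a discrete Gronwall inequality with factor
\<open>1 / (1 - \<gamma>)\<close>, \<open>\<gamma> = \<epsilon> + 2 \<theta>\<^sup>2 / \<mu>\<close>, and source term \<open>\<beta>\<close>, whereas the pairing with \<open>f\<close> contracts by the
factor \<open>\<mu> / (\<mu> + l)\<close> in every step. The tolerance of each near minimisation is absorbed by the
strict inequality assumed of \<open>\<beta>\<close> and by \<open>\<kappa>\<close>.
\<close>

lemma euler_scheme:
  assumes f: "(\<lambda>x. l * f x) \<in> Ch_subdiff d m f" and l: "0 \<le> l" and \<eta>: "\<eta> \<in> Lip_bs d m" "unit_valued \<eta>"
    and \<mu>: "0 < \<mu>" and \<epsilon>: "0 < \<epsilon>" "\<epsilon> \<le> 1" and \<theta>: "0 \<le> \<theta>" and \<gamma>: "\<epsilon> + 2 * \<theta>\<^sup>2 / \<mu> < 1"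
    and \<beta>: "2 / \<mu> * (\<integral>x. weight \<theta> x * (rslope \<eta> x)\<^sup>2 \<partial>m) < \<beta>" and \<kappa>: "0 < \<kappa>"
  shows "\<exists>v. v \<in> Lip_bs d m \<and> unit_valued v \<and>
     deviation \<theta> \<eta> v \<le> real n * \<beta> * (1 / (1 - (\<epsilon> + 2 * \<theta>\<^sup>2 / \<mu>))) ^ n \<and>
     \<bar>\<integral>x. f x * v x \<partial>m\<bar> \<le> (\<mu> / (\<mu> + l)) ^ n * \<bar>\<integral>x. f x * \<eta> x \<partial>m\<bar> + real n * \<kappa>"
proof (induction n)
  case 0
  show ?case by (rule exI[of _ \<eta>]) (use \<eta> in \<open>simp add: deviation_def\<close>)
next
  case (Suc n)
  define G where "G = 1 / (1 - (\<epsilon> + 2 * \<theta>\<^sup>2 / \<mu>))"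
  have G0: "0 \<le> \<epsilon> + 2 * \<theta>\<^sup>2 / \<mu>" using \<epsilon> \<mu> by simp
  have G1: "1 \<le> G" using \<gamma> G0 by (simp add: G_def)
  define E where "E = (\<integral>x. weight \<theta> x * (rslope \<eta> x)\<^sup>2 \<partial>m)"
  have E0: "0 \<le> E" unfolding E_def by (intro integral_nonneg_AE AE_I2) (simp add: weight_bounds(1) less_imp_le)
  have \<beta>0: "0 \<le> \<beta>" using \<beta> E0 \<mu> unfolding E_def[symmetric]
    by (smt (verit) divide_nonneg_pos mult_nonneg_nonneg)
  obtain u where u: "u \<in> Lip_bs d m" "unit_valued u" "deviation \<theta> \<eta> u \<le> real n * \<beta> * G ^ n"
    "\<bar>\<integral>x. f x * u x \<partial>m\<bar> \<le> (\<mu> / (\<mu> + l)) ^ n * \<bar>\<integral>x. f x * \<eta> x \<partial>m\<bar> + real n * \<kappa>"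
    using Suc.IH unfolding G_def by blast
  have \<kappa>l: "0 < (\<mu> + l) * \<kappa>" using \<kappa> \<mu> l by simp
  obtain \<delta>1 where \<delta>1: "\<delta>1 > 0" "\<And>u v. u \<in> Lip_bs d m \<Longrightarrow> near_min \<mu> \<delta>1 u v \<Longrightarrow>
    \<bar>(l + \<mu>) * (\<integral>x. f x * v x \<partial>m) - \<mu> * (\<integral>x. f x * u x \<partial>m)\<bar> \<le> (\<mu> + l) * \<kappa>"
    using near_min_eigen[OF f \<mu> \<kappa>l] by metis
  define \<delta> where "\<delta> = min \<delta>1 (\<epsilon> * (\<mu> / 2 * \<beta> - E))"
  have pos: "\<mu> / 2 * \<beta> - E > 0" using \<beta> \<mu> unfolding E_def[symmetric] by (simp add: field_simps)
  have \<delta>: "\<delta> > 0" using \<delta>1 \<epsilon> pos by (simp add: \<delta>_def)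
  have "\<delta> / \<epsilon> \<le> (\<epsilon> * (\<mu> / 2 * \<beta> - E)) / \<epsilon>" using \<epsilon> by (intro divide_right_mono) (auto simp: \<delta>_def)
  then have \<delta>\<epsilon>: "\<delta> / \<epsilon> \<le> \<mu> / 2 * \<beta> - E" using \<epsilon> by simp
  obtain v where v: "near_min \<mu> \<delta> u v" "unit_valued v" using near_min_ex[OF u(1,2) \<mu> \<delta>] by metis
  have vB: "v \<in> Lip_bs d m" using v(1) by (simp add: near_min_def)
  have "deviation \<theta> \<eta> v \<le> G * (deviation \<theta> \<eta> u + \<beta>)"
  proof -
    have "\<mu> / 2 * (deviation \<theta> \<eta> v - deviation \<theta> \<eta> u) \<le> E + (\<theta>\<^sup>2 + \<mu> * \<epsilon> / 2) * deviation \<theta> \<eta> v + \<delta> / \<epsilon>"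
      unfolding E_def by (rule near_min_deviation[OF v(1) u(1) \<eta>(1) \<mu> \<epsilon> \<theta>])
    also have "\<dots> \<le> (\<theta>\<^sup>2 + \<mu> * \<epsilon> / 2) * deviation \<theta> \<eta> v + \<mu> / 2 * \<beta>" using \<delta>\<epsilon> by linarith
    finally have "(\<mu> / 2) * (deviation \<theta> \<eta> v * (1 - (\<epsilon> + 2 * \<theta>\<^sup>2 / \<mu>))) \<le> (\<mu> / 2) * (deviation \<theta> \<eta> u + \<beta>)"
    proof -
      have "(\<mu> / 2) * (a * (1 - (\<epsilon> + 2 * \<theta>\<^sup>2 / \<mu>))) = \<mu> / 2 * a - (\<theta>\<^sup>2 + \<mu> * \<epsilon> / 2) * a" for a
        using \<mu> by (simp add: field_simps)
      then show "\<mu> / 2 * (deviation \<theta> \<eta> v - deviation \<theta> \<eta> u) \<le> (\<theta>\<^sup>2 + \<mu> * \<epsilon> / 2) * deviation \<theta> \<eta> v + \<mu> / 2 * \<beta> \<Longrightarrow> ?thesis"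
        unfolding distrib_left right_diff_distrib[of "\<mu> / 2" "deviation \<theta> \<eta> v" "deviation \<theta> \<eta> u"] by (smt (verit))
    qed
    then have "deviation \<theta> \<eta> v * (1 - (\<epsilon> + 2 * \<theta>\<^sup>2 / \<mu>)) \<le> deviation \<theta> \<eta> u + \<beta>"
      using \<mu> by (simp del: mult_le_cancel_left1)
    then show ?thesis using \<gamma> by (simp add: G_def pos_le_divide_eq)
  qed
  also have "\<dots> \<le> G * (real n * \<beta> * G ^ n + \<beta> * G ^ n)"
    using u(3) G1 \<beta>0 by (intro mult_left_mono add_mono) (auto intro!: mult_le_cancel_left1[THEN iffD2] one_le_power)
  also have "\<dots> = real (Suc n) * \<beta> * G ^ Suc n" by (simp add: algebra_simps)
  finally have dv: "deviation \<theta> \<eta> v \<le> real (Suc n) * \<beta> * G ^ Suc n" .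
  define \<rho> where "\<rho> = \<mu> / (\<mu> + l)"
  have \<rho>: "0 \<le> \<rho>" "\<rho> \<le> 1" using \<mu> l by (auto simp: \<rho>_def)
  have "\<bar>(l + \<mu>) * (\<integral>x. f x * v x \<partial>m) - \<mu> * (\<integral>x. f x * u x \<partial>m)\<bar> \<le> (\<mu> + l) * \<kappa>"
    by (rule \<delta>1(2)[OF u(1) near_min_mono[OF v(1)]]) (simp add: \<delta>_def)
  then have "(\<mu> + l) * \<bar>\<integral>x. f x * v x \<partial>m\<bar> \<le> \<mu> * \<bar>\<integral>x. f x * u x \<partial>m\<bar> + (\<mu> + l) * \<kappa>"
  proof -
    have "(\<mu> + l) * \<bar>a\<bar> \<le> \<mu> * \<bar>b\<bar> + (\<mu> + l) * \<kappa>" if "\<bar>(l + \<mu>) * a - \<mu> * b\<bar> \<le> (\<mu> + l) * \<kappa>" for a b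
    proof -
      have "(\<mu> + l) * \<bar>a\<bar> = \<bar>(l + \<mu>) * a\<bar>" "\<mu> * \<bar>b\<bar> = \<bar>\<mu> * b\<bar>"
        using \<mu> l by (auto simp: abs_mult add.commute)
      then show ?thesis using that by linarith
    qed
    then show "\<bar>(l + \<mu>) * (\<integral>x. f x * v x \<partial>m) - \<mu> * (\<integral>x. f x * u x \<partial>m)\<bar> \<le> (\<mu> + l) * \<kappa> \<Longrightarrow> ?thesis" by blast
  qed
  then have "\<bar>\<integral>x. f x * v x \<partial>m\<bar> \<le> \<rho> * \<bar>\<integral>x. f x * u x \<partial>m\<bar> + \<kappa>"
    using \<mu> l by (simp add: \<rho>_def field_simps)
  also have "\<dots> \<le> \<rho> * (\<rho> ^ n * \<bar>\<integral>x. f x * \<eta> x \<partial>m\<bar> + real n * \<kappa>) + \<kappa>"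
    using u(4) \<rho> unfolding \<rho>_def[symmetric] by (intro add_right_mono mult_left_mono) auto
  also have "\<dots> \<le> \<rho> ^ Suc n * \<bar>\<integral>x. f x * \<eta> x \<partial>m\<bar> + real (Suc n) * \<kappa>"
  proof -
    have "\<rho> * (real n * \<kappa>) \<le> real n * \<kappa>" using \<rho> \<kappa> by (intro mult_left_le_one_le) auto
    then show ?thesis by (simp add: algebra_simps)
  qed
  finally show ?case using vB v(2) dv unfolding G_def \<rho>_def by blast
qed

text \<open>
The scheme runs with \<open>n\<close> steps of size \<open>\<tau> / n\<close> and the weight parameter \<open>\<theta> = 40 B R\<close>. The constants
are chosen such that the exponents add up: volume of the ball of radius \<open>3 R\<close> contributes \<open>9 B R\<^sup>2\<close>, the
weight on the support of the slope \<open>- 40 B R\<^sup>2\<close>, the Gronwall factor \<open>4 \<theta>\<^sup>2 \<tau> = B R\<^sup>2\<close>, and undoing the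
weight on the ball of radius \<open>R / 2\<close> costs \<open>20 B R\<^sup>2\<close>. The sum \<open>- 10 B R\<^sup>2\<close> is negative, so on this ball
the scheme has hardly moved.
\<close>

lemma one_scale:
  assumes f: "(\<lambda>x. l * f x) \<in> Ch_subdiff d m f" and l: "0 < l" and f1: "integrable m f"
    and A: "A > 0" and B: "B > 0" and vol: "\<And>r. r > 0 \<Longrightarrow> emeasure m (mball z r) \<le> ennreal (A * exp (B * r\<^sup>2))"
    and R: "1 \<le> R"
  defines "\<tau> \<equiv> 1 / (6400 * B)"
  shows "\<bar>\<integral>x. f x * bump R x \<partial>m\<bar> \<le> 1 / (1 + l * \<tau>) * \<bar>\<integral>x. f x * bump R x \<partial>m\<bar> + 1 / R
     + L2_norm m f * sqrt (4 * \<tau> * A * exp 2 * exp (- (10 * B * R\<^sup>2)))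
     + (\<integral>x. indicator {x \<in> space m. R / 2 \<le> d z x} x * \<bar>f x\<bar> \<partial>m)"
proof -
  let ?\<eta> = "bump R"
  note \<eta> = bump(1,2)[OF R]
  have \<tau>: "\<tau> > 0" using B by (simp add: \<tau>_def)
  define \<theta> where "\<theta> = 40 * B * R"
  have \<theta>: "0 \<le> \<theta>" using B R by (simp add: \<theta>_def)
  have \<theta>\<tau>: "4 * \<theta>\<^sup>2 * \<tau> = B * R\<^sup>2"
  proof -
    have "4 * \<theta>\<^sup>2 * \<tau> = (6400 * B * \<tau>) * (B * R\<^sup>2)" by (simp add: \<theta>_def power2_eq_square)
    moreover have "6400 * B * \<tau> = 1" using B by (simp add: \<tau>_def)
    ultimately show ?thesis by simp
  qed
  define V where "V = A * exp (9 * B * R\<^sup>2)"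
  have V: "V > 0" using A by (simp add: V_def)
  define E' where "E' = exp (- (\<theta> * R)) * V"
  have E': "E' > 0" using V by (simp add: E'_def)
  have "emeasure m (mball z (3 * R)) \<le> ennreal V"
    using vol[of "3 * R"] R by (simp add: V_def power2_eq_square algebra_simps)
  then have E: "(\<integral>x. weight \<theta> x * (rslope ?\<eta> x)\<^sup>2 \<partial>m) \<le> E'"
    unfolding E'_def using V by (intro bump_energy[OF R \<theta>]) auto
  \<comment> \<open>So many steps that \<open>\<gamma> \<le> 1 / 2\<close>, which keeps the Gronwall factor exponential in \<open>n \<gamma>\<close>.\<close>
  obtain n0 :: nat where n0: "2 * (1 + 2 * \<theta>\<^sup>2 * \<tau>) \<le> real n0" using real_arch_simple by blast
  define n where "n = Suc n0"
  have n: "2 * (1 + 2 * \<theta>\<^sup>2 * \<tau>) \<le> real n" "0 < real n" using n0 by (auto simp: n_def)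
  define \<mu> where "\<mu> = real n / \<tau>"
  have \<mu>: "\<mu> > 0" using n \<tau> by (simp add: \<mu>_def)
  define \<epsilon> where "\<epsilon> = 1 / real n"
  have "0 \<le> \<theta>\<^sup>2 * \<tau>" using \<tau> by simp
  then have \<epsilon>: "0 < \<epsilon>" "\<epsilon> \<le> 1" using n unfolding \<epsilon>_def by auto
  define \<gamma> where "\<gamma> = \<epsilon> + 2 * \<theta>\<^sup>2 / \<mu>"
  have n\<gamma>: "real n * \<gamma> = 1 + 2 * \<theta>\<^sup>2 * \<tau>" using n \<tau> by (simp add: \<gamma>_def \<epsilon>_def \<mu>_def field_simps)
  then have "real n * \<gamma> \<le> real n * (1 / 2)" using n(1) by simp
  then have \<gamma>: "\<gamma> \<le> 1 / 2" using n(2) by (simp only: mult_le_cancel_left_pos)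
  have \<gamma>0: "0 \<le> \<gamma>" using \<epsilon> \<mu> by (simp add: \<gamma>_def)
  define \<beta> where "\<beta> = 4 / \<mu> * E'"
  have "2 / \<mu> * (\<integral>x. weight \<theta> x * (rslope ?\<eta> x)\<^sup>2 \<partial>m) \<le> 2 / \<mu> * E'" using E \<mu> by (intro mult_left_mono) auto
  also have "\<dots> < \<beta>" using \<mu> E' by (simp add: \<beta>_def field_simps)
  finally have \<beta>: "2 / \<mu> * (\<integral>x. weight \<theta> x * (rslope ?\<eta> x)\<^sup>2 \<partial>m) < \<beta>" .
  define \<kappa> where "\<kappa> = 1 / (real n * R)"
  have \<kappa>: "\<kappa> > 0" using n R by (simp add: \<kappa>_def)
  have \<gamma>1: "\<epsilon> + 2 * \<theta>\<^sup>2 / \<mu> < 1" using \<gamma> unfolding \<gamma>_def by linarith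
  obtain v where v: "v \<in> Lip_bs d m" "unit_valued v"
     "deviation \<theta> ?\<eta> v \<le> real n * \<beta> * (1 / (1 - \<gamma>)) ^ n"
     "\<bar>\<integral>x. f x * v x \<partial>m\<bar> \<le> (\<mu> / (\<mu> + l)) ^ n * \<bar>\<integral>x. f x * ?\<eta> x \<partial>m\<bar> + real n * \<kappa>"
    using euler_scheme[OF f less_imp_le[OF l] \<eta> \<mu> \<epsilon> \<theta> \<gamma>1 \<beta> \<kappa>, of n] unfolding \<gamma>_def[symmetric] by blast
  have n\<beta>: "real n * \<beta> = 4 * \<tau> * E'" using n \<tau> by (simp add: \<beta>_def \<mu>_def)
  have "deviation \<theta> ?\<eta> v \<le> 4 * \<tau> * E' * exp (2 * (real n * \<gamma>))"
    using v(3) inverse_power_le_exp[OF \<gamma>0 \<gamma>, of n] \<tau> E' unfolding n\<beta>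
    by (elim order_trans) (intro mult_left_mono, auto)
  also have "\<dots> = 4 * \<tau> * A * exp 2 * exp (- (30 * B * R\<^sup>2))"
  proof -
    have "E' * exp (2 * (real n * \<gamma>)) = A * (exp (- (\<theta> * R)) * exp (9 * B * R\<^sup>2) * exp (2 + 4 * \<theta>\<^sup>2 * \<tau>))"
      unfolding n\<gamma> E'_def V_def by (simp add: algebra_simps)
    also have "exp (- (\<theta> * R)) * exp (9 * B * R\<^sup>2) * exp (2 + 4 * \<theta>\<^sup>2 * \<tau>) = exp 2 * exp (- (30 * B * R\<^sup>2))"
      unfolding \<theta>\<tau> unfolding \<theta>_def by (simp add: power2_eq_square flip: exp_add)
    finally show ?thesis by simp
  qed
  finally have dv: "deviation \<theta> ?\<eta> v \<le> 4 * \<tau> * A * exp 2 * exp (- (30 * B * R\<^sup>2))" .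
  \<comment> \<open>Off \<open>S\<close> the weighted bound on \<open>v - \<eta>\<close> is effective; on \<open>S\<close> only \<open>|v - \<eta>| \<le> 1\<close> is used, and \<open>S\<close> moves
    off to infinity with \<open>R\<close>.\<close>
  define S where "S = {x \<in> space m. R / 2 \<le> d z x}"
  have S [measurable]: "S \<in> sets m" unfolding S_def by measurable
  define w where "w x = indicator (space m - S) x * (v x - ?\<eta> x)" for x
  have vd: "(\<lambda>x. v x - ?\<eta> x) \<in> L2 m" by (intro L2_diff Lip_bs_L2 v \<eta>)
  have wm: "w \<in> borel_measurable m" unfolding w_def using vd by measurable
  have iw: "integrable m (\<lambda>x. (w x)\<^sup>2)"
  proof (rule Bochner_Integration.integrable_bound[OF L2_integrable_sq[OF vd]])
    show "(\<lambda>x. (w x)\<^sup>2) \<in> borel_measurable m" using wm by measurable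
    show "AE x in m. norm ((w x)\<^sup>2) \<le> norm ((v x - ?\<eta> x)\<^sup>2)"
      by (intro AE_I2) (auto simp: w_def indicator_def)
  qed
  then have wL: "w \<in> L2 m" using wm by (simp add: L2_def)
  have "(\<integral>x. (w x)\<^sup>2 \<partial>m) \<le> (\<integral>x. exp (20 * B * R\<^sup>2) * (weight \<theta> x * (v x - ?\<eta> x)\<^sup>2) \<partial>m)"
  proof (rule integral_mono[OF iw])
    show "integrable m (\<lambda>x. exp (20 * B * R\<^sup>2) * (weight \<theta> x * (v x - ?\<eta> x)\<^sup>2))"
      by (intro integrable_mult_right weight_sq_integrable[OF \<theta> vd])
    fix x assume x: "x \<in> space m"
    show "(w x)\<^sup>2 \<le> exp (20 * B * R\<^sup>2) * (weight \<theta> x * (v x - ?\<eta> x)\<^sup>2)"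
    proof (cases "x \<in> S")
      case True
      then show ?thesis using weight_bounds(1)[of \<theta> x] by (simp add: w_def)
    next
      case False
      then have dx: "d z x \<le> R / 2" using x by (simp add: S_def)
      have "\<theta> * d z x \<le> \<theta> * (R / 2)" using dx \<theta> by (rule mult_left_mono)
      also have "\<dots> = 20 * B * R\<^sup>2" by (simp add: \<theta>_def power2_eq_square)
      finally have "1 \<le> exp (20 * B * R\<^sup>2) * weight \<theta> x" by (simp add: weight_def flip: exp_add)
      then have "1 * (v x - ?\<eta> x)\<^sup>2 \<le> (exp (20 * B * R\<^sup>2) * weight \<theta> x) * (v x - ?\<eta> x)\<^sup>2"
        by (rule mult_right_mono) simp
      then show ?thesis using False x by (simp add: w_def mult.assoc)
    qed
  qed
  also have "\<dots> = exp (20 * B * R\<^sup>2) * deviation \<theta> ?\<eta> v" by (simp add: deviation_def)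
  also have "\<dots> \<le> exp (20 * B * R\<^sup>2) * (4 * \<tau> * A * exp 2 * exp (- (30 * B * R\<^sup>2)))"
    using dv by (rule mult_left_mono) simp
  also have "\<dots> = 4 * \<tau> * A * exp 2 * (exp (20 * B * R\<^sup>2) * exp (- (30 * B * R\<^sup>2)))" by simp
  also have "exp (20 * B * R\<^sup>2) * exp (- (30 * B * R\<^sup>2)) = exp (- (10 * B * R\<^sup>2))" by (simp flip: exp_add)
  finally have "L2_norm m w \<le> sqrt (4 * \<tau> * A * exp 2 * exp (- (10 * B * R\<^sup>2)))"
    unfolding L2_norm_def by (rule real_sqrt_le_mono)
  then have inner: "\<bar>\<integral>x. f x * w x \<partial>m\<bar> \<le> L2_norm m f * sqrt (4 * \<tau> * A * exp 2 * exp (- (10 * B * R\<^sup>2)))"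
    using L2_cauchy_schwarz[OF W12_L2[OF subdiffD(2)[OF f]] wL] by (meson L2_norm_nonneg mult_left_mono order_trans)
  have fL: "f \<in> L2 m" by (rule W12_L2[OF subdiffD(2)[OF f]])
  define T where "T = (\<integral>x. indicator S x * \<bar>f x\<bar> \<partial>m)"
  have iS: "integrable m (\<lambda>x. indicator S x * \<bar>f x\<bar>)"
    using integrable_mult_indicator[OF S integrable_abs[OF f1]] by simp
  have ifw: "integrable m (\<lambda>x. f x * w x)" by (rule L2_mult_integrable[OF fL wL])
  have ifv: "integrable m (\<lambda>x. f x * v x)" "integrable m (\<lambda>x. f x * ?\<eta> x)"
    using L2_mult_integrable[OF fL Lip_bs_L2] v(1) \<eta>(1) by auto
  have iSv: "integrable m (\<lambda>x. indicator S x * (f x * (v x - ?\<eta> x)))"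
    using integrable_mult_indicator[OF S L2_mult_integrable[OF fL vd]] by simp
  have outer: "\<bar>\<integral>x. indicator S x * (f x * (v x - ?\<eta> x)) \<partial>m\<bar> \<le> T"
  proof -
    have "\<bar>\<integral>x. indicator S x * (f x * (v x - ?\<eta> x)) \<partial>m\<bar> \<le> (\<integral>x. \<bar>indicator S x * (f x * (v x - ?\<eta> x))\<bar> \<partial>m)"
      by (rule integral_abs_bound)
    also have "\<dots> \<le> T" unfolding T_def
    proof (rule integral_mono[OF integrable_abs[OF iSv] iS])
      fix x assume x: "x \<in> space m"
      have "\<bar>v x - ?\<eta> x\<bar> \<le> 1" using v(2) \<eta>(2) x by (force simp: unit_valued_def abs_le_iff)
      then have "\<bar>f x\<bar> * \<bar>v x - ?\<eta> x\<bar> \<le> \<bar>f x\<bar>" by (rule mult_left_le) simp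
      then show "\<bar>indicator S x * (f x * (v x - ?\<eta> x))\<bar> \<le> indicator S x * \<bar>f x\<bar>"
        by (simp add: abs_mult indicator_def)
    qed
    finally show ?thesis .
  qed
  have "(\<integral>x. f x * v x \<partial>m) - (\<integral>x. f x * ?\<eta> x \<partial>m) = (\<integral>x. f x * v x - f x * ?\<eta> x \<partial>m)"
    using ifv by simp
  also have "\<dots> = (\<integral>x. f x * w x + indicator S x * (f x * (v x - ?\<eta> x)) \<partial>m)"
    by (intro Bochner_Integration.integral_cong refl) (auto simp: w_def indicator_def algebra_simps)
  also have "\<dots> = (\<integral>x. f x * w x \<partial>m) + (\<integral>x. indicator S x * (f x * (v x - ?\<eta> x)) \<partial>m)"
    using ifw iSv by simp
  finally have "\<bar>\<integral>x. f x * ?\<eta> x \<partial>m\<bar> \<le> \<bar>\<integral>x. f x * v x \<partial>m\<bar> + \<bar>\<integral>x. f x * w x \<partial>m\<bar> + \<bar>\<integral>x. indicator S x * (f x * (v x - ?\<eta> x)) \<partial>m\<bar>"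
    by linarith
  moreover have "real n * \<kappa> = 1 / R" using n by (simp add: \<kappa>_def)
  moreover have "(\<mu> / (\<mu> + l)) ^ n * \<bar>\<integral>x. f x * ?\<eta> x \<partial>m\<bar> \<le> 1 / (1 + l * \<tau>) * \<bar>\<integral>x. f x * ?\<eta> x \<partial>m\<bar>"
  proof (rule mult_right_mono)
    have "1 + l * \<tau> = 1 + real n * (l / \<mu>)" using n \<tau> by (simp add: \<mu>_def)
    also have "\<dots> \<le> (1 + l / \<mu>) ^ n" using l \<mu> by (intro Bernoulli_inequality) (simp add: order_trans[of _ 0])
    finally have "1 / (1 + l / \<mu>) ^ n \<le> 1 / (1 + l * \<tau>)"
      using l \<tau> \<mu> by (intro divide_left_mono mult_pos_pos zero_less_power) (auto intro: add_pos_pos)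
    moreover have "\<mu> / (\<mu> + l) = 1 / (1 + l / \<mu>)" using \<mu> l by (simp add: field_simps)
    ultimately show "(\<mu> / (\<mu> + l)) ^ n \<le> 1 / (1 + l * \<tau>)" by (simp add: power_divide)
  qed simp
  ultimately show ?thesis using v(4) inner outer unfolding T_def S_def by linarith
qed

text \<open>
Let \<open>R\<close> tend to infinity in \<open>one_scale\<close>; the factor in front of \<open>|\<integral> f|\<close> on the right is less than one
and does not depend on \<open>R\<close>.
\<close>

lemma eigenfunction_mean_zero:
  assumes f: "(\<lambda>x. l * f x) \<in> Ch_subdiff d m f" and l: "0 < l" and f1: "integrable m f"
    and A: "A > 0" and B: "B > 0" and vol: "\<And>r. r > 0 \<Longrightarrow> emeasure m (mball z r) \<le> ennreal (A * exp (B * r\<^sup>2))"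
  shows "(\<integral>x. f x \<partial>m) = 0"
proof -
  define \<tau> where "\<tau> = 1 / (6400 * B)"
  define \<rho> where "\<rho> = 1 / (1 + l * \<tau>)"
  have \<tau>: "\<tau> > 0" using B by (simp add: \<tau>_def)
  have "0 < l * \<tau>" using l \<tau> by simp
  then have \<rho>: "\<rho> < 1" by (simp add: \<rho>_def)
  define R where "R k = real (Suc k)" for k :: nat
  have R: "1 \<le> R k" for k by (simp add: R_def)
  have Rt: "filterlim R at_top sequentially" unfolding R_def
    by (rule filterlim_compose[OF filterlim_real_sequentially filterlim_Suc])
  note [measurable] = borel_measurable_integrable[OF f1]
  have bl: "(\<lambda>k. \<integral>x. f x * bump (R k) x \<partial>m) \<longlonglongrightarrow> (\<integral>x. f x \<partial>m)"
  proof (rule integral_dominated_convergence[where w="\<lambda>x. \<bar>f x\<bar>"])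
    show "AE x in m. (\<lambda>k. f x * bump (R k) x) \<longlonglongrightarrow> f x"
    proof (rule AE_I2)
      fix x
      have "eventually (\<lambda>k. d z x \<le> R k) sequentially" using Rt by (simp add: filterlim_at_top)
      then have "eventually (\<lambda>k. f x * bump (R k) x = f x) sequentially"
        by (rule eventually_mono) (simp add: bump(3)[OF R])
      then show "(\<lambda>k. f x * bump (R k) x) \<longlonglongrightarrow> f x" by (rule tendsto_eventually)
    qed
    show "AE x in m. norm (f x * bump (R k) x) \<le> \<bar>f x\<bar>" for k
      by (intro AE_I2) (auto simp: abs_mult bump_def intro!: mult_left_le)
    show "(\<lambda>x. f x * bump (R k) x) \<in> borel_measurable m" for k
      using Lip_bs_measurable[OF bump(1)[OF R]] by measurable
  qed (use f1 in auto)
  have Tl: "(\<lambda>k. \<integral>x. indicator {x \<in> space m. R k / 2 \<le> d z x} x * \<bar>f x\<bar> \<partial>m) \<longlonglongrightarrow> (\<integral>x. 0 \<partial>m)"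
  proof (rule integral_dominated_convergence[where w="\<lambda>x. \<bar>f x\<bar>"])
    show "AE x in m. (\<lambda>k. indicator {x \<in> space m. R k / 2 \<le> d z x} x * \<bar>f x\<bar>) \<longlonglongrightarrow> 0"
    proof (rule AE_I2)
      fix x
      have "eventually (\<lambda>k. 2 * d z x + 1 \<le> R k) sequentially" using Rt by (simp add: filterlim_at_top)
      then have "eventually (\<lambda>k. indicator {x \<in> space m. R k / 2 \<le> d z x} x * \<bar>f x\<bar> = 0) sequentially"
        by (rule eventually_mono) (auto simp: indicator_def)
      then show "(\<lambda>k. indicator {x \<in> space m. R k / 2 \<le> d z x} x * \<bar>f x\<bar>) \<longlonglongrightarrow> 0" by (rule tendsto_eventually)
    qed
    show "AE x in m. norm (indicator {x \<in> space m. R k / 2 \<le> d z x} x * \<bar>f x\<bar>) \<le> \<bar>f x\<bar>" for k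
      by (intro AE_I2) (auto simp: indicator_def)
  qed (use f1 in auto)
  have Rl: "(\<lambda>k. 1 / R k) \<longlonglongrightarrow> 0"
    unfolding R_def using LIMSEQ_inverse_real_of_nat by (simp add: inverse_eq_divide)
  have el: "(\<lambda>k. exp (- (10 * B * (R k)\<^sup>2))) \<longlonglongrightarrow> 0"
  proof (rule tendsto_sandwich[OF _ _ tendsto_const])
    show "eventually (\<lambda>k. exp (- (10 * B * (R k)\<^sup>2)) \<le> 1 / (10 * B) * (1 / R k)) sequentially"
    proof (intro always_eventually allI)
      fix k
      have "10 * B * R k \<le> 10 * B * (R k)\<^sup>2" using R[of k] B by (intro mult_left_mono) (auto simp: power2_eq_square)
      also have "\<dots> \<le> exp (10 * B * (R k)\<^sup>2)" using exp_ge_add_one_self[of "10 * B * (R k)\<^sup>2"] by linarith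
      finally have "1 / exp (10 * B * (R k)\<^sup>2) \<le> 1 / (10 * B * R k)"
        using B R[of k] by (intro divide_left_mono) auto
      then show "exp (- (10 * B * (R k)\<^sup>2)) \<le> 1 / (10 * B) * (1 / R k)"
        by (simp add: exp_minus inverse_eq_divide)
    qed
    show "(\<lambda>k. 1 / (10 * B) * (1 / R k)) \<longlonglongrightarrow> 0" using tendsto_mult_right[OF Rl, of "1 / (10 * B)"] by (simp add: ac_simps)
  qed simp
  have rhs: "(\<lambda>k. \<rho> * \<bar>\<integral>x. f x * bump (R k) x \<partial>m\<bar> + 1 / R k
     + L2_norm m f * sqrt (4 * \<tau> * A * exp 2 * exp (- (10 * B * (R k)\<^sup>2)))
     + (\<integral>x. indicator {x \<in> space m. R k / 2 \<le> d z x} x * \<bar>f x\<bar> \<partial>m)) \<longlonglongrightarrow>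
     \<rho> * \<bar>\<integral>x. f x \<partial>m\<bar> + 0 + L2_norm m f * sqrt (4 * \<tau> * A * exp 2 * 0) + (\<integral>x. 0 \<partial>m)"
    by (intro tendsto_intros bl Rl el Tl)
  have "\<bar>\<integral>x. f x \<partial>m\<bar> \<le> \<rho> * \<bar>\<integral>x. f x \<partial>m\<bar> + 0 + L2_norm m f * sqrt (4 * \<tau> * A * exp 2 * 0) + (\<integral>x. 0 \<partial>m)"
  proof (rule LIMSEQ_le[OF tendsto_rabs[OF bl] rhs], intro exI allI impI)
    fix k
    show "\<bar>\<integral>x. f x * bump (R k) x \<partial>m\<bar> \<le> \<rho> * \<bar>\<integral>x. f x * bump (R k) x \<partial>m\<bar> + 1 / R k
     + L2_norm m f * sqrt (4 * \<tau> * A * exp 2 * exp (- (10 * B * (R k)\<^sup>2)))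
     + (\<integral>x. indicator {x \<in> space m. R k / 2 \<le> d z x} x * \<bar>f x\<bar> \<partial>m)"
      unfolding \<rho>_def \<tau>_def by (rule one_scale[OF f l f1 A B vol R])
  qed
  then have "(1 - \<rho>) * \<bar>\<integral>x. f x \<partial>m\<bar> \<le> 0" by (simp add: algebra_simps)
  then show ?thesis using \<rho> by (simp add: mult_le_0_iff)
qed

end

section \<open>The heat flow acts on eigenfunctions by scaling\<close>

context hilbertian_space
begin

text \<open>
Along a heat curve, \<open>\<phi> t = \<integral> f (u t)\<close> is locally Lipschitz, and by symmetry of the Laplacian it
satisfies \<open>\<phi>' = - l \<phi>\<close> almost everywhere. Therefore \<open>exp (l t) \<phi> t\<close> is constant, and its value is
found at time zero.
\<close>

lemma heat_curve_pairing:
  assumes f: "(\<lambda>x. l * f x) \<in> Ch_subdiff d m f" and l: "0 \<le> l"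
    and u: "heat_curve d m g u" and t: "t > 0"
  shows "(\<integral>x. f x * u t x \<partial>m) = exp (- (l * t)) * (\<integral>x. f x * g x \<partial>m)"
proof -
  have fL: "f \<in> L2 m" by (rule W12_L2[OF subdiffD(2)[OF f]])
  define N where "N = L2_norm m f"
  define \<phi> where "\<phi> s = (\<integral>x. f x * u s x \<partial>m)" for s
  define \<psi> where "\<psi> s = exp (l * s) * \<phi> s" for s
  have gL: "g \<in> L2 m" and uL: "\<And>s. 0 \<le> s \<Longrightarrow> u s \<in> L2 m"
    and u0: "((\<lambda>s. L2_norm m (\<lambda>x. u s x - g x)) \<longlongrightarrow> 0) (at_right 0)"
    and ulip: "\<And>a b. 0 < a \<Longrightarrow> a \<le> b \<Longrightarrow> \<exists>K. \<forall>s\<in>{a..b}. \<forall>t\<in>{a..b}. L2_norm m (\<lambda>x. u s x - u t x) \<le> K * \<bar>s - t\<bar>"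
    and uder: "AE t in lborel. t > 0 \<longrightarrow> (\<exists>w. is_Laplacian d m (u t) w \<and>
             ((\<lambda>s. L2_norm m (\<lambda>x. (u s x - u t x) / (s - t) - w x)) \<longlongrightarrow> 0) (at t))"
    using u unfolding heat_curve_def by auto
  have pair: "\<bar>(\<integral>x. f x * p x \<partial>m) - (\<integral>x. f x * r x \<partial>m)\<bar> \<le> N * L2_norm m (\<lambda>x. p x - r x)"
    if "p \<in> L2 m" "r \<in> L2 m" for p r
  proof -
    have "(\<integral>x. f x * p x \<partial>m) - (\<integral>x. f x * r x \<partial>m) = (\<integral>x. f x * (p x - r x) \<partial>m)"
      using L2_mult_integrable[OF fL] that by (simp add: right_diff_distrib)
    then show ?thesis using L2_cauchy_schwarz[OF fL L2_diff[OF that]] by (simp add: N_def)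
  qed
  have N0: "0 \<le> N" by (simp add: N_def)
  have philip: "\<exists>K\<ge>0. \<forall>s\<in>{a..b}. \<forall>t\<in>{a..b}. \<bar>\<phi> s - \<phi> t\<bar> \<le> K * \<bar>s - t\<bar>" if ab: "0 < a" "a \<le> b" for a b
  proof -
    obtain K where K: "\<forall>s\<in>{a..b}. \<forall>t\<in>{a..b}. L2_norm m (\<lambda>x. u s x - u t x) \<le> K * \<bar>s - t\<bar>"
      using ulip[OF ab] by blast
    have "\<bar>\<phi> s - \<phi> t\<bar> \<le> (N * \<bar>K\<bar>) * \<bar>s - t\<bar>" if st: "s \<in> {a..b}" "t \<in> {a..b}" for s t
    proof -
      have "\<bar>\<phi> s - \<phi> t\<bar> \<le> N * L2_norm m (\<lambda>x. u s x - u t x)"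
        unfolding \<phi>_def using st ab by (intro pair uL) auto
      also have "L2_norm m (\<lambda>x. u s x - u t x) \<le> \<bar>K\<bar> * \<bar>s - t\<bar>"
        using K st by (meson abs_ge_self abs_ge_zero mult_right_mono order_trans)
      finally show ?thesis using N0 by (simp add: mult_left_mono mult.assoc)
    qed
    then show ?thesis using N0 by (intro exI[of _ "N * \<bar>K\<bar>"]) auto
  qed
  have psilip: "\<exists>K. \<forall>s\<in>{a..b}. \<forall>t\<in>{a..b}. \<bar>\<psi> s - \<psi> t\<bar> \<le> K * \<bar>s - t\<bar>" if ab: "0 < a" "a \<le> b" for a b
  proof -
    obtain K where K0: "0 \<le> K" and K: "\<And>s t. s \<in> {a..b} \<Longrightarrow> t \<in> {a..b} \<Longrightarrow> \<bar>\<phi> s - \<phi> t\<bar> \<le> K * \<bar>s - t\<bar>"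
      using philip[OF ab] by blast
    define P where "P = \<bar>\<phi> a\<bar> + K * (b - a)"
    have P: "\<bar>\<phi> t\<bar> \<le> P" if "t \<in> {a..b}" for t
    proof -
      have "\<bar>\<phi> t - \<phi> a\<bar> \<le> K * \<bar>t - a\<bar>" using K[of t a] that ab by auto
      also have "\<dots> \<le> K * (b - a)" using K0 that by (intro mult_left_mono) auto
      finally show ?thesis unfolding P_def by linarith
    qed
    define Q where "Q = exp (l * b) * exp (l * b) * l"
    have Q: "\<bar>exp (l * s) - exp (l * t)\<bar> \<le> Q * \<bar>s - t\<bar>" if st: "s \<in> {a..b}" "t \<in> {a..b}" for s t
    proof -
      have "exp (l * s) - exp (l * t) = exp (l * t) * (exp (l * s - l * t) - 1)"
        by (simp add: right_diff_distrib flip: exp_add)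
      then have "\<bar>exp (l * s) - exp (l * t)\<bar> = exp (l * t) * \<bar>exp (l * s - l * t) - 1\<bar>" by (simp add: abs_mult)
      also have "\<dots> \<le> exp (l * t) * (exp \<bar>l * s - l * t\<bar> * \<bar>l * s - l * t\<bar>)"
        by (intro mult_left_mono abs_exp_minus_1_le) simp
      also have "\<bar>l * s - l * t\<bar> = l * \<bar>s - t\<bar>" using l by (simp add: abs_mult flip: right_diff_distrib)
      also have "exp (l * t) * (exp (l * \<bar>s - t\<bar>) * (l * \<bar>s - t\<bar>)) \<le> exp (l * b) * (exp (l * b) * (l * \<bar>s - t\<bar>))"
        using st ab l by (intro mult_mono mult_right_mono) (auto intro!: mult_left_mono)
      finally show ?thesis by (simp add: Q_def mult.assoc)
    qed
    have "\<bar>\<psi> s - \<psi> t\<bar> \<le> (exp (l * b) * K + P * Q) * \<bar>s - t\<bar>" if st: "s \<in> {a..b}" "t \<in> {a..b}" for s t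
    proof -
      have "\<psi> s - \<psi> t = exp (l * s) * (\<phi> s - \<phi> t) + \<phi> t * (exp (l * s) - exp (l * t))"
        by (simp add: \<psi>_def algebra_simps)
      also have "\<bar>\<dots>\<bar> \<le> exp (l * s) * \<bar>\<phi> s - \<phi> t\<bar> + \<bar>\<phi> t\<bar> * \<bar>exp (l * s) - exp (l * t)\<bar>"
        by (intro order_trans[OF abs_triangle_ineq]) (simp add: abs_mult)
      also have "\<dots> \<le> exp (l * b) * (K * \<bar>s - t\<bar>) + P * (Q * \<bar>s - t\<bar>)"
        using K[OF st] P[OF st(2)] Q[OF st] st l
        by (intro add_mono mult_mono) (auto intro!: mult_left_mono order_trans[OF abs_ge_zero P[OF st(2)]])
      finally show ?thesis by (simp add: algebra_simps)
    qed
    then show ?thesis by blast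
  qed
  have psider: "AE t in lborel. t > 0 \<longrightarrow> (\<psi> has_real_derivative 0) (at t)"
    using uder
  proof (rule AE_mp, intro AE_I2 impI)
    fix t :: real
    assume "t > 0 \<longrightarrow> (\<exists>w. is_Laplacian d m (u t) w \<and>
             ((\<lambda>s. L2_norm m (\<lambda>x. (u s x - u t x) / (s - t) - w x)) \<longlongrightarrow> 0) (at t))" and t: "t > 0"
    then obtain w where w: "is_Laplacian d m (u t) w"
      and lim: "((\<lambda>s. L2_norm m (\<lambda>x. (u s x - u t x) / (s - t) - w x)) \<longlongrightarrow> 0) (at t)" by blast
    have ws: "(\<lambda>x. - w x) \<in> Ch_subdiff d m (u t)" using w by (simp add: is_Laplacian_def)
    have wL: "w \<in> L2 m" using L2_cmult[OF subdiffD(1)[OF ws], of "-1"] by simp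
    have "(\<integral>x. l * f x * u t x \<partial>m) = (\<integral>x. - w x * f x \<partial>m)" by (rule subdiff_sym[OF f ws])
    moreover have "(\<integral>x. l * f x * u t x \<partial>m) = l * \<phi> t" by (simp add: \<phi>_def mult.assoc)
    moreover have "(\<integral>x. - w x * f x \<partial>m) = - (\<integral>x. f x * w x \<partial>m)" by (simp add: mult.commute)
    ultimately have wf: "(\<integral>x. f x * w x \<partial>m) = - l * \<phi> t" by simp
    have "((\<lambda>s. (\<phi> s - \<phi> t) / (s - t) - (\<integral>x. f x * w x \<partial>m)) \<longlongrightarrow> 0) (at t)"
    proof (rule Lim_null_comparison)
      have "eventually (\<lambda>s. s \<in> {0<..}) (at t)" using t by (intro eventually_at_in_open') auto
      moreover have "eventually (\<lambda>s. s \<noteq> t) (at t)" by (simp add: eventually_at_filter)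
      ultimately show "eventually (\<lambda>s. norm ((\<phi> s - \<phi> t) / (s - t) - (\<integral>x. f x * w x \<partial>m))
         \<le> N * L2_norm m (\<lambda>x. (u s x - u t x) / (s - t) - w x)) (at t)"
      proof eventually_elim
        case (elim s)
        have sL: "u s \<in> L2 m" "u t \<in> L2 m" using uL elim t by auto
        have qL: "(\<lambda>x. (u s x - u t x) / (s - t)) \<in> L2 m"
          using L2_cmult[OF L2_diff[OF sL], of "1 / (s - t)"] by simp
        have eq: "(\<integral>x. f x * ((u s x - u t x) / (s - t)) \<partial>m) = (\<phi> s - \<phi> t) / (s - t)"
          unfolding \<phi>_def using L2_mult_integrable[OF fL] sL by (simp add: right_diff_distrib)
        show ?case using pair[OF qL wL] unfolding eq real_norm_def .
      qed
      show "((\<lambda>s. N * L2_norm m (\<lambda>x. (u s x - u t x) / (s - t) - w x)) \<longlongrightarrow> 0) (at t)"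
        using tendsto_mult_left[OF lim, of N] by simp
    qed
    then have "((\<lambda>s. (\<phi> s - \<phi> t) / (s - t)) \<longlongrightarrow> - l * \<phi> t) (at t)"
      unfolding wf using LIM_zero_iff by blast
    then have "(\<phi> has_real_derivative - l * \<phi> t) (at t)" by (simp add: has_field_derivative_iff)
    then have "(\<psi> has_real_derivative (exp (l * t) * l) * \<phi> t + (- l * \<phi> t) * exp (l * t)) (at t)"
      unfolding \<psi>_def by (intro DERIV_mult) (auto intro!: derivative_eq_intros)
    then show "(\<psi> has_real_derivative 0) (at t)" by simp
  qed
  have const: "\<psi> s = \<psi> t" if "s \<in> {0<..t}" for s
    using locally_lipschitz_deriv_zero_const[OF psilip psider] that by auto
  have "((\<lambda>s. \<phi> s - (\<integral>x. f x * g x \<partial>m)) \<longlongrightarrow> 0) (at_right 0)"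
  proof (rule Lim_null_comparison)
    have "eventually (\<lambda>s. s \<in> {0<..<t}) (at_right 0)" using t by (rule eventually_at_right_real)
    then show "eventually (\<lambda>s. norm (\<phi> s - (\<integral>x. f x * g x \<partial>m)) \<le> N * L2_norm m (\<lambda>x. u s x - g x)) (at_right 0)"
      by (rule eventually_mono) (use pair[OF uL gL] in \<open>auto simp: \<phi>_def\<close>)
    show "((\<lambda>s. N * L2_norm m (\<lambda>x. u s x - g x)) \<longlongrightarrow> 0) (at_right 0)"
      using tendsto_mult_left[OF u0, of N] by simp
  qed
  then have "(\<phi> \<longlongrightarrow> (\<integral>x. f x * g x \<partial>m)) (at_right 0)" using LIM_zero_iff by blast
  then have "(\<psi> \<longlongrightarrow> exp (l * 0) * (\<integral>x. f x * g x \<partial>m)) (at_right 0)"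
    unfolding \<psi>_def by (intro tendsto_intros)
  moreover have "(\<psi> \<longlongrightarrow> \<psi> t) (at_right 0)"
  proof (rule tendsto_eventually)
    have "eventually (\<lambda>s. s \<in> {0<..<t}) (at_right 0)" using t by (rule eventually_at_right_real)
    then show "eventually (\<lambda>s. \<psi> s = \<psi> t) (at_right 0)"
      by (rule eventually_mono) (rule const, simp)
  qed
  ultimately have "\<psi> t = exp (l * 0) * (\<integral>x. f x * g x \<partial>m)"
    using tendsto_unique[OF trivial_limit_at_right_real] by blast
  then have "exp (l * t) * \<phi> t = (\<integral>x. f x * g x \<partial>m)" by (simp add: \<psi>_def)
  then have "\<phi> t = exp (- (l * t)) * (\<integral>x. f x * g x \<partial>m)" by (simp add: exp_minus field_simps)
  then show ?thesis by (simp add: \<phi>_def)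
qed

lemma heat_L1_pairing:
  assumes f: "(\<lambda>x. l * f x) \<in> Ch_subdiff d m f" and l: "0 \<le> l" and fi: "f \<in> Linf m"
    and h: "heat_L1 d m t g k" and t: "t > 0"
  shows "(\<integral>x. f x * k x \<partial>m) = exp (- (l * t)) * (\<integral>x. f x * g x \<partial>m)"
proof -
  obtain F G where FG: "\<And>j. heat_L2 d m t (F j) (G j)" "L1_converges m F g" "L1_converges m G k"
    using h unfolding heat_L1_def by auto
  have eq: "(\<integral>x. f x * G j x \<partial>m) = exp (- (l * t)) * (\<integral>x. f x * F j x \<partial>m)" for j
  proof -
    obtain u where u: "heat_curve d m (F j) u" "AE x in m. G j x = u t x" "G j \<in> L2 m"
      using FG(1)[of j] unfolding heat_L2_def by blast
    have uL: "u t \<in> L2 m" using u(1) t unfolding heat_curve_def by auto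
    have fL: "f \<in> L2 m" by (rule W12_L2[OF subdiffD(2)[OF f]])
    have "(\<integral>x. f x * G j x \<partial>m) = (\<integral>x. f x * u t x \<partial>m)"
    proof (rule integral_cong_AE)
      show "AE x in m. f x * G j x = f x * u t x" using u(2) by (rule AE_mp) simp
    qed (use L2_mult_integrable[OF fL u(3)] L2_mult_integrable[OF fL uL] in auto)
    then show ?thesis using heat_curve_pairing[OF f l u(1) t] by simp
  qed
  have "(\<lambda>j. exp (- (l * t)) * (\<integral>x. f x * F j x \<partial>m)) \<longlonglongrightarrow> exp (- (l * t)) * (\<integral>x. f x * g x \<partial>m)"
    by (intro tendsto_intros Linf_L1_tendsto fi FG)
  then show ?thesis
    using Linf_L1_tendsto[OF fi FG(3)] LIMSEQ_unique unfolding eq by blast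
qed

text \<open>
The pairings of both sides with any integrable function agree by duality; the difference of the two
sides, cut off to a ball, is itself an admissible test function.
\<close>

lemma heat_Linf_eigen:
  assumes f: "(\<lambda>x. l * f x) \<in> Ch_subdiff d m f" and l: "0 \<le> l"
    and h: "heat_Linf d m t f h" and t: "t > 0"
  shows "AE x in m. h x = exp (- (l * t)) * f x"
proof -
  have fi: "f \<in> Linf m" and hi: "h \<in> Linf m" using h by (auto simp: heat_Linf_def)
  have [measurable]: "f \<in> borel_measurable m" "h \<in> borel_measurable m" using fi hi by (auto simp: Linf_def)
  define p where "p x = h x - exp (- (l * t)) * f x" for x
  have [measurable]: "p \<in> borel_measurable m" unfolding p_def by measurable
  define C where "C = enn2real (Linf_norm m h) + exp (- (l * t)) * enn2real (Linf_norm m f)"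
  have pC: "AE x in m. \<bar>p x\<bar> \<le> C"
    using Linf_bound[OF fi] Linf_bound[OF hi]
  proof eventually_elim
    case (elim x)
    have "\<bar>p x\<bar> \<le> \<bar>h x\<bar> + exp (- (l * t)) * \<bar>f x\<bar>"
      unfolding p_def by (intro order_trans[OF abs_triangle_ineq4]) (simp add: abs_mult)
    also have "\<dots> \<le> C" unfolding C_def using elim by (intro add_mono mult_left_mono) auto
    finally show ?case .
  qed
  have zero: "(\<integral>x. g x * p x \<partial>m) = 0" if g: "integrable m g" for g
  proof -
    obtain k where k: "heat_L1 d m t g k" "(\<integral>x. g x * h x \<partial>m) = (\<integral>x. f x * k x \<partial>m)"
      using h g by (auto simp: heat_Linf_def L1_def)
    have "(\<integral>x. h x * g x \<partial>m) = exp (- (l * t)) * (\<integral>x. f x * g x \<partial>m)"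
      using k(2) heat_L1_pairing[OF f l fi k(1) t] by (simp add: mult.commute)
    moreover have "(\<integral>x. g x * p x \<partial>m) = (\<integral>x. h x * g x - exp (- (l * t)) * (f x * g x) \<partial>m)"
      by (intro Bochner_Integration.integral_cong refl) (simp add: p_def algebra_simps)
    ultimately show ?thesis
      using Linf_L1_integrable[OF hi g] Linf_L1_integrable[OF fi g] by simp
  qed
  have "AE x in m. indicator (mball z (real n)) x * (p x)\<^sup>2 = 0" for n
  proof -
    have bi: "integrable m (\<lambda>x. C * indicator (mball z (real n)) x)"
      using ball_finite[of "real n"] by (intro integrable_mult_right integrable_real_indicator) auto
    have gi: "integrable m (\<lambda>x. indicator (mball z (real n)) x * p x)"
      by (rule Bochner_Integration.integrable_bound[OF bi])
        (use pC in \<open>auto elim!: eventually_mono simp: indicator_def\<close>)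
    have bi2: "integrable m (\<lambda>x. C\<^sup>2 * indicator (mball z (real n)) x)"
      using ball_finite[of "real n"] by (intro integrable_mult_right integrable_real_indicator) auto
    have g2: "integrable m (\<lambda>x. indicator (mball z (real n)) x * (p x)\<^sup>2)"
    proof (rule Bochner_Integration.integrable_bound[OF bi2])
      show "AE x in m. norm (indicator (mball z (real n)) x * (p x)\<^sup>2) \<le> norm (C\<^sup>2 * indicator (mball z (real n)) x)"
        using pC
      proof eventually_elim
        case (elim x)
        then have "\<bar>p x\<bar>\<^sup>2 \<le> C\<^sup>2" by (intro power_mono) auto
        then show ?case by (simp add: indicator_def)
      qed
    qed measurable
    have "(\<integral>x. indicator (mball z (real n)) x * (p x)\<^sup>2 \<partial>m) = 0"
      using zero[OF gi] by (simp add: power2_eq_square mult.assoc)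
    then show ?thesis using g2 by (subst (asm) integral_nonneg_eq_0_iff_AE) auto
  qed
  then have "AE x in m. \<forall>n. indicator (mball z (real n)) x * (p x)\<^sup>2 = 0" unfolding AE_all_countable by blast
  then show ?thesis
  proof (rule AE_mp, intro AE_I2 impI)
    fix x assume x: "x \<in> space m" and *: "\<forall>n. indicator (mball z (real n)) x * (p x)\<^sup>2 = 0"
    obtain n :: nat where "d z x < real n" using reals_Archimedean2 by blast
    then have "p x = 0" using *[rule_format, of n] x z by simp
    then show "h x = exp (- (l * t)) * f x" by (simp add: p_def)
  qed
qed

end

section \<open>Perimeter of the positivity set\<close>

context metric_measure
begin

lemma Lip_const_lip:
  assumes "Lip_const d m h \<le> ennreal K" and K: "0 \<le> K"
  shows "lip K h"
  unfolding lip_def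
proof (intro conjI ballI K)
  fix x y assume x: "x \<in> space m" and y: "y \<in> space m"
  show "\<bar>h x - h y\<bar> \<le> K * d x y"
  proof (cases "x = y")
    case False
    have "ennreal (\<bar>h x - h y\<bar> / d x y) \<le> Lip_const d m h"
      unfolding Lip_const_def using x y False by (intro SUP_upper2[of x] SUP_upper2[of y]) auto
    also note assms(1)
    finally have "\<bar>h x - h y\<bar> / d x y \<le> K" using K by simp
    moreover have "0 < d x y" using x y False by simp
    ultimately show ?thesis by (simp add: pos_divide_le_eq)
  qed (use x in simp)
qed

lemma Ch_cong_AE:
  assumes eq: "AE x in m. f x = g x" and g: "g \<in> borel_measurable m" and f: "f \<in> L2 m"
  shows "g \<in> L2 m" "Ch d m g = Ch d m f"
proof -
  have [measurable]: "f \<in> borel_measurable m" "g \<in> borel_measurable m" using f g by auto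
  have "integrable m (\<lambda>x. (g x)\<^sup>2)"
    using L2_integrable_sq[OF f]
    by (rule integrable_cong_AE_imp) (use eq in \<open>auto elim: eventually_mono\<close>)
  then show gL: "g \<in> L2 m" by (simp add: L2_def)
  have "L2_norm m (\<lambda>x. F x - g x) = L2_norm m (\<lambda>x. F x - f x)" if F: "F \<in> L2 m" for F
  proof -
    have [measurable]: "F \<in> borel_measurable m" using F by (simp add: L2_def)
    show ?thesis unfolding L2_norm_def
      by (intro arg_cong[where f=sqrt] integral_cong_AE) (use eq in \<open>auto elim: eventually_mono\<close>)
  qed
  then have "L2_converges m F g \<longleftrightarrow> L2_converges m F f" for F
    unfolding L2_converges_def using gL f by auto
  then show "Ch d m g = Ch d m f" by (simp add: Ch_def)
qed

lemma subdiff_cong_AE: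
  assumes v: "v \<in> Ch_subdiff d m f" and eq: "AE x in m. f x = g x" and g: "g \<in> borel_measurable m"
  shows "v \<in> Ch_subdiff d m g"
proof -
  have fL: "f \<in> L2 m" and vL: "v \<in> L2 m" using subdiffD[OF v] W12_L2 by auto
  have [measurable]: "f \<in> borel_measurable m" "g \<in> borel_measurable m" "v \<in> borel_measurable m" using fL g vL by auto
  note C = Ch_cong_AE[OF eq g fL]
  have "(\<integral>x. v x * (k x - g x) \<partial>m) = (\<integral>x. v x * (k x - f x) \<partial>m)" if k: "k \<in> L2 m" for k
  proof -
    have [measurable]: "k \<in> borel_measurable m" using k by auto
    show ?thesis by (intro integral_cong_AE) (use eq in \<open>auto elim: eventually_mono\<close>)
  qed
  then show ?thesis using v C unfolding Ch_subdiff_def W12_def by auto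
qed

text \<open>
Apply \<open>subdiff_lip_le\<close> to each member of a sequence that is admissible in the definition of the total
variation of the indicator, and pass to the limit. The bound \<open>L'\<close> is separated from the Lipschitz
constant \<open>L\<close> only so as to be positive.
\<close>

lemma eigenfunction_perimeter_bound:
  assumes f: "(\<lambda>x. l * f x) \<in> Ch_subdiff d m f" and fi: "f \<in> Linf m" and f1: "integrable m f"
    and mean: "(\<integral>x. f x \<partial>m) = 0"
    and eq: "AE x in m. f x = g x" and g: "lip L g" and L: "L \<le> L'" "0 < L'" and l: "0 \<le> l"
  shows "ennreal (l / (2 * L') * (\<integral>x. \<bar>f x\<bar> \<partial>m)) \<le> Per d m {x \<in> space m. f x > 0}"
proof -
  let ?E = "{x \<in> space m. f x > 0}"
  have [measurable]: "f \<in> borel_measurable m" using f1 by auto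
  have sub: "(\<lambda>x. l * f x) \<in> Ch_subdiff d m g"
    by (rule subdiff_cong_AE[OF f eq lip_measurable[OF g]])
  have iE: "integrable m (\<lambda>x. f x * indicator ?E x)"
    by (rule integrable_real_mult_indicator[OF _ f1]) measurable
  \<comment> \<open>\<open>|f|\<close> is twice the positive part of \<open>f\<close> minus \<open>f\<close>, and \<open>f\<close> has mean zero.\<close>
  have "(\<integral>x. \<bar>f x\<bar> \<partial>m) = (\<integral>x. 2 * (f x * indicator ?E x) - f x \<partial>m)"
    by (intro Bochner_Integration.integral_cong refl) (auto simp: indicator_def)
  also have "\<dots> = 2 * (\<integral>x. f x * indicator ?E x \<partial>m)" using iE f1 mean by simp
  finally have half: "(\<integral>x. \<bar>f x\<bar> \<partial>m) = 2 * (\<integral>x. f x * indicator ?E x \<partial>m)" .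
  have "ennreal (l / (2 * L') * (\<integral>x. \<bar>f x\<bar> \<partial>m)) \<le> TV d m (indicator ?E)"
    unfolding TV_def
  proof (rule INF_greatest)
    fix F assume "F \<in> {F. (\<forall>k. F k \<in> Lip_bs d m) \<and> L1_converges m F (indicator ?E)}"
    then have F: "\<And>k. F k \<in> Lip_bs d m" "L1_converges m F (indicator ?E)" by auto
    have "(\<lambda>k. ennreal (l / L' * (\<integral>x. f x * F k x \<partial>m))) \<longlonglongrightarrow> ennreal (l / L' * (\<integral>x. f x * indicator ?E x \<partial>m))"
      by (intro tendsto_ennrealI tendsto_mult_left Linf_L1_tendsto fi F)
    then have "liminf (\<lambda>k. ennreal (l / L' * (\<integral>x. f x * F k x \<partial>m))) = ennreal (l / L' * (\<integral>x. f x * indicator ?E x \<partial>m))"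
      by (intro lim_imp_Liminf) auto
    moreover have "liminf (\<lambda>k. ennreal (l / L' * (\<integral>x. f x * F k x \<partial>m))) \<le> liminf (\<lambda>k. \<integral>\<^sup>+x. slope d m (F k) x \<partial>m)"
    proof (intro Liminf_mono always_eventually allI)
      fix k
      have "l * (\<integral>x. f x * F k x \<partial>m) = (\<integral>x. l * f x * F k x \<partial>m)" by (simp add: mult.assoc)
      also have "\<dots> \<le> L * (\<integral>x. rslope (F k) x \<partial>m)" by (rule subdiff_lip_le[OF sub g F(1)])
      also have "\<dots> \<le> L' * (\<integral>x. rslope (F k) x \<partial>m)"
        using L by (intro mult_right_mono integral_nonneg_AE) auto
      finally have "l / L' * (\<integral>x. f x * F k x \<partial>m) \<le> (\<integral>x. rslope (F k) x \<partial>m)"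
        using L(2) by (simp add: field_simps)
      then show "ennreal (l / L' * (\<integral>x. f x * F k x \<partial>m)) \<le> (\<integral>\<^sup>+x. slope d m (F k) x \<partial>m)"
        unfolding nn_slope[OF F(1)] by (rule ennreal_leI)
    qed
    ultimately show "ennreal (l / (2 * L') * (\<integral>x. \<bar>f x\<bar> \<partial>m)) \<le> liminf (\<lambda>k. \<integral>\<^sup>+x. slope d m (F k) x \<partial>m)"
      by (simp add: half)
  qed
  then show ?thesis by (simp add: Per_def)
qed

end

theorem theorem4p4:
  fixes M b l0 :: real
  assumes "0 \<le> M" and "0 < b" and "b < 1" and "0 < l0"
  shows "\<exists>C>0. \<forall>(d :: 'a \<Rightarrow> 'a \<Rightarrow> real) (m :: 'a measure) (c :: real \<Rightarrow> real).
           standing_mms d m \<and> contraction_function c \<and> Linf_to_Lip_contraction d m c \<and>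
           (\<forall>t\<in>{0<..1}. c t \<le> M * t powr (- b)) \<longrightarrow>
           (\<forall>l f. l0 \<le> l \<and> eigenfunction d m l f \<and> f \<in> L1 m \<longrightarrow>
              Per d m {x \<in> space m. f x > 0}
                \<ge> ennreal (C * l powr (1 - b)) * (L1_norm m f / Linf_norm m f))"
proof -
  \<comment> \<open>The contraction property is used at time \<open>s / l\<close>, which lies in the interval \<open>(0, 1]\<close> since \<open>s \<le> l0 \<le> l\<close>.\<close>
  define s where "s = min 1 l0"
  have s: "0 < s" "s \<le> 1" "s \<le> l0" using assms by (auto simp: s_def)
  define C where "C = s powr b / (2 * exp 1 * (M + 1))"
  have C: "C > 0" using s assms by (simp add: C_def)
  have main: "Per d m {x \<in> space m. f x > 0} \<ge> ennreal (C * l powr (1 - b)) * (L1_norm m f / Linf_norm m f)"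
    if mms: "standing_mms d m" and c: "contraction_function c" and con: "Linf_to_Lip_contraction d m c"
      and cM: "\<forall>t\<in>{0<..1}. c t \<le> M * t powr (- b)"
      and l: "l0 \<le> l" and ef: "eigenfunction d m l f" and f1: "f \<in> L1 m"
    for d :: "'a \<Rightarrow> 'a \<Rightarrow> real" and m :: "'a measure" and c l f
  proof (cases "Linf_norm m f = \<infinity>")
    case True
    then show ?thesis by simp
  next
    case False
    obtain A B z where AB: "A > 0" "B > 0" "z \<in> space m"
      and vol: "\<And>r. r > 0 \<Longrightarrow> emeasure m {x \<in> space m. d x z < r} \<le> ennreal (A * exp (B * r\<^sup>2))"
      using mms unfolding standing_mms_def by blast
    interpret Metric_space "space m" d using mms by (simp add: standing_mms_def)
    have ball: "mball z r = {x \<in> space m. d x z < r}" for r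
      using AB(3) commute by (auto simp: mball_def)
    have vol': "emeasure m (mball z r) \<le> ennreal (A * exp (B * r\<^sup>2))" if "r > 0" for r
      unfolding ball by (rule vol[OF that])
    interpret hilbertian_space m d z
    proof
      show "borel_sets_of d m \<subseteq> sets m" using mms by (simp add: standing_mms_def borel_regular_def)
      show "z \<in> space m" by fact
      show "emeasure m (mball z r) < \<infinity>" for r
      proof (cases "r > 0")
        case True
        show ?thesis using vol'[OF True] by (rule le_less_trans) simp
      next
        case False
        then have "mball z r = {}" using mball_eq_empty by auto
        then show ?thesis by simp
      qed
      show "infinitesimally_Hilbertian d m" using mms by (simp add: standing_mms_def)
    qed
    have l0: "0 < l" using l assms by simp
    have f1: "integrable m f" using f1 by (simp add: L1_def)
    then have [measurable]: "f \<in> borel_measurable m" by auto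
    have fi: "f \<in> Linf m" using False by (simp add: Linf_def less_top)
    have sub: "(\<lambda>x. l * f x) \<in> Ch_subdiff d m f" using ef by (simp add: eigenfunction_def is_Laplacian_def)
    define N where "N = enn2real (Linf_norm m f)"
    have LN: "Linf_norm m f = ennreal N" unfolding N_def using False by (simp add: less_top)
    have "N \<noteq> 0"
    proof
      assume "N = 0"
      then have "AE x in m. f x = 0" using Linf_bound[OF fi] unfolding N_def by simp
      then show False using ef by (simp add: eigenfunction_def)
    qed
    then have N: "N > 0" unfolding N_def using enn2real_nonneg less_le by metis
    have L1: "L1_norm m f = ennreal (\<integral>x. \<bar>f x\<bar> \<partial>m)"
      unfolding L1_norm_def using f1 by (intro nn_integral_eq_integral) auto
    define t where "t = s / l"
    have t: "0 < t" "t \<le> 1" using s l l0 by (auto simp: t_def)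
    have lt: "l * t = s" using l0 by (simp add: t_def)
    obtain h where h: "heat_Linf d m t f h" "Lip_const d m h \<le> ennreal (c t) * Linf_norm m f"
      using con fi t unfolding Linf_to_Lip_contraction_def by blast
    have ct: "0 < c t" using c t by (simp add: contraction_function_def)
    have "Lip_const d m h \<le> ennreal (c t * N)" using h(2) ct N by (simp add: LN ennreal_mult)
    then have hl: "lip (c t * N) h" using ct N by (intro Lip_const_lip) auto
    define g where "g x = exp s * h x" for x
    have gl: "lip (\<bar>exp s\<bar> * (c t * N)) g" unfolding g_def by (rule lip_cmult[OF hl])
    have "AE x in m. h x = exp (- (l * t)) * f x" by (rule heat_Linf_eigen[OF sub _ h(1) t(1)]) (use l0 in simp)
    then have fg: "AE x in m. f x = g x"
      by (rule AE_mp) (simp add: g_def lt flip: mult.assoc exp_add)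
    define L' where "L' = exp 1 * (M + 1) * (l powr b / s powr b) * N"
    have L': "0 < L'" using assms l0 s N by (simp add: L'_def)
    have LL: "\<bar>exp s\<bar> * (c t * N) \<le> L'"
    proof -
      have "c t \<le> M * t powr (- b)" using cM t by simp
      also have "t powr (- b) = l powr b / s powr b"
        using s l0 by (simp add: t_def powr_minus powr_divide inverse_eq_divide)
      also have "M * (l powr b / s powr b) \<le> (M + 1) * (l powr b / s powr b)" by (intro mult_right_mono) auto
      finally have "exp s * (c t * N) \<le> exp 1 * ((M + 1) * (l powr b / s powr b) * N)"
        using s N ct by (intro mult_mono mult_right_mono) auto
      then show ?thesis by (simp add: L'_def mult.assoc)
    qed
    have mean: "(\<integral>x. f x \<partial>m) = 0" by (rule eigenfunction_mean_zero[OF sub l0 f1 AB(1,2) vol'])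
    have "ennreal (C * l powr (1 - b)) * (L1_norm m f / Linf_norm m f)
       = ennreal (C * l powr (1 - b) * ((\<integral>x. \<bar>f x\<bar> \<partial>m) / N))"
      unfolding L1 LN using N C
      by (subst divide_ennreal, simp, simp, intro ennreal_mult[symmetric]) auto
    also have "C * l powr (1 - b) * ((\<integral>x. \<bar>f x\<bar> \<partial>m) / N) = l / (2 * L') * (\<integral>x. \<bar>f x\<bar> \<partial>m)"
      using l0 s N assms by (simp add: C_def L'_def powr_diff field_simps)
    also have "ennreal \<dots> \<le> Per d m {x \<in> space m. f x > 0}"
      by (rule eigenfunction_perimeter_bound[OF sub fi f1 mean fg gl LL L']) (use l0 in simp)
    finally show ?thesis .
  qed
  show ?thesis
    using C main by (intro exI[of _ C]) blast
qed

end
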